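(* Let $v:P_{\Delta}\times\mathbb{R}^n\to\mathbb{R}^n$ satisfy all of conditions (A1) and (A2), and in addition at least one of the conditions (A3), (A4) (all stated in the context). Then the nonlinear Volterra integral operator $V:AC_0^2\to AC_0^2$, $$V(x)(t)=x(t)+\int_{\alpha}^{t}v(t,\tau,x(\tau))\,d\tau,\qquad t\in[\alpha,\beta],$$ is a diffeomorphism.
   Context: Let $\alpha<\beta$ be real, $n\ge 1$, $P_{\Delta}=\{(t,\tau)\in[\alpha,\beta]\times[\alpha,\beta]:\tau\le t\}$. $AC_0^2=AC_0^2([\alpha,\beta],\mathbb{R}^n)$ is the space of absolutely continuous $x:[\alpha,\beta]\to\mathbb{R}^n$ with $x(\alpha)=0$ and $x'\in L^2([\alpha,\beta],\mathbb{R}^n)$, with norm $\|x\|_{AC_0^2}^2=\int_\alpha^\beta|x'(t)|^2dt$. An operator $V:X\to X$ on a Banach space $X$ is called a diffeomorphism if $V(X)=X$, there exists an inverse operator $V^{-1}:X\to X$, and $V$ and $V^{-1}$ are Fréchet differentiable at every point of $X$. For $v:P_\Delta\times\mathbb{R}^n\to\mathbb{R}^n$, $v=v(t,\tau,x)$, subscripts denote partial derivatives (one-sided in $t$ at endpoints). A function $w(t,\tau,x)$ is called locally bounded with respect to $x$ if for every $\rho>0$ there is $l_\rho>0$ with $|w(t,\tau,x)|\le l_\rho$ for all $(t,\tau)\in P_\Delta$ and $|x|\le\rho$. Conditions involving derivatives of $v$ are understood for those $\tau$ (a.e.) for which the derivatives exist. Conditions: (A1) For a.e. $\tau\in[\alpha,\beta]$: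 the function $v(\cdot,\tau,\cdot)$ is continuous, and the partial derivatives $v_t(\cdot,\tau,\cdot)$, $v_x(\cdot,\tau,\cdot)$, $v_{tx}(\cdot,\tau,\cdot)$ exist and are continuous, in $(t,x)\in[\tau,\beta]\times\mathbb{R}^n$. (A2) Each of $v,\ v_t,\ v_x,\ v_{tx}$ is measurable with respect to $\tau$ and locally bounded with respect to $x$. (A3) (a) $v(t,t,x)=0$ for all $t\in[\alpha,\beta]$, $x\in\mathbb{R}^n$; (b) $|v_t(t,\tau,x)|\le c_0(t,\tau)|x|+d_0(t,\tau)$ for $(t,\tau)\in P_\Delta$, $x\in\mathbb{R}^n$, where $c_0,d_0\in L^2(P_\Delta,\mathbb{R}^+)$; (c) $\|c_0\|_{L^2(P_\Delta,\mathbb{R}^+)}<\frac{\sqrt2}{2(\beta-\alpha)}$. (A4) (a) $|v(t,t,x)|\le c_1(t)|x|+d_1(t)$ for $t\in[\alpha,\beta]$, $x\in\mathbb{R}^n$, where $c_1,d_1\in L^2([\alpha,\beta],\mathbb{R}^+)$; (b) $|v_t(t,\tau,x)|\le c_2(t,\tau)|x|+d_2(t,\tau)$ for $(t,\tau)\in P_\Delta$, $x\in\mathbb{R}^n$, where $c_2,d_2\in L^2(P_\Delta,\mathbb{R}^+)$; (c) $\|\tilde c\|_{L^2([\alpha,\beta],\mathbb{R}^+)}<\frac12$, where $\tilde c(t)=(t-\alpha)^{1/2}c_1(t)+\frac{1}{\sqrt2}(\beta-\alpha)\left(\int_\alpha^t c_2^2(t,\tau)\,d\tau\right)^{1/2}$.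 *)

theory Defs
  imports "HOL-Analysis.Analysis"
begin

section \<open>The space of absolutely continuous functions with square integrable derivative\<close>

definition L2 :: "'a::euclidean_space set \<Rightarrow> ('a \<Rightarrow> 'b::euclidean_space) set" where
  "L2 S = {f. set_borel_measurable lebesgue S f \<and>
              set_integrable lebesgue S (\<lambda>x. (norm (f x))\<^sup>2)}"

definition L2_nonneg :: "'a::euclidean_space set \<Rightarrow> ('a \<Rightarrow> real) set" where
  "L2_nonneg S = {f \<in> L2 S. \<forall>x\<in>S. 0 \<le> f x}"

definition L2_norm :: "'a::euclidean_space set \<Rightarrow> ('a \<Rightarrow> 'b::euclidean_space) \<Rightarrow> real" where
  "L2_norm S f = sqrt (LINT x:S|lebesgue. (norm (f x))\<^sup>2)"

definition abs_continuous_on_interval :: "real \<Rightarrow> real \<Rightarrow> (real \<Rightarrow> 'a::real_normed_vector) \<Rightarrow> bool" where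
  "abs_continuous_on_interval \<alpha> \<beta> f \<longleftrightarrow>
     (\<forall>\<epsilon>>0. \<exists>\<delta>>0. \<forall>D :: (real \<times> real) set.
        finite D \<and> (\<forall>(a, b)\<in>D. \<alpha> \<le> a \<and> a < b \<and> b \<le> \<beta>) \<and>
        disjoint_family_on (\<lambda>(a, b). {a<..<b}) D \<and>
        (\<Sum>(a, b)\<in>D. b - a) < \<delta>
        \<longrightarrow> (\<Sum>(a, b)\<in>D. norm (f b - f a)) < \<epsilon>)"

text \<open>The almost everywhere existing derivative \<open>x'\<close>, one-sided at the endpoints.\<close>

definition interval_deriv :: "real \<Rightarrow> real \<Rightarrow> (real \<Rightarrow> 'a::real_normed_vector) \<Rightarrow> real \<Rightarrow> 'a" where
  "interval_deriv \<alpha> \<beta> x t = vector_derivative x (at t within {\<alpha>..\<beta>})"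

text \<open>A function on \<open>[\<alpha>, \<beta>]\<close> is represented by its extension by zero to the real line, so that
  equality of functions on \<open>[\<alpha>, \<beta>]\<close> is equality in HOL and the set is a linear subspace of the
  functions on the real line with pointwise operations.\<close>

definition AC02 :: "real \<Rightarrow> real \<Rightarrow> (real \<Rightarrow> 'a::euclidean_space) set" where
  "AC02 \<alpha> \<beta> = {x. abs_continuous_on_interval \<alpha> \<beta> x \<and> x \<alpha> = 0 \<and>
                   interval_deriv \<alpha> \<beta> x \<in> L2 {\<alpha>..\<beta>} \<and> (\<forall>t. t \<notin> {\<alpha>..\<beta>} \<longrightarrow> x t = 0)}"

definition AC02_norm :: "real \<Rightarrow> real \<Rightarrow> (real \<Rightarrow> 'a::euclidean_space) \<Rightarrow> real" where
  "AC02_norm \<alpha> \<beta> x = L2_norm {\<alpha>..\<beta>} (interval_deriv \<alpha> \<beta> x)"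

section \<open>Diffeomorphisms of a normed function space\<close>

text \<open>Since \<open>AC02 \<alpha> \<beta>\<close> depends on \<open>\<alpha>\<close> and \<open>\<beta>\<close>, it cannot be made a type of class \<open>banach\<close>.
  The notions below are therefore relative to a linear subspace \<open>X\<close> of a space of functions,
  with pointwise operations and a norm \<open>N\<close> on \<open>X\<close>.\<close>

definition bounded_linear_in ::
  "('a \<Rightarrow> 'b::real_vector) set \<Rightarrow> (('a \<Rightarrow> 'b) \<Rightarrow> real) \<Rightarrow> (('a \<Rightarrow> 'b) \<Rightarrow> 'a \<Rightarrow> 'b) \<Rightarrow> bool" where
  "bounded_linear_in X N L \<longleftrightarrow>
     (\<forall>x\<in>X. L x \<in> X) \<and>
     (\<forall>x\<in>X. \<forall>y\<in>X. L (\<lambda>s. x s + y s) = (\<lambda>s. L x s + L y s)) \<and>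
     (\<forall>c. \<forall>x\<in>X. L (\<lambda>s. c *\<^sub>R x s) = (\<lambda>s. c *\<^sub>R L x s)) \<and>
     (\<exists>K. \<forall>x\<in>X. N (L x) \<le> K * N x)"

definition frechet_differentiable_in ::
  "('a \<Rightarrow> 'b::real_vector) set \<Rightarrow> (('a \<Rightarrow> 'b) \<Rightarrow> real) \<Rightarrow> (('a \<Rightarrow> 'b) \<Rightarrow> 'a \<Rightarrow> 'b) \<Rightarrow> ('a \<Rightarrow> 'b) \<Rightarrow> bool"
  where
  "frechet_differentiable_in X N F x \<longleftrightarrow>
     (\<exists>L. bounded_linear_in X N L \<and>
        (\<forall>\<epsilon>>0. \<exists>\<delta>>0. \<forall>h\<in>X. N h < \<delta> \<longrightarrow>
           N (\<lambda>s. F (\<lambda>r. x r + h r) s - F x s - L h s) \<le> \<epsilon> * N h))"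

definition diffeomorphism_in ::
  "('a \<Rightarrow> 'b::real_vector) set \<Rightarrow> (('a \<Rightarrow> 'b) \<Rightarrow> real) \<Rightarrow> (('a \<Rightarrow> 'b) \<Rightarrow> 'a \<Rightarrow> 'b) \<Rightarrow> bool" where
  "diffeomorphism_in X N V \<longleftrightarrow>
     V ` X = X \<and>
     (\<exists>W. (\<forall>y\<in>X. W y \<in> X) \<and> (\<forall>x\<in>X. W (V x) = x) \<and> (\<forall>y\<in>X. V (W y) = y) \<and>
          (\<forall>x\<in>X. frechet_differentiable_in X N V x) \<and>
          (\<forall>y\<in>X. frechet_differentiable_in X N W y))"

section \<open>The kernel and its partial derivatives\<close>

text \<open>A kernel \<open>v(t, \<tau>, x)\<close> is a curried total function; only its values at
  \<open>(t, \<tau>) \<in> P_tri \<alpha> \<beta>\<close> are used. For fixed \<open>\<tau>\<close> the variable \<open>t\<close> ranges over \<open>[\<tau>, \<beta>]\<close>.\<close>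

definition P_tri :: "real \<Rightarrow> real \<Rightarrow> (real \<times> real) set" where
  "P_tri \<alpha> \<beta> = {(t, \<tau>). t \<in> {\<alpha>..\<beta>} \<and> \<tau> \<in> {\<alpha>..\<beta>} \<and> \<tau> \<le> t}"

type_synonym 'n kernel = "real \<Rightarrow> real \<Rightarrow> real^'n \<Rightarrow> real^'n"

definition d_t :: "real \<Rightarrow> 'n::finite kernel \<Rightarrow> 'n kernel" where
  "d_t \<beta> v t \<tau> x = vector_derivative (\<lambda>s. v s \<tau> x) (at t within {\<tau>..\<beta>})"

definition d_x :: "'n::finite kernel \<Rightarrow> real \<Rightarrow> real \<Rightarrow> real^'n \<Rightarrow> real^'n^'n" where
  "d_x v t \<tau> x = matrix (frechet_derivative (\<lambda>y. v t \<tau> y) (at x))"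

definition d_tx :: "real \<Rightarrow> 'n::finite kernel \<Rightarrow> real \<Rightarrow> real \<Rightarrow> real^'n \<Rightarrow> real^'n^'n" where
  "d_tx \<beta> v = d_x (d_t \<beta> v)"

definition cond_A1 :: "real \<Rightarrow> real \<Rightarrow> 'n::finite kernel \<Rightarrow> bool" where
  "cond_A1 \<alpha> \<beta> v \<longleftrightarrow>
     (AE \<tau>\<in>{\<alpha>..\<beta>} in lebesgue.
        continuous_on ({\<tau>..\<beta>} \<times> UNIV) (\<lambda>(t, x). v t \<tau> x) \<and>
        (\<forall>t\<in>{\<tau>..\<beta>}. \<forall>x. (\<lambda>s. v s \<tau> x) differentiable (at t within {\<tau>..\<beta>})) \<and>
        continuous_on ({\<tau>..\<beta>} \<times> UNIV) (\<lambda>(t, x). d_t \<beta> v t \<tau> x) \<and>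
        (\<forall>t\<in>{\<tau>..\<beta>}. \<forall>x. (\<lambda>y. v t \<tau> y) differentiable (at x)) \<and>
        continuous_on ({\<tau>..\<beta>} \<times> UNIV) (\<lambda>(t, x). d_x v t \<tau> x) \<and>
        (\<forall>t\<in>{\<tau>..\<beta>}. \<forall>x. (\<lambda>y. d_t \<beta> v t \<tau> y) differentiable (at x)) \<and>
        continuous_on ({\<tau>..\<beta>} \<times> UNIV) (\<lambda>(t, x). d_tx \<beta> v t \<tau> x))"

definition measurable_in_tau ::
  "real \<Rightarrow> real \<Rightarrow> (real \<Rightarrow> real \<Rightarrow> 'a \<Rightarrow> 'b::euclidean_space) \<Rightarrow> bool" where
  "measurable_in_tau \<alpha> \<beta> w \<longleftrightarrow>
     (\<forall>t\<in>{\<alpha>..\<beta>}. \<forall>x. set_borel_measurable lebesgue {\<alpha>..t} (\<lambda>\<tau>. w t \<tau> x))"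

definition locally_bounded_in_x ::
  "real \<Rightarrow> real \<Rightarrow> (real \<Rightarrow> real \<Rightarrow> 'a::real_normed_vector \<Rightarrow> 'b::real_normed_vector) \<Rightarrow> bool" where
  "locally_bounded_in_x \<alpha> \<beta> w \<longleftrightarrow>
     (\<forall>\<rho>>0. \<exists>l>0. \<forall>(t, \<tau>)\<in>P_tri \<alpha> \<beta>. \<forall>x. norm x \<le> \<rho> \<longrightarrow> norm (w t \<tau> x) \<le> l)"

text \<open>For the partial derivatives, which exist only for almost every \<open>\<tau>\<close>, pointwise conditions are
  imposed for almost every \<open>\<tau>\<close>, and then for all \<open>t \<in> [\<tau>, \<beta>]\<close> and all \<open>x\<close>.\<close>

definition ae_locally_bounded_in_x ::
  "real \<Rightarrow> real \<Rightarrow> (real \<Rightarrow> real \<Rightarrow> 'a::real_normed_vector \<Rightarrow> 'b::real_normed_vector) \<Rightarrow> bool" where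
  "ae_locally_bounded_in_x \<alpha> \<beta> w \<longleftrightarrow>
     (\<forall>\<rho>>0. \<exists>l>0. AE \<tau>\<in>{\<alpha>..\<beta>} in lebesgue.
        \<forall>t\<in>{\<tau>..\<beta>}. \<forall>x. norm x \<le> \<rho> \<longrightarrow> norm (w t \<tau> x) \<le> l)"

definition cond_A2 :: "real \<Rightarrow> real \<Rightarrow> 'n::finite kernel \<Rightarrow> bool" where
  "cond_A2 \<alpha> \<beta> v \<longleftrightarrow>
     measurable_in_tau \<alpha> \<beta> v \<and> locally_bounded_in_x \<alpha> \<beta> v \<and>
     measurable_in_tau \<alpha> \<beta> (d_t \<beta> v) \<and> ae_locally_bounded_in_x \<alpha> \<beta> (d_t \<beta> v) \<and>
     measurable_in_tau \<alpha> \<beta> (d_x v) \<and> ae_locally_bounded_in_x \<alpha> \<beta> (d_x v) \<and>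
     measurable_in_tau \<alpha> \<beta> (d_tx \<beta> v) \<and> ae_locally_bounded_in_x \<alpha> \<beta> (d_tx \<beta> v)"

definition d_t_linear_growth ::
  "real \<Rightarrow> real \<Rightarrow> 'n::finite kernel \<Rightarrow> (real \<times> real \<Rightarrow> real) \<Rightarrow> (real \<times> real \<Rightarrow> real) \<Rightarrow> bool" where
  "d_t_linear_growth \<alpha> \<beta> v c d \<longleftrightarrow>
     (AE \<tau>\<in>{\<alpha>..\<beta>} in lebesgue.
        \<forall>t\<in>{\<tau>..\<beta>}. \<forall>x. norm (d_t \<beta> v t \<tau> x) \<le> c (t, \<tau>) * norm x + d (t, \<tau>))"

definition cond_A3 :: "real \<Rightarrow> real \<Rightarrow> 'n::finite kernel \<Rightarrow> bool" where
  "cond_A3 \<alpha> \<beta> v \<longleftrightarrow>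
     (\<forall>t\<in>{\<alpha>..\<beta>}. \<forall>x. v t t x = 0) \<and>
     (\<exists>c0 \<in> L2_nonneg (P_tri \<alpha> \<beta>). \<exists>d0 \<in> L2_nonneg (P_tri \<alpha> \<beta>).
        d_t_linear_growth \<alpha> \<beta> v c0 d0 \<and>
        L2_norm (P_tri \<alpha> \<beta>) c0 < sqrt 2 / (2 * (\<beta> - \<alpha>)))"

text \<open>By Fubini, the inner integral is finite for almost every \<open>t\<close> if \<open>c2\<close> is square integrable
  over the triangle, and then \<open>c_tilde \<alpha> \<beta> c1 c2\<close> is square integrable.\<close>

definition c_tilde :: "real \<Rightarrow> real \<Rightarrow> (real \<Rightarrow> real) \<Rightarrow> (real \<times> real \<Rightarrow> real) \<Rightarrow> real \<Rightarrow> real" where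
  "c_tilde \<alpha> \<beta> c1 c2 t =
     sqrt (t - \<alpha>) * c1 t +
     1 / sqrt 2 * (\<beta> - \<alpha>) * sqrt (LINT \<tau>:{\<alpha>..t}|lebesgue. (c2 (t, \<tau>))\<^sup>2)"

definition cond_A4 :: "real \<Rightarrow> real \<Rightarrow> 'n::finite kernel \<Rightarrow> bool" where
  "cond_A4 \<alpha> \<beta> v \<longleftrightarrow>
     (\<exists>c1 \<in> L2_nonneg {\<alpha>..\<beta>}. \<exists>d1 \<in> L2_nonneg {\<alpha>..\<beta>}.
      \<exists>c2 \<in> L2_nonneg (P_tri \<alpha> \<beta>). \<exists>d2 \<in> L2_nonneg (P_tri \<alpha> \<beta>).
        (\<forall>t\<in>{\<alpha>..\<beta>}. \<forall>x. norm (v t t x) \<le> c1 t * norm x + d1 t) \<and>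
        d_t_linear_growth \<alpha> \<beta> v c2 d2 \<and>
        L2_norm {\<alpha>..\<beta>} (c_tilde \<alpha> \<beta> c1 c2) < 1 / 2)"

section \<open>The Volterra operator\<close>

definition volterra ::
  "real \<Rightarrow> real \<Rightarrow> 'n::finite kernel \<Rightarrow> (real \<Rightarrow> real^'n) \<Rightarrow> real \<Rightarrow> real^'n" where
  "volterra \<alpha> \<beta> v x t =
     (if t \<in> {\<alpha>..\<beta>} then x t + (LINT \<tau>:{\<alpha>..t}|lebesgue. v t \<tau> (x \<tau>)) else 0)"

end

(*
  A function x in AC02 is the primitive of a square integrable function u = x', with norm the L2 norm
  of u; this rests on Lebesgue's differentiation theorem and on the fact that absolutely continuous
  functions are primitives. Since v is continuously differentiable in t, Fubini's theorem gives
    V(x)' = x' + F(x),  F(x)(s) = v(s,s,x(s)) + integral over [alpha,s] of v_t(s,tau,x(tau)).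
  Condition (A3) is the case c_1 = d_1 = 0 of (A4), and under (A4) the Cauchy-Schwarz inequality yields
  |F(x)| <= k |x| + D with k < 1/2, hence an a priori bound for |x| in terms of |V(x)|.
  To solve V(x) = y, compose the coefficients with the retraction onto a large ball. The equation then
  becomes globally Lipschitz and causal, so that it is solved by a contraction in an exponentially
  weighted supremum norm, and by the a priori bound its solution never leaves the ball. A Gronwall
  argument gives uniqueness and a Lipschitz estimate for the inverse of V on bounded sets. The same two
  arguments invert the linearised operator. Dominated convergence shows that V is differentiable, and
  then so is its inverse.
*)
theory Submission
  imports Defs
begin

text \<open>Two obstacles shape the setup. The hypotheses hold only for almost every \<tau>, with
  exceptional sets that depend on the condition and on the radius of the ball. All of them are put
  into one null set; the coefficients are set to 0 there, and the operator theory can assume its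
  conditions pointwise. Moreover \<open>v\<close> and its derivatives are measurable in \<tau> for
  fixed (t, x) only, whereas Fubini needs joint measurability; this is a Caratheodory argument in
  which t is approximated from above. The weights in (A4) come from Cauchy-Schwarz: |x(t)| \<le>
  sqrt(t - \<alpha>) |x| gives the factor of c_1, and the integral of \<tau> - \<alpha> over
  [\<alpha>, s], at most (\<beta> - \<alpha>)^2 / 2, gives (\<beta> - \<alpha>) / sqrt 2. As the
  growth bound uses only the pointwise size of x, it survives a retraction that does not increase
  norms. The inverse is differentiated by hand: the linearised operator maps its remainder, up to
  sign, to the remainder of V, so the stability estimates transfer one to the other.\<close>

section \<open>Lebesgue points\<close>

text \<open>A Vitali covering argument. A point of \<open>A\<close> where the averages do not tend
  to 0 has, for some n, arbitrarily small radii h with \<open>I x h > h / real (Suc n)\<close>; such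
  a ball has length 2 h, at most 2 (n + 1) times its mass under the measure with density
  \<open>g\<close>. That measure gives \<open>A\<close> no mass, so these balls can be kept inside
  an open set of arbitrarily small mass.\<close>

lemma AE_zero_density_measure:
  fixes g :: "real \<Rightarrow> real"
  assumes g: "integrable lborel g" "\<And>x. g x \<ge> 0" and A: "A \<in> sets borel" "\<And>x. x \<in> A \<Longrightarrow> g x = 0"
  shows "AE x in lebesgue. x \<in> A \<longrightarrow> ((\<lambda>h. (LINT s:ball x h|lborel. g s) / h) \<longlongrightarrow> 0) (at_right 0)"
proof -
  define I where "I x h = (LINT s:ball x h|lborel. g s)" for x h
  have I_nonneg: "I x h \<ge> 0" for x h
    unfolding I_def set_lebesgue_integral_def using g(2) by (intro integral_nonneg_AE) auto
  define N where "N = density lborel (\<lambda>x. ennreal (g x))"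
  have gm[measurable]: "g \<in> borel_measurable borel"
    using borel_measurable_integrable[OF g(1)] by simp
  have N_ball: "emeasure N (ball x h) = ennreal (I x h)" for x h
  proof -
    have "emeasure N (ball x h) = (\<integral>\<^sup>+s. ennreal (indicator (ball x h) s *\<^sub>R g s) \<partial>lborel)"
      unfolding N_def by (subst emeasure_density) (auto intro!: nn_integral_cong simp: indicator_def)
    also have "\<dots> = ennreal (I x h)"
      unfolding I_def set_lebesgue_integral_def
      by (rule nn_integral_eq_integral) (use g in \<open>auto intro: integrable_mult_indicator[of _ lborel g, simplified]\<close>)
    finally show ?thesis .
  qed
  have N_fin: "emeasure N (space N) \<noteq> \<infinity>"
  proof -
    have "emeasure N (space N) = (\<integral>\<^sup>+s. ennreal (g s) \<partial>lborel)"
      unfolding N_def by (subst emeasure_density) (auto intro!: nn_integral_cong)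
    then show ?thesis using nn_integral_eq_integral[OF g(1)] g(2) by simp
  qed
  have N_A: "emeasure N A = 0"
    unfolding N_def using A by (subst emeasure_density) (auto simp: indicator_def nn_integral_0_iff_AE intro!: AE_I2)
  define B where "B = (\<lambda>n::nat. {x\<in>A. \<forall>d>0. \<exists>h. 0 < h \<and> h < d \<and> I x h > h / real (Suc n)})"
  have neg: "negligible (B n)" for n
    unfolding negligible_outer_le
  proof (intro allI impI)
    fix e :: real assume e: "e > 0"
    define k where "k = real (Suc n)"
    have k: "k > 0" unfolding k_def by simp
    \<comment> \<open>Outer regularity of the finite measure \<open>N\<close>; the bound
      \<open>e / (2 * k)\<close> compensates the factor \<open>2 * k\<close> between length and
      mass.\<close>
    have "(INF U \<in> {U. A \<subseteq> U \<and> open U}. emeasure N U) = 0"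
      using outer_regular[of N A] N_fin A(1) N_A by (simp add: N_def)
    then have "(INF U \<in> {U. A \<subseteq> U \<and> open U}. emeasure N U) < ennreal (e / (2 * k))"
      using e k by simp
    then obtain U where U: "A \<subseteq> U" "open U" "emeasure N U < ennreal (e / (2 * k))"
      by (auto simp: INF_less_iff)
    define K where "K = {(x, h). x \<in> B n \<and> 0 < h \<and> ball x h \<subseteq> U \<and> I x h > h / k}"
    have "\<exists>i. i \<in> K \<and> x \<in> ball (fst i) (snd i) \<and> snd i < d" if "x \<in> B n" "d > 0" for x d
    proof -
      have "x \<in> U" using that U by (auto simp: B_def)
      then obtain r where r: "r > 0" "ball x r \<subseteq> U" using U(2) openE by blast
      have xB: "x \<in> B n" and "min d r > 0" using that r(1) by simp_all
      then obtain h where h: "0 < h" "h < min d r" "I x h > h / k"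
        using xB unfolding B_def k_def mem_Collect_eq by meson
      have "ball x h \<subseteq> U" using r h by (auto simp: subset_eq)
      then show ?thesis using h that by (intro exI[of _ "(x, h)"]) (auto simp: K_def)
    qed
    then obtain C where C: "countable C" "C \<subseteq> K"
      "pairwise (\<lambda>i j. disjnt (ball (fst i) (snd i)) (ball (fst j) (snd j))) C"
      "negligible (B n - (\<Union>i \<in> C. ball (fst i) (snd i)))"
      using Vitali_covering_theorem_balls[of "B n" K fst snd] by blast
    define W where "W = (\<Union>i \<in> C. ball (fst i) (snd i))"
    have disj: "disjoint_family_on (\<lambda>i. ball (fst i) (snd i)) C"
      using C(3) by (auto simp: disjoint_family_on_def pairwise_def disjnt_def)
    have le: "emeasure lborel (ball (fst i) (snd i)) \<le> ennreal (2 * k) * emeasure N (ball (fst i) (snd i))" if "i \<in> C" for i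
    proof -
      have "0 < snd i" "I (fst i) (snd i) > snd i / k" using that C(2) by (auto simp: K_def)
      moreover have "emeasure lborel (ball (fst i) (snd i)) = ennreal (2 * snd i)"
        using \<open>0 < snd i\<close> by (simp add: ball_eq_greaterThanLessThan)
      ultimately show ?thesis using k I_nonneg[of "fst i" "snd i"]
        unfolding N_ball by (auto simp: ennreal_mult[symmetric] field_simps intro!: ennreal_leI)
    qed
    have "emeasure lborel W = (\<integral>\<^sup>+i. emeasure lborel (ball (fst i) (snd i)) \<partial>count_space C)"
      unfolding W_def by (rule emeasure_UN_countable) (use C disj in auto)
    also have "\<dots> \<le> (\<integral>\<^sup>+i. ennreal (2 * k) * emeasure N (ball (fst i) (snd i)) \<partial>count_space C)"
      by (intro nn_integral_mono) (use le in auto)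
    also have "\<dots> = ennreal (2 * k) * (\<integral>\<^sup>+i. emeasure N (ball (fst i) (snd i)) \<partial>count_space C)"
      by (rule nn_integral_cmult) auto
    also have "(\<integral>\<^sup>+i. emeasure N (ball (fst i) (snd i)) \<partial>count_space C) = emeasure N W"
      unfolding W_def by (rule emeasure_UN_countable[symmetric]) (use C disj in \<open>auto simp: N_def\<close>)
    also have "emeasure N W \<le> emeasure N U"
      using C(2) U(2) by (intro emeasure_mono) (fastforce simp: W_def K_def N_def subset_eq)+
    also have "ennreal (2 * k) * emeasure N U \<le> ennreal (2 * k) * ennreal (e / (2 * k))"
      using U(3) by (intro mult_left_mono) auto
    also have "\<dots> = ennreal e" using k e by (simp add: ennreal_mult[symmetric])
    finally have Wle: "emeasure lborel W \<le> ennreal e" by (simp add: mult_left_mono)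
    have Wopen: "open W" by (auto simp: W_def)
    then have Wl: "W \<in> lmeasurable" using Wle
      by (intro fmeasurableI) (auto simp: less_top[symmetric] top_unique)
    have "measure lebesgue W \<le> e"
      using Wle e Wopen by (simp add: measure_def enn2real_leI)
    \<comment> \<open>The part of \<open>B n\<close> that the Vitali balls miss is negligible and is
      added without changing the measure.\<close>
    have W2: "W \<union> (B n - W) \<in> lmeasurable" "measure lebesgue (W \<union> (B n - W)) = measure lebesgue W"
      using Wl C(4) unfolding W_def[symmetric]
      by (simp_all add: measure_Un_null_set negligible_iff_null_sets fmeasurable.Un negligible_imp_measurable fmeasurableD del: Un_Diff_cancel)
    show "\<exists>T. B n \<subseteq> T \<and> T \<in> lmeasurable \<and> measure lebesgue T \<le> e"
      using W2 \<open>measure lebesgue W \<le> e\<close> by (intro exI[of _ "W \<union> (B n - W)"]) auto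
  qed
  have "negligible (\<Union>n. B n)" using neg by (intro negligible_countable_Union) auto
  then have "AE x in lebesgue. x \<notin> (\<Union>n. B n)"
    by (intro AE_not_in) (simp add: negligible_iff_null_sets)
  then show ?thesis
  proof eventually_elim
    case (elim x)
    show ?case unfolding I_def[symmetric]
    proof (intro impI tendstoI)
      fix e :: real assume x: "x \<in> A" and e: "e > 0"
      obtain n where n: "1 / real (Suc n) < e" using nat_approx_posE[OF e] by auto
      from elim x have "x \<notin> B n" by auto
      then obtain d where d: "d > 0" "\<And>h. 0 < h \<Longrightarrow> h < d \<Longrightarrow> I x h \<le> h / real (Suc n)"
        using x by (force simp: B_def)
      show "\<forall>\<^sub>F h in at_right 0. dist (I x h / h) 0 < e"
        unfolding eventually_at_right_field
      proof (intro exI[of _ d] conjI allI impI)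
        fix h assume h: "0 < h" "h < d"
        have "I x h / h \<le> (h / real (Suc n)) / h" by (intro divide_right_mono d) (use h in auto)
        also have "\<dots> = 1 / real (Suc n)" using h by simp
        finally show "dist (I x h / h) 0 < e" using n I_nonneg[of x h] h by (simp add: dist_real_def)
      qed (use d in auto)
    qed
  qed
qed


lemma set_integrable_lborel_bounded_const:
  fixes A :: "'a::euclidean_space set"
  assumes "A \<in> sets borel" "bounded A"
  shows "set_integrable lborel A (\<lambda>_. c::'b::{banach,second_countable_topology})"
  using assms emeasure_bounded_finite[of A] unfolding set_integrable_def
  by (intro integrable_scaleR_left integrable_real_indicator) auto

text \<open>The values \<open>u x\<close> are uncountably many, so the density lemma is applied to
  countably many excess functions \<open>g q n m\<close> with q in a dense set; each vanishes where
  u is within 1/(n+1) of q. At x one picks q close to \<open>u x\<close>, and near x the distance of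
  \<open>u s\<close> from \<open>u x\<close> exceeds \<open>g q n m s\<close> by at most
  2/(n+1).\<close>

lemma AE_lebesgue_point:
  fixes u :: "real \<Rightarrow> 'a::euclidean_space"
  assumes u: "integrable lborel u"
  shows "AE x in lebesgue. ((\<lambda>h. (LINT s:ball x h|lborel. norm (u s - u x)) / h) \<longlongrightarrow> 0) (at_right 0)"
proof -
  have um[measurable]: "u \<in> borel_measurable borel"
    using borel_measurable_integrable[OF u] by simp
  obtain D :: "'a set" where D: "countable D" "\<And>X. open X \<Longrightarrow> X \<noteq> {} \<Longrightarrow> \<exists>d\<in>D. d \<in> X"
    by (rule countable_dense_setE) blast
  have su: "set_integrable lborel (ball x h) (\<lambda>s. norm (u s - c))" for x h c
  proof (intro set_integrable_norm set_integral_diff(1))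
    show "set_integrable lborel (ball x h) u"
      unfolding set_integrable_def using u by (intro integrable_mult_indicator) auto
    show "set_integrable lborel (ball x h) (\<lambda>_. c)"
      by (intro set_integrable_lborel_bounded_const) auto
  qed
  \<comment> \<open>The cut-off to \<open>ball 0 (real m)\<close> makes the excess integrable over
    the line; near x it is invisible once m exceeds |x|.\<close>
  define g where "g q n m s = indicator (ball 0 (real m)) s * max 0 (norm (u s - q) - 1 / real (Suc n))"
    for q and n m :: nat and s :: real
  have g_int: "integrable lborel (g q n m)" for q n m
  proof (rule Bochner_Integration.integrable_bound)
    show "integrable lborel (\<lambda>s. indicator (ball 0 (real m)) s *\<^sub>R norm (u s - q))"
      using su[of 0 "real m" q] by (simp add: set_integrable_def)
    show "g q n m \<in> borel_measurable lborel" unfolding g_def ball_eq_greaterThanLessThan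
      by (intro borel_measurable_times borel_measurable_indicator borel_measurable_max borel_measurable_const
          borel_measurable_diff borel_measurable_norm) auto
  qed (auto simp: g_def indicator_def)
  have g_nonneg: "g q n m s \<ge> 0" for q n m s by (simp add: g_def)
  define A where "A q n = {s. norm (u s - q) \<le> 1 / real (Suc n)}" for q and n :: nat
  have "AE x in lebesgue. \<forall>n m. \<forall>q\<in>D. x \<in> A q n \<longrightarrow>
      ((\<lambda>h. (LINT s:ball x h|lborel. g q n m s) / h) \<longlongrightarrow> 0) (at_right 0)"
    unfolding AE_all_countable AE_ball_countable[OF D(1)]
    by (intro allI ballI AE_zero_density_measure g_int g_nonneg) (auto simp: A_def g_def)
  then show ?thesis
  proof eventually_elim
    case (elim x)
    show ?case
    proof (rule tendstoI)
      fix e :: real assume e: "e > 0"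
      \<comment> \<open>The error 2/(n+1) is integrated over a ball of length 2 h and divided by h,
        so it contributes 4/(n+1) < e/2.\<close>
      then have "e / 8 > 0" by simp
      then obtain n where n: "1 / real (Suc n) < e / 8" using nat_approx_posE by blast
      obtain q where q: "q \<in> D" "q \<in> ball (u x) (1 / real (Suc n))"
        using D(2)[of "ball (u x) (1 / real (Suc n))"] by auto
      obtain m :: nat where m: "\<bar>x\<bar> < real m" using reals_Archimedean2 by blast
      have "x \<in> A q n" using q(2) by (auto simp: A_def dist_norm)
      then have "((\<lambda>h. (LINT s:ball x h|lborel. g q n m s) / h) \<longlongrightarrow> 0) (at_right 0)"
        using elim q(1) by blast
      then have "\<forall>\<^sub>F h in at_right 0. dist ((LINT s:ball x h|lborel. g q n m s) / h) 0 < e / 2"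
        by (rule tendstoD) (use e in simp)
      moreover have "\<forall>\<^sub>F h in at_right 0. 0 < h \<and> h < real m - \<bar>x\<bar>"
        unfolding eventually_at_right_field using m by (intro exI[of _ "real m - \<bar>x\<bar>"]) auto
      ultimately show "\<forall>\<^sub>F h in at_right 0. dist ((LINT s:ball x h|lborel. norm (u s - u x)) / h) 0 < e"
      proof eventually_elim
        case (elim h)
        have ball_sub: "s \<in> ball 0 (real m)" if "s \<in> ball x h" for s
          using that elim by (auto simp: dist_real_def)
        have si: "set_integrable lborel (ball x h) (g q n m)"
          unfolding set_integrable_def using g_int by (intro integrable_mult_indicator) auto
        have sc: "set_integrable lborel (ball x h) (\<lambda>s. 2 / real (Suc n))"
          by (intro set_integrable_lborel_bounded_const) auto
        have "(LINT s:ball x h|lborel. norm (u s - u x)) \<le> (LINT s:ball x h|lborel. g q n m s + 2 / real (Suc n))"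
        proof (rule set_integral_mono[OF su])
          show "set_integrable lborel (ball x h) (\<lambda>s. g q n m s + 2 / real (Suc n))"
            using si sc by (rule set_integral_add)
          fix s assume "s \<in> ball x h"
          then have gs: "g q n m s = max 0 (norm (u s - q) - 1 / real (Suc n))"
            using ball_sub by (simp add: g_def indicator_def)
          have "norm (u s - u x) \<le> norm (u s - q) + norm (u x - q)"
            by (metis dist_norm dist_triangle2)
          also have "norm (u x - q) \<le> 1 / real (Suc n)" using q(2) by (simp add: dist_norm)
          finally show "norm (u s - u x) \<le> g q n m s + 2 / real (Suc n)"
            unfolding gs by linarith
        qed
        also have "\<dots> = (LINT s:ball x h|lborel. g q n m s) + (2 / real (Suc n)) * (2 * h)"
          using set_integral_add(2)[OF si sc] elim
          by (simp add: ball_eq_greaterThanLessThan set_integral_const)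
        finally have "(LINT s:ball x h|lborel. norm (u s - u x)) / h \<le>
          ((LINT s:ball x h|lborel. g q n m s) + (2 / real (Suc n)) * (2 * h)) / h"
          using elim by (intro divide_right_mono) auto
        also have "\<dots> = (LINT s:ball x h|lborel. g q n m s) / h + 4 * (1 / real (Suc n))"
          using elim by (simp add: add_divide_distrib)
        also have "\<dots> < e / 2 + 4 * (e / 8)"
          using elim(1) n unfolding dist_real_def by linarith
        finally have "(LINT s:ball x h|lborel. norm (u s - u x)) / h < e" by simp
        moreover have "(LINT s:ball x h|lborel. norm (u s - u x)) \<ge> 0"
          unfolding set_lebesgue_integral_def by (intro integral_nonneg_AE) auto
        ultimately show ?case using elim by (simp add: dist_real_def)
      qed
    qed
  qed
qed

text \<open>At a Lebesgue point x the error of the increment of the integral is the integral of u -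
  u x between x and y, which is dominated by an integral of the norm over a small ball around
  x.\<close>

lemma AE_has_vector_derivative_integral_lborel:
  fixes u :: "real \<Rightarrow> 'a::euclidean_space"
  assumes u: "integrable lborel u"
  shows "AE x in lebesgue. a < x \<longrightarrow> ((\<lambda>t. LINT s:{a..t}|lborel. u s) has_vector_derivative u x) (at x)"
  using AE_lebesgue_point[OF u]
proof eventually_elim
  case (elim x)
  define F where "F t = (LINT s:{a..t}|lborel. u s)" for t
  have um[measurable]: "u \<in> borel_measurable borel"
    using borel_measurable_integrable[OF u] by simp
  have ui: "set_integrable lborel S u" if "S \<in> sets borel" for S
    unfolding set_integrable_def using u that by (intro integrable_mult_indicator) auto
  show ?case unfolding F_def[symmetric]
  proof
    assume ax: "a < x"
    show "(F has_vector_derivative u x) (at x)"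
      unfolding has_vector_derivative_def has_derivative_within_alt
    proof (intro conjI allI impI bounded_linear_scaleR_left)
      fix e :: real assume e: "e > 0"
      then have "\<forall>\<^sub>F h in at_right 0. dist ((LINT s:ball x h|lborel. norm (u s - u x)) / h) 0 < e / 2"
        by (intro tendstoD[OF elim]) simp
      then obtain d where d: "d > 0"
        "\<And>h. 0 < h \<Longrightarrow> h < d \<Longrightarrow> dist ((LINT s:ball x h|lborel. norm (u s - u x)) / h) 0 < e / 2"
        unfolding eventually_at_right_field by blast
      show "\<exists>d>0. \<forall>y\<in>UNIV. norm (y - x) < d \<longrightarrow> norm (F y - F x - (y - x) *\<^sub>R u x) \<le> e * norm (y - x)"
      \<comment> \<open>The bound x - a keeps y to the right of a, where increments of
        \<open>F\<close> are integrals; d / 2 allows for the doubled radius below.\<close>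
      proof (intro exI[of _ "min (d / 2) (x - a)"] conjI ballI impI)
        show "min (d / 2) (x - a) > 0" using d ax by simp
        fix y assume "norm (y - x) < min (d / 2) (x - a)"
        then have y: "\<bar>y - x\<bar> < d / 2" "\<bar>y - x\<bar> < x - a" by auto
        show "norm (F y - F x - (y - x) *\<^sub>R u x) \<le> e * norm (y - x)"
        proof (cases "y = x")
          case False
          \<comment> \<open>The doubled radius puts the endpoint y inside the open ball; the factor
            2 is paid for by e / 2.\<close>
          define h where "h = 2 * \<bar>y - x\<bar>"
          have h: "0 < h" "h < d" using False y by (auto simp: h_def)
          have su: "set_integrable lborel (ball x h) (\<lambda>s. norm (u s - u x))"
            by (intro set_integrable_norm set_integral_diff(1) ui set_integrable_lborel_bounded_const) auto
          have key: "norm (F q - F p - (q - p) *\<^sub>R u x) \<le> (LINT s:ball x h|lborel. norm (u s - u x))"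
            if "a \<le> p" "p < q" "{p<..q} \<subseteq> ball x h" for p q
          proof -
            have "F q = F p + (LINT s:{p<..q}|lborel. u s)"
            proof -
              have "{a..q} = {a..p} \<union> {p<..q}" using that by auto
              then show ?thesis unfolding F_def
                by (simp only: \<open>{a..q} = _\<close>) (rule set_integral_Un[OF _ ui ui], auto)
            qed
            moreover have "(LINT s:{p<..q}|lborel. u x) = (q - p) *\<^sub>R u x"
              using that by (simp add: set_integral_const)
            moreover have sc: "set_integrable lborel {p<..q} (\<lambda>s. u x)"
              by (intro set_integrable_lborel_bounded_const) auto
            ultimately have "F q - F p - (q - p) *\<^sub>R u x = (LINT s:{p<..q}|lborel. u s - u x)"
              by (simp add: set_integral_diff(2)[OF ui sc])
            also have "norm \<dots> \<le> (LINT s:{p<..q}|lborel. norm (u s - u x))"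
              by (rule set_integral_norm_bound) (intro set_integral_diff ui sc, simp)
            also have "\<dots> \<le> (LINT s:ball x h|lborel. norm (u s - u x))"
              unfolding set_lebesgue_integral_def using that
              by (intro integral_mono set_integrable_subset[OF su, unfolded set_integrable_def] su[unfolded set_integrable_def])
                (auto simp: indicator_def)
            finally show ?thesis .
          qed
          have le: "(LINT s:ball x h|lborel. norm (u s - u x)) \<le> e * norm (y - x)"
            
          proof -
            have "(LINT s:ball x h|lborel. norm (u s - u x)) / h < e / 2"
              using d(2)[OF h] unfolding dist_real_def by linarith
            then have "(LINT s:ball x h|lborel. norm (u s - u x)) < e / 2 * h"
              using h by (simp add: divide_less_eq)
            then show ?thesis by (simp add: h_def)
          qed
          show ?thesis
          proof (cases "x < y")
            case True
            have "{x<..y} \<subseteq> ball x h" using True by (auto simp: h_def dist_real_def)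
            then show ?thesis using order_trans[OF key[of x y] le] True ax by simp
          next
            case lt: False
            have "{y<..x} \<subseteq> ball x h" using lt False by (auto simp: h_def dist_real_def)
            then have "norm (F x - F y - (x - y) *\<^sub>R u x) \<le> e * norm (y - x)"
              using order_trans[OF key[of y x] le] lt False y by simp
            moreover have "F x - F y - (x - y) *\<^sub>R u x = - (F y - F x - (y - x) *\<^sub>R u x)"
              by (simp add: algebra_simps)
            ultimately show ?thesis by (metis norm_minus_cancel)
          qed
        qed simp
      qed
    qed
  qed
qed

section \<open>Jordan decomposition and Radon-Nikodym: densities of absolutely continuous
  functions\<close>

section \<open>Absolutely continuous functions are primitives\<close>

text \<open>Unlike in \<open>abs_continuous_on_interval\<close>, the intervals are not confined to
  [\<alpha>, \<beta>], so that they can be cut and clamped freely.\<close>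

definition disjoint_intervals :: "(real \<times> real) set \<Rightarrow> bool" where
  "disjoint_intervals D \<longleftrightarrow> finite D \<and> (\<forall>(a, b)\<in>D. a < b) \<and> disjoint_family_on (\<lambda>(a, b). {a<..<b}) D"

definition abs_continuous_line :: "(real \<Rightarrow> 'a::real_normed_vector) \<Rightarrow> bool" where
  "abs_continuous_line f \<longleftrightarrow> (\<forall>e>0. \<exists>d>0. \<forall>D. disjoint_intervals D \<longrightarrow>
     (\<Sum>(a, b)\<in>D. b - a) < d \<longrightarrow> (\<Sum>(a, b)\<in>D. norm (f b - f a)) < e)"

lemma disjoint_intervalsD:
  assumes "disjoint_intervals D"
  shows "finite D" "\<And>i. i \<in> D \<Longrightarrow> fst i < snd i" "disjoint_family_on (\<lambda>i. {fst i<..<snd i}) D"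
  using assms unfolding disjoint_intervals_def by (auto simp: case_prod_beta')

lemma disjoint_family_on_shrink:
  assumes "disjoint_family_on A I" "\<And>i. i \<in> I \<Longrightarrow> B i \<subseteq> A i"
  shows "disjoint_family_on B I"
  using assms unfolding disjoint_family_on_def by blast

text \<open>Cutting a family of intervals may produce empty and coinciding members, which a set of
  pairs cannot keep apart. The empty ones are dropped; two others with equal endpoints would share
  their midpoint. Sums of a \<open>g\<close> that vanishes on the diagonal do not notice the
  difference.\<close>

lemma disjoint_intervals_of_indexed:
  assumes "finite I" and le: "\<And>i. i \<in> I \<Longrightarrow> l i \<le> r i"
    and disj: "disjoint_family_on (\<lambda>i. {l i<..<r i}) I"
  obtains D where "disjoint_intervals D" "D \<subseteq> (\<lambda>i. (l i, r i)) ` I"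
    "\<forall>g :: real \<Rightarrow> real \<Rightarrow> real. (\<forall>x. g x x = 0) \<longrightarrow> (\<Sum>(a, b)\<in>D. g a b) = (\<Sum>i\<in>I. g (l i) (r i))"
proof
  define J where "J = {i\<in>I. l i < r i}"
  let ?D = "(\<lambda>i. (l i, r i)) ` J"
  have fin: "finite J" using assms(1) by (simp add: J_def)
  have inj: "inj_on (\<lambda>i. (l i, r i)) J"
  proof (rule inj_onI, rule ccontr)
    fix i j assume ij: "i \<in> J" "j \<in> J" "(l i, r i) = (l j, r j)" "i \<noteq> j"
    then have "{l i<..<r i} \<inter> {l j<..<r j} = {}"
      using disj unfolding disjoint_family_on_def J_def by blast
    moreover have "(l i + r i) / 2 \<in> {l i<..<r i} \<inter> {l j<..<r j}"
      using ij by (auto simp: J_def)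
    ultimately show False by blast
  qed
  show "disjoint_intervals ?D"
    unfolding disjoint_intervals_def
  proof (intro conjI)
    show "disjoint_family_on (\<lambda>(a, b). {a<..<b}) ?D"
      using disj unfolding disjoint_family_on_def J_def by (auto split: prod.splits)
  qed (use fin in \<open>auto simp: J_def\<close>)
  show "?D \<subseteq> (\<lambda>i. (l i, r i)) ` I" by (auto simp: J_def)
  have "(\<Sum>(a, b)\<in>?D. g a b) = (\<Sum>i\<in>I. g (l i) (r i))"
    if g: "\<And>x. g x x = 0" for g :: "real \<Rightarrow> real \<Rightarrow> real"
  proof -
  have "(\<Sum>(a, b)\<in>?D. g a b) = (\<Sum>i\<in>J. g (l i) (r i))"
    by (subst sum.reindex[OF inj]) simp
  also have "\<dots> = (\<Sum>i\<in>I. g (l i) (r i))"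
  proof (intro sum.mono_neutral_left ballI)
    fix i assume "i \<in> I - J"
    then have "l i = r i" using le[of i] by (auto simp: J_def)
    then show "g (l i) (r i) = 0" using g by simp
  qed (use assms(1) in \<open>auto simp: J_def\<close>)
  finally show ?thesis .
  qed
  then show "\<forall>g :: real \<Rightarrow> real \<Rightarrow> real. (\<forall>x. g x x = 0) \<longrightarrow>
      (\<Sum>(a, b)\<in>?D. g a b) = (\<Sum>i\<in>I. g (l i) (r i))" by blast
qed

lemma sum_lengths_le_emeasure:
  assumes "finite I" and le: "\<And>i. i \<in> I \<Longrightarrow> l i \<le> (r i :: real)"
    and disj: "disjoint_family_on (\<lambda>i. {l i<..<r i}) I"
    and U: "\<And>i. i \<in> I \<Longrightarrow> {l i<..<r i} \<subseteq> U" "U \<in> sets borel"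
  shows "ennreal (\<Sum>i\<in>I. r i - l i) \<le> emeasure lborel U"
proof -
  have "ennreal (\<Sum>i\<in>I. r i - l i) = (\<Sum>i\<in>I. emeasure lborel {l i<..<r i})"
    using le by (subst sum_ennreal[symmetric]) auto
  also have "\<dots> = emeasure lborel (\<Union>i\<in>I. {l i<..<r i})"
    by (rule sum_emeasure) (use assms in auto)
  also have "\<dots> \<le> emeasure lborel U" by (rule emeasure_mono) (use U in auto)
  finally show ?thesis .
qed

lemma abs_continuous_lineE:
  assumes "abs_continuous_line f" "e > 0"
  obtains d where "d > 0"
    "\<forall>(I::'i set) l r. finite I \<longrightarrow> (\<forall>i\<in>I. l i \<le> r i) \<longrightarrow> disjoint_family_on (\<lambda>i. {l i<..<r i}) I \<longrightarrow>
      (\<Sum>i\<in>I. r i - l i) < d \<longrightarrow> (\<Sum>i\<in>I. norm (f (r i) - f (l i))) < e"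
proof -
  obtain d where dd: "d > 0 \<and> (\<forall>D. disjoint_intervals D \<longrightarrow>
     (\<Sum>(a, b)\<in>D. b - a) < d \<longrightarrow> (\<Sum>(a, b)\<in>D. norm (f b - f a)) < e)"
    by (rule exE[OF assms(1)[unfolded abs_continuous_line_def, rule_format, OF assms(2)]])
  note d = dd[THEN conjunct1] dd[THEN conjunct2]
  show thesis
  proof (rule that[OF d(1)], intro allI impI)
    fix I :: "'i set" and l r :: "'i \<Rightarrow> real"
    assume I: "finite I" "\<forall>i\<in>I. l i \<le> r i" "disjoint_family_on (\<lambda>i. {l i<..<r i}) I"
      and s: "(\<Sum>i\<in>I. r i - l i) < d"
    obtain D where D: "disjoint_intervals D" "D \<subseteq> (\<lambda>i. (l i, r i)) ` I"
      "\<forall>g :: real \<Rightarrow> real \<Rightarrow> real. (\<forall>x. g x x = 0) \<longrightarrow> (\<Sum>(a, b)\<in>D. g a b) = (\<Sum>i\<in>I. g (l i) (r i))"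
      by (rule disjoint_intervals_of_indexed[OF I(1) I(2)[rule_format] I(3)])
    have "(\<Sum>(a, b)\<in>D. norm (f b - f a)) < e"
      using d(2)[rule_format, OF D(1)] D(3)[rule_format, of "\<lambda>a b. b - a"] s by simp
    then show "(\<Sum>i\<in>I. norm (f (r i) - f (l i))) < e"
      using D(3)[rule_format, of "\<lambda>a b. norm (f b - f a)"] by simp
  qed
qed

text \<open>Clamping sends every interval to a subinterval of itself or to a degenerate one, so a
  disjoint family stays disjoint and its total length does not grow.\<close>

lemma abs_continuous_line_clamp:
  assumes f: "abs_continuous_on_interval \<alpha> \<beta> f" and "\<alpha> \<le> \<beta>"
  shows "abs_continuous_line (\<lambda>t. f (max \<alpha> (min \<beta> t)))"
  unfolding abs_continuous_line_def
proof (intro allI impI)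
  fix e :: real assume "e > 0"
  have "\<exists>d>0. \<forall>D. finite D \<and> (\<forall>(a, b)\<in>D. \<alpha> \<le> a \<and> a < b \<and> b \<le> \<beta>) \<and>
        disjoint_family_on (\<lambda>(a, b). {a<..<b}) D \<and> (\<Sum>(a, b)\<in>D. b - a) < d
        \<longrightarrow> (\<Sum>(a, b)\<in>D. norm (f b - f a)) < e"
    by (rule f[unfolded abs_continuous_on_interval_def, THEN spec, THEN mp, OF \<open>e > 0\<close>])
  then obtain d where dd: "d > 0 \<and> (\<forall>D. finite D \<and> (\<forall>(a, b)\<in>D. \<alpha> \<le> a \<and> a < b \<and> b \<le> \<beta>) \<and>
        disjoint_family_on (\<lambda>(a, b). {a<..<b}) D \<and> (\<Sum>(a, b)\<in>D. b - a) < d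
        \<longrightarrow> (\<Sum>(a, b)\<in>D. norm (f b - f a)) < e)"
    by (rule exE)
  note d = dd[THEN conjunct1] dd[THEN conjunct2]
  define c where "c t = max \<alpha> (min \<beta> t)" for t
  show "\<exists>d>0. \<forall>D. disjoint_intervals D \<longrightarrow> (\<Sum>(a, b)\<in>D. b - a) < d \<longrightarrow>
      (\<Sum>(a, b)\<in>D. norm (f (max \<alpha> (min \<beta> b)) - f (max \<alpha> (min \<beta> a)))) < e"
    unfolding c_def[symmetric]
  proof (intro exI[of _ d] conjI d(1) allI impI)
    fix D assume D: "disjoint_intervals D" "(\<Sum>(a, b)\<in>D. b - a) < d"
    have sub: "{c (fst i)<..<c (snd i)} \<subseteq> {fst i<..<snd i}" for i
      by (auto simp: c_def)
    have fam: "disjoint_family_on (\<lambda>i. {c (fst i)<..<c (snd i)}) D"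
      by (rule disjoint_family_on_shrink[OF disjoint_intervalsD(3)[OF D(1)]]) (rule sub)
    have le: "c (fst i) \<le> c (snd i)" if "i \<in> D" for i
      using disjoint_intervalsD(2)[OF D(1) that] by (auto simp: c_def)
    obtain D' where D': "disjoint_intervals D'" "D' \<subseteq> (\<lambda>i. (c (fst i), c (snd i))) ` D"
      "\<forall>g :: real \<Rightarrow> real \<Rightarrow> real. (\<forall>x. g x x = 0) \<longrightarrow> (\<Sum>(a, b)\<in>D'. g a b) = (\<Sum>i\<in>D. g (c (fst i)) (c (snd i)))"
      by (rule disjoint_intervals_of_indexed[OF disjoint_intervalsD(1)[OF D(1)] le fam])
    have "(\<Sum>(a, b)\<in>D'. b - a) = (\<Sum>i\<in>D. c (snd i) - c (fst i))"
      by (rule D'(3)[rule_format]) simp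
    also have "\<dots> \<le> (\<Sum>(a, b)\<in>D. b - a)"
      unfolding case_prod_beta
    proof (rule sum_mono)
      fix i assume "i \<in> D"
      then show "c (snd i) - c (fst i) \<le> snd i - fst i"
        using disjoint_intervalsD(2)[OF D(1) \<open>i \<in> D\<close>] by (auto simp: c_def)
    qed
    finally have "(\<Sum>(a, b)\<in>D'. b - a) < d" using D(2) by simp
    moreover have "\<forall>(a, b)\<in>D'. \<alpha> \<le> a \<and> a < b \<and> b \<le> \<beta>"
      using D'(1,2) assms(2) by (auto simp: disjoint_intervals_def c_def)
    ultimately have "(\<Sum>(a, b)\<in>D'. norm (f b - f a)) < e"
      using d(2)[rule_format, of D'] D'(1) by (simp add: disjoint_intervals_def)
    also have "(\<Sum>(a, b)\<in>D'. norm (f b - f a)) = (\<Sum>i\<in>D. norm (f (c (snd i)) - f (c (fst i))))"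
      by (rule D'(3)[rule_format]) simp
    finally show "(\<Sum>(a, b)\<in>D. norm (f (c b) - f (c a))) < e"
      by (simp add: case_prod_beta)
  qed
qed

text \<open>[\<alpha>, \<beta>] is cut into n pieces shorter than the \<delta> that belongs to
  \<epsilon> = 1. Clamped to one piece, any disjoint family has total length below \<delta>, so each
  piece adds at most 1 to the variation.\<close>

lemma abs_continuous_line_bounded_variation:
  fixes f :: "real \<Rightarrow> 'a::real_normed_vector"
  assumes f: "abs_continuous_line f" and "\<alpha> < \<beta>"
    and const: "\<And>t. f (max \<alpha> (min \<beta> t)) = f t"
  obtains B where "\<And>D. disjoint_intervals D \<Longrightarrow> (\<Sum>(a, b)\<in>D. norm (f b - f a)) \<le> B"
proof -
  obtain d where d: "d > 0"
    "\<forall>(I::(real\<times>real) set) l r. finite I \<longrightarrow> (\<forall>i\<in>I. l i \<le> r i) \<longrightarrow> disjoint_family_on (\<lambda>i. {l i<..<r i}) I \<longrightarrow>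
      (\<Sum>i\<in>I. r i - l i) < d \<longrightarrow> (\<Sum>i\<in>I. norm (f (r i) - f (l i))) < 1"
    by (rule abs_continuous_lineE[OF f zero_less_one])
  obtain n :: nat where n: "(\<beta> - \<alpha>) / d < real n" using reals_Archimedean2 by blast
  have npos: "n > 0" using n assms(2) d(1) by (metis diff_gt_0_iff_gt divide_pos_pos gr0I less_asym of_nat_0)
  define p where "p j = \<alpha> + real j * ((\<beta> - \<alpha>) / real n)" for j
  define c where "c j t = max (p j) (min (p (Suc j)) t)" for j t
  have p0: "p 0 = \<alpha>" and pn: "p n = \<beta>" using npos by (simp_all add: p_def)
  have pS: "p (Suc j) - p j = (\<beta> - \<alpha>) / real n" for j unfolding p_def of_nat_Suc distrib_right by simp
  have step: "0 < (\<beta> - \<alpha>) / real n" "(\<beta> - \<alpha>) / real n < d"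
    using assms(2) npos n d(1) by (simp_all add: field_simps)
  \<comment> \<open>Each piece contributes the increment of \<open>f\<close> inside it up to t: the
    full increment if t lies to its right, nothing if t lies to its left.\<close>
  have tele: "(\<Sum>j<k. f (c j t) - f (p j)) = f (max \<alpha> (min (p k) t)) - f \<alpha>" for k t
  proof (induction k)
    case (Suc k)
    have "p k < p (Suc k)" using pS[of k] step by linarith
    moreover have "\<alpha> \<le> p k" using mult_nonneg_nonneg[of "real k" "(\<beta> - \<alpha>) / real n"] step
      unfolding p_def by linarith
    ultimately consider "t \<le> p k" | "t > p k" by linarith
    then have "f (c k t) - f (p k) = f (max \<alpha> (min (p (Suc k)) t)) - f (max \<alpha> (min (p k) t))"
    proof cases
      case 1
      then have "c k t = p k" "min (p (Suc k)) t = t" "min (p k) t = t"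
        using \<open>p k < p (Suc k)\<close> by (auto simp: c_def)
      then show ?thesis by simp
    next
      case 2
      then have "c k t = min (p (Suc k)) t" "max \<alpha> (min (p (Suc k)) t) = min (p (Suc k)) t" "max \<alpha> (min (p k) t) = p k"
        using \<open>p k < p (Suc k)\<close> \<open>\<alpha> \<le> p k\<close> by (auto simp: c_def)
      then show ?thesis by simp
    qed
    then show ?case using Suc by simp
  qed (simp add: p0)
  have incr: "f b - f a = (\<Sum>j<n. f (c j b) - f (c j a))" for a b
  proof -
    have "f b - f a = (\<Sum>j<n. f (c j b) - f (p j)) - (\<Sum>j<n. f (c j a) - f (p j))"
      unfolding tele pn using const by simp
    then show ?thesis by (simp add: sum_subtractf)
  qed
  show thesis
  proof (rule that[of "real n"])
    fix D assume D: "disjoint_intervals D"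
    have "(\<Sum>(a, b)\<in>D. norm (f b - f a)) \<le> (\<Sum>(a, b)\<in>D. \<Sum>j<n. norm (f (c j b) - f (c j a)))"
    proof (intro sum_mono, clarify)
      fix a b show "norm (f b - f a) \<le> (\<Sum>j<n. norm (f (c j b) - f (c j a)))"
        by (subst incr) (rule norm_sum)
    qed
    also have "\<dots> = (\<Sum>j<n. \<Sum>i\<in>D. norm (f (c j (snd i)) - f (c j (fst i))))"
      by (subst sum.swap) (simp add: case_prod_beta)
    also have "\<dots> \<le> (\<Sum>j<n. 1)"
    proof (intro sum_mono)
      fix j
      have sub: "{c j (fst i)<..<c j (snd i)} \<subseteq> {fst i<..<snd i} \<inter> {p j..p (Suc j)}" for i
        using pS[of j] step by (auto simp: c_def)
      have le: "c j (fst i) \<le> c j (snd i)" if "i \<in> D" for i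
        using disjoint_intervalsD(2)[OF D that] by (auto simp: c_def)
      have disj: "disjoint_family_on (\<lambda>i. {c j (fst i)<..<c j (snd i)}) D"
        by (rule disjoint_family_on_shrink[OF disjoint_intervalsD(3)[OF D]]) (rule order_trans[OF sub Int_lower1])
      have "ennreal (\<Sum>i\<in>D. c j (snd i) - c j (fst i)) \<le> emeasure lborel {p j..p (Suc j)}"
        by (rule sum_lengths_le_emeasure) (use le disj sub D in \<open>auto simp: disjoint_intervals_def\<close>)
      also have "\<dots> = ennreal ((\<beta> - \<alpha>) / real n)" using pS[of j] step by (subst emeasure_lborel_Icc) auto
      finally have "(\<Sum>i\<in>D. c j (snd i) - c j (fst i)) < d"
        using step by (simp add: ennreal_le_iff)
      then show "(\<Sum>i\<in>D. norm (f (c j (snd i)) - f (c j (fst i)))) \<le> 1"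
        using d(2)[rule_format, OF _ le disj] D by (auto simp: disjoint_intervals_def less_imp_le)
    qed
    finally show "(\<Sum>(a, b)\<in>D. norm (f b - f a)) \<le> real n" by simp
  qed
qed

lemma abs_continuous_line_continuous:
  assumes "abs_continuous_line f"
  shows "continuous_on UNIV f"
proof (rule continuous_onI)
  fix x e :: real assume "e > 0"
  obtain d where d: "d > 0"
    "\<forall>(I::unit set) l r. finite I \<longrightarrow> (\<forall>i\<in>I. l i \<le> r i) \<longrightarrow> disjoint_family_on (\<lambda>i. {l i<..<r i}) I \<longrightarrow>
      (\<Sum>i\<in>I. r i - l i) < d \<longrightarrow> (\<Sum>i\<in>I. norm (f (r i) - f (l i))) < e"
    by (rule abs_continuous_lineE[OF assms \<open>e > 0\<close>])
  have "dist (f y) (f x) \<le> e" if "dist y x < d" for y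
    using d(2)[rule_format, of "{()}" "\<lambda>_. min x y" "\<lambda>_. max x y"] that
    by (cases "x \<le> y") (auto simp: disjoint_family_on_def dist_norm norm_minus_commute)
  then show "\<exists>d>0. \<forall>y\<in>UNIV. dist y x < d \<longrightarrow> dist (f y) (f x) \<le> e" using d(1) by blast
qed

lemma abs_continuous_line_diff:
  assumes "abs_continuous_line f" "abs_continuous_line g"
  shows "abs_continuous_line (\<lambda>t. f t - g t)"
  unfolding abs_continuous_line_def
proof (intro allI impI)
  fix e :: real assume "e > 0"
  then have e: "e / 2 > 0" by simp
  obtain d1 where dd1: "d1 > 0 \<and> (\<forall>D. disjoint_intervals D \<longrightarrow>
     (\<Sum>(a, b)\<in>D. b - a) < d1 \<longrightarrow> (\<Sum>(a, b)\<in>D. norm (f b - f a)) < e / 2)"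
    by (rule exE[OF assms(1)[unfolded abs_continuous_line_def, rule_format, OF e]])
  note d1 = dd1[THEN conjunct1] dd1[THEN conjunct2]
  obtain d2 where dd2: "d2 > 0 \<and> (\<forall>D. disjoint_intervals D \<longrightarrow>
     (\<Sum>(a, b)\<in>D. b - a) < d2 \<longrightarrow> (\<Sum>(a, b)\<in>D. norm (g b - g a)) < e / 2)"
    by (rule exE[OF assms(2)[unfolded abs_continuous_line_def, rule_format, OF e]])
  note d2 = dd2[THEN conjunct1] dd2[THEN conjunct2]
  show "\<exists>d>0. \<forall>D. disjoint_intervals D \<longrightarrow>
     (\<Sum>(a, b)\<in>D. b - a) < d \<longrightarrow> (\<Sum>(a, b)\<in>D. norm (f b - g b - (f a - g a))) < e"
  proof (intro exI[of _ "min d1 d2"] conjI allI impI)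
    fix D assume D: "disjoint_intervals D" "(\<Sum>(a, b)\<in>D. b - a) < min d1 d2"
    have "(\<Sum>(a, b)\<in>D. norm (f b - g b - (f a - g a))) \<le> (\<Sum>(a, b)\<in>D. norm (f b - f a) + norm (g b - g a))"
    proof (intro sum_mono, clarify)
      fix a b
      have "f b - g b - (f a - g a) = (f b - f a) - (g b - g a)" by simp
      then show "norm (f b - g b - (f a - g a)) \<le> norm (f b - f a) + norm (g b - g a)"
        by (metis norm_triangle_ineq4)
    qed
    also have "\<dots> = (\<Sum>(a, b)\<in>D. norm (f b - f a)) + (\<Sum>(a, b)\<in>D. norm (g b - g a))"
      by (simp add: case_prod_beta sum.distrib)
    also have "\<dots> < e / 2 + e / 2" using d1(2) d2(2) D by (intro add_strict_mono) auto
    finally show "(\<Sum>(a, b)\<in>D. norm (f b - g b - (f a - g a))) < e" by simp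
  qed (use d1 d2 in auto)
qed

text \<open>The total variation of \<open>f\<close> on (-infinity, t]. It is a genuine supremum only
  if the sums are bounded, which the context below assumes.\<close>

definition variation_upto :: "(real \<Rightarrow> real) \<Rightarrow> real \<Rightarrow> real" where
  "variation_upto f t = (SUP D\<in>{D. disjoint_intervals D \<and> (\<forall>(a, b)\<in>D. b \<le> t)}. \<Sum>(a, b)\<in>D. \<bar>f b - f a\<bar>)"

text \<open>The triangle inequality after cutting [x, y] at s; if s lies outside, one of the two
  terms vanishes.\<close>

lemma abs_increment_split:
  fixes f :: "real \<Rightarrow> real"
  assumes "x \<le> y"
  shows "\<bar>f y - f x\<bar> \<le> \<bar>f (min s y) - f (min s x)\<bar> + \<bar>f (max s y) - f (max s x)\<bar>"
proof -
  consider "y \<le> s" | "s \<le> x" | "x \<le> s" "s \<le> y" by linarith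
  then show ?thesis using assms by cases (auto simp: min_def max_def)
qed

context
  fixes f :: "real \<Rightarrow> real" and B :: real
  assumes B: "\<And>D. disjoint_intervals D \<Longrightarrow> (\<Sum>(a, b)\<in>D. \<bar>f b - f a\<bar>) \<le> B"
begin

lemma variation_upto_upper:
  assumes "disjoint_intervals D" "\<And>a b. (a, b) \<in> D \<Longrightarrow> b \<le> t"
  shows "(\<Sum>(a, b)\<in>D. \<bar>f b - f a\<bar>) \<le> variation_upto f t"
  unfolding variation_upto_def
  by (rule cSUP_upper) (use assms B in \<open>auto intro!: bdd_aboveI[of _ B]\<close>)

lemma variation_upto_least:
  assumes "\<And>D. disjoint_intervals D \<Longrightarrow> (\<And>a b. (a, b) \<in> D \<Longrightarrow> b \<le> t) \<Longrightarrow> (\<Sum>(a, b)\<in>D. \<bar>f b - f a\<bar>) \<le> c"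
  shows "variation_upto f t \<le> c"
  unfolding variation_upto_def
proof (rule cSUP_least)
  have "{} \<in> {D. disjoint_intervals D \<and> (\<forall>(a, b)\<in>D. b \<le> t)}"
    by (simp add: disjoint_intervals_def disjoint_family_on_def)
  then show "{D. disjoint_intervals D \<and> (\<forall>(a, b)\<in>D. b \<le> t)} \<noteq> {}" by blast
qed (use assms in auto)

text \<open>Adding the interval (s, t) to a disjoint family left of s gives a disjoint family left
  of t.\<close>

lemma variation_upto_increment:
  assumes "s \<le> t"
  shows "\<bar>f t - f s\<bar> \<le> variation_upto f t - variation_upto f s"
proof (cases "s = t")
  case False
  then have st: "s < t" using assms by simp
  have "variation_upto f s \<le> variation_upto f t - \<bar>f t - f s\<bar>"
  proof (rule variation_upto_least)
    fix D assume D: "disjoint_intervals D" and Ds: "\<And>a b. (a, b) \<in> D \<Longrightarrow> b \<le> s"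
    have ge: "b \<le> s" "a < b" if "(a, b) \<in> D" for a b
      using Ds[OF that] disjoint_intervalsD(2)[OF D that] by simp_all
    have nin: "(s, t) \<notin> D" using ge st by fastforce
    have disj: "{s<..<t} \<inter> (\<Union>p\<in>D. case p of (a, b) \<Rightarrow> {a<..<b}) = {}"
      by (force dest: ge(1))
    have D': "disjoint_intervals (insert (s, t) D)"
      unfolding disjoint_intervals_def
    proof (intro conjI)
      show "disjoint_family_on (\<lambda>(a, b). {a<..<b}) (insert (s, t) D)"
        using D disj nin unfolding disjoint_intervals_def
        by (subst disjoint_family_on_insert) simp_all
    qed (use D st in \<open>auto simp: disjoint_intervals_def\<close>)
    have "(\<Sum>(a, b)\<in>insert (s, t) D. \<bar>f b - f a\<bar>) \<le> variation_upto f t"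
    proof (rule variation_upto_upper[OF D'])
      fix a b assume "(a, b) \<in> insert (s, t) D"
      then show "b \<le> t" using ge st by force
    qed
    then show "(\<Sum>(a, b)\<in>D. \<bar>f b - f a\<bar>) \<le> variation_upto f t - \<bar>f t - f s\<bar>"
      using nin disjoint_intervalsD(1)[OF D] by simp
  qed
  then show ?thesis by simp
qed simp

text \<open>A nearly optimal family for b is cut at a. The pieces left of a cost at most the
  variation up to a, so the pieces between a and b carry the difference.\<close>

lemma variation_upto_near:
  assumes "a < b" "\<eta> > 0"
  obtains D where "disjoint_intervals D" "\<forall>(x, y)\<in>D. y \<le> b"
    "variation_upto f b - variation_upto f a \<le> (\<Sum>i\<in>D. \<bar>f (max a (snd i)) - f (max a (fst i))\<bar>) + \<eta>"
proof -
  have "\<exists>D. disjoint_intervals D \<and> (\<forall>(x, y)\<in>D. y \<le> b) \<and> variation_upto f b - \<eta> < (\<Sum>(a, b)\<in>D. \<bar>f b - f a\<bar>)"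
  proof (rule ccontr)
    assume "\<not> ?thesis"
    then have "variation_upto f b \<le> variation_upto f b - \<eta>"
      by (intro variation_upto_least) (force simp: not_less)
    then show False using assms by simp
  qed
  then obtain D where D: "disjoint_intervals D" "\<forall>(x, y)\<in>D. y \<le> b"
    "variation_upto f b - \<eta> < (\<Sum>(a, b)\<in>D. \<bar>f b - f a\<bar>)" by blast
  have "(\<Sum>(a, b)\<in>D. \<bar>f b - f a\<bar>) \<le> (\<Sum>i\<in>D. \<bar>f (min a (snd i)) - f (min a (fst i))\<bar> + \<bar>f (max a (snd i)) - f (max a (fst i))\<bar>)"
    unfolding case_prod_beta
    by (intro sum_mono abs_increment_split less_imp_le disjoint_intervalsD(2)[OF D(1)])
  moreover have "(\<Sum>i\<in>D. \<bar>f (min a (snd i)) - f (min a (fst i))\<bar>) \<le> variation_upto f a"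
  proof -
    have le: "min a (fst i) \<le> min a (snd i)" if "i \<in> D" for i
      using disjoint_intervalsD(2)[OF D(1) that] by auto
    have fam: "disjoint_family_on (\<lambda>i. {min a (fst i)<..<min a (snd i)}) D"
      by (rule disjoint_family_on_shrink[OF disjoint_intervalsD(3)[OF D(1)]]) auto
    obtain D' where D': "disjoint_intervals D'" "D' \<subseteq> (\<lambda>i. (min a (fst i), min a (snd i))) ` D"
      "\<forall>g :: real \<Rightarrow> real \<Rightarrow> real. (\<forall>x. g x x = 0) \<longrightarrow>
        (\<Sum>(x, y)\<in>D'. g x y) = (\<Sum>i\<in>D. g (min a (fst i)) (min a (snd i)))"
      by (rule disjoint_intervals_of_indexed[OF disjoint_intervalsD(1)[OF D(1)] le fam])
    have "(\<Sum>(x, y)\<in>D'. \<bar>f y - f x\<bar>) \<le> variation_upto f a"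
      by (rule variation_upto_upper[OF D'(1)]) (use D'(2) in auto)
    then show ?thesis using D'(3)[rule_format, of "\<lambda>x y. \<bar>f y - f x\<bar>"] by simp
  qed
  ultimately have "variation_upto f b - variation_upto f a \<le> (\<Sum>i\<in>D. \<bar>f (max a (snd i)) - f (max a (fst i))\<bar>) + \<eta>"
    using D(3) by (simp add: sum.distrib)
  then show thesis using that D by blast
qed

text \<open>Each interval of a short family is refined by a family that nearly realises the
  variation on it. The refinements together form one disjoint family of no greater total length, so
  absolute continuity of \<open>f\<close> bounds the sum of the variations.\<close>

lemma abs_continuous_line_variation_upto:
  assumes f: "abs_continuous_line f"
  shows "abs_continuous_line (variation_upto f)"
  unfolding abs_continuous_line_def
proof (intro allI impI)
  fix e :: real assume e: "e > 0"
  then have "e / 2 > 0" by simp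
  obtain d where d: "d > 0"
    "\<forall>(I::((real\<times>real)\<times>(real\<times>real)) set) l r. finite I \<longrightarrow> (\<forall>i\<in>I. l i \<le> r i) \<longrightarrow> disjoint_family_on (\<lambda>i. {l i<..<r i}) I \<longrightarrow>
      (\<Sum>i\<in>I. r i - l i) < d \<longrightarrow> (\<Sum>i\<in>I. norm (f (r i) - f (l i))) < e / 2"
    by (rule abs_continuous_lineE[OF f \<open>e / 2 > 0\<close>])
  show "\<exists>d>0. \<forall>D. disjoint_intervals D \<longrightarrow>
     (\<Sum>(a, b)\<in>D. b - a) < d \<longrightarrow> (\<Sum>(a, b)\<in>D. norm (variation_upto f b - variation_upto f a)) < e"
  proof (intro exI[of _ d] conjI d(1) allI impI)
    fix E assume E: "disjoint_intervals E" and len: "(\<Sum>(a, b)\<in>E. b - a) < d"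
    note finE = disjoint_intervalsD(1)[OF E]
    \<comment> \<open>The errors of all refinements together stay strictly below e / 2, also for an
      empty family, whence the + 1.\<close>
    define \<eta> where "\<eta> = e / (2 * (real (card E) + 1))"
    have \<eta>: "\<eta> > 0" using e by (simp add: \<eta>_def)
    define P where "P k D \<longleftrightarrow> disjoint_intervals D \<and> (\<forall>(x, y)\<in>D. y \<le> snd k) \<and>
      variation_upto f (snd k) - variation_upto f (fst k) \<le> (\<Sum>i\<in>D. \<bar>f (max (fst k) (snd i)) - f (max (fst k) (fst i))\<bar>) + \<eta>"
      for k D
    have "\<exists>D. P k D" if k: "k \<in> E" for k
    proof -
      obtain D where "disjoint_intervals D" "\<forall>(x, y)\<in>D. y \<le> snd k"
        "variation_upto f (snd k) - variation_upto f (fst k) \<le> (\<Sum>i\<in>D. \<bar>f (max (fst k) (snd i)) - f (max (fst k) (fst i))\<bar>) + \<eta>"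
        by (rule variation_upto_near[OF disjoint_intervalsD(2)[OF E k] \<eta>])
      then have "P k D" unfolding P_def by (intro conjI)
      then show ?thesis by (rule exI)
    qed
    then obtain D where D: "\<And>k. k \<in> E \<Longrightarrow> P k (D k)" by metis
    have Dk: "disjoint_intervals (D k)" "\<And>i. i \<in> D k \<Longrightarrow> snd i \<le> snd k"
      "variation_upto f (snd k) - variation_upto f (fst k) \<le> (\<Sum>i\<in>D k. \<bar>f (max (fst k) (snd i)) - f (max (fst k) (fst i))\<bar>) + \<eta>"
      if "k \<in> E" for k
      using D[OF that] unfolding P_def by (auto simp: case_prod_beta)
    define I where "I = Sigma E D"
    define l where "l p = max (fst (fst p)) (fst (snd p))" for p :: "(real\<times>real)\<times>(real\<times>real)"
    define r where "r p = max (fst (fst p)) (snd (snd p))" for p :: "(real\<times>real)\<times>(real\<times>real)"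
    have finI: "finite I" unfolding I_def using finE disjoint_intervalsD(1)[OF Dk(1)] by (rule finite_SigmaI)
    have le: "l i \<le> r i" if "i \<in> I" for i
    proof -
      have "fst i \<in> E" "snd i \<in> D (fst i)" using that by (auto simp: I_def)
      then show ?thesis using disjoint_intervalsD(2)[OF Dk(1), of "fst i" "snd i"] by (auto simp: l_def r_def)
    qed
    have sub1: "{l i<..<r i} \<subseteq> {fst (snd i)<..<snd (snd i)}" for i
      by (auto simp: l_def r_def)
    have sub2: "{l i<..<r i} \<subseteq> {fst (fst i)<..<snd (fst i)}" if "i \<in> I" for i
    proof -
      have i: "fst i \<in> E" "snd i \<in> D (fst i)" using that by (auto simp: I_def)
      have "r i \<le> snd (fst i)" using Dk(2)[OF i] disjoint_intervalsD(2)[OF E i(1)] by (auto simp: r_def)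
      then show ?thesis by (auto simp: l_def)
    qed
    \<comment> \<open>Two members with the same first component are disjoint inside one refinement;
      otherwise they lie in different intervals of \<open>E\<close>.\<close>
    have fam: "disjoint_family_on (\<lambda>i. {l i<..<r i}) I"
      unfolding disjoint_family_on_def
    proof (intro ballI impI)
      fix i j assume ij: "i \<in> I" "j \<in> I" "i \<noteq> j"
      have m: "fst i \<in> E" "snd i \<in> D (fst i)" "fst j \<in> E" "snd j \<in> D (fst j)" using ij by (auto simp: I_def)
      show "{l i<..<r i} \<inter> {l j<..<r j} = {}"
      proof (cases "fst i = fst j")
        case True
        then have "snd i \<noteq> snd j" using ij(3) by (simp add: prod_eq_iff)
        then have "{fst (snd i)<..<snd (snd i)} \<inter> {fst (snd j)<..<snd (snd j)} = {}"
          using disjoint_intervalsD(3)[OF Dk(1)[OF m(1)]] m True unfolding disjoint_family_on_def by metis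
        then show ?thesis using sub1[of i] sub1[of j] by blast
      next
        case False
        then have "{fst (fst i)<..<snd (fst i)} \<inter> {fst (fst j)<..<snd (fst j)} = {}"
          using disjoint_intervalsD(3)[OF E] m unfolding disjoint_family_on_def by metis
        then show ?thesis using sub2[OF ij(1)] sub2[OF ij(2)] by blast
      qed
    qed
    have "(\<Sum>i\<in>I. r i - l i) = (\<Sum>k\<in>E. \<Sum>i\<in>D k. r (k, i) - l (k, i))"
      unfolding I_def using finE disjoint_intervalsD(1)[OF Dk(1)] by (subst sum.Sigma) auto
    also have "\<dots> \<le> (\<Sum>k\<in>E. snd k - fst k)"
    proof (rule sum_mono)
      fix k assume k: "k \<in> E"
      have inI: "(k, i) \<in> I" if "i \<in> D k" for i using k that by (simp add: I_def)
      have "ennreal (\<Sum>i\<in>D k. r (k, i) - l (k, i)) \<le> emeasure lborel {fst k<..<snd k}"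
      proof (rule sum_lengths_le_emeasure)
        show "finite (D k)" using disjoint_intervalsD(1)[OF Dk(1)[OF k]] .
        show "disjoint_family_on (\<lambda>i. {l (k, i)<..<r (k, i)}) (D k)"
          by (rule disjoint_family_on_shrink[OF disjoint_intervalsD(3)[OF Dk(1)[OF k]]])
            (use sub1[of "(k, _)"] in \<open>simp only: fst_conv snd_conv\<close>)
        show "l (k, i) \<le> r (k, i)" if "i \<in> D k" for i using le[OF inI[OF that]] .
        show "{l (k, i)<..<r (k, i)} \<subseteq> {fst k<..<snd k}" if "i \<in> D k" for i using sub2[OF inI[OF that]] by simp
      qed simp
      also have "\<dots> = ennreal (snd k - fst k)" using disjoint_intervalsD(2)[OF E k] by simp
      finally show "(\<Sum>i\<in>D k. r (k, i) - l (k, i)) \<le> snd k - fst k"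
        using disjoint_intervalsD(2)[OF E k] by (simp add: ennreal_le_iff)
    qed
    also have "\<dots> < d" using len by (simp add: case_prod_beta)
    finally have lenI: "(\<Sum>i\<in>I. r i - l i) < d" .
    have "(\<Sum>(a, b)\<in>E. norm (variation_upto f b - variation_upto f a)) =
        (\<Sum>k\<in>E. variation_upto f (snd k) - variation_upto f (fst k))"
      unfolding case_prod_beta
    proof (rule sum.cong)
      fix k assume "k \<in> E"
      then show "norm (variation_upto f (snd k) - variation_upto f (fst k)) = variation_upto f (snd k) - variation_upto f (fst k)"
        using order_trans[OF abs_ge_zero variation_upto_increment[OF less_imp_le[OF disjoint_intervalsD(2)[OF E]]]]
        by (simp add: abs_of_nonneg)
    qed simp
    also have "\<dots> \<le> (\<Sum>k\<in>E. (\<Sum>i\<in>D k. norm (f (r (k, i)) - f (l (k, i)))) + \<eta>)"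
      by (intro sum_mono) (simp add: Dk(3) r_def l_def)
    also have "\<dots> = (\<Sum>i\<in>I. norm (f (r i) - f (l i))) + real (card E) * \<eta>"
      unfolding I_def sum.distrib using finE disjoint_intervalsD(1)[OF Dk(1)] by (subst sum.Sigma) auto
    also have "\<dots> < e / 2 + e / 2"
    proof (rule add_strict_mono)
      show "(\<Sum>i\<in>I. norm (f (r i) - f (l i))) < e / 2"
        using d(2)[rule_format, OF finI le fam lenI] .
      show "real (card E) * \<eta> < e / 2" using e by (simp add: \<eta>_def field_simps)
    qed
    finally show "(\<Sum>(a, b)\<in>E. norm (variation_upto f b - variation_upto f a)) < e" by simp
  qed
qed

end

text \<open>An open set is a countable union of closed intervals. A finite subunion is divided into
  nonoverlapping intervals, so its Stieltjes measure is at most the sum of the increments of g,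
  hence at most e; continuity from below passes to the whole set.\<close>

lemma emeasure_interval_measure_open_le:
  fixes g :: "real \<Rightarrow> real"
  assumes mono: "mono g" and cont: "continuous_on UNIV g" and U: "open U" "emeasure lborel U < ennreal d"
    and d: "\<forall>(I::real set set) l r. finite I \<longrightarrow> (\<forall>i\<in>I. l i \<le> r i) \<longrightarrow> disjoint_family_on (\<lambda>i. {l i<..<r i}) I \<longrightarrow>
      (\<Sum>i\<in>I. r i - l i) < d \<longrightarrow> (\<Sum>i\<in>I. norm (g (r i) - g (l i))) < e"
  shows "emeasure (interval_measure g) U \<le> ennreal e"
proof -
  have mono': "\<And>x y. x \<le> y \<Longrightarrow> g x \<le> g y" using mono by (simp add: monoD)
  obtain \<D> where \<D>: "countable \<D>" "\<D> \<subseteq> Pow U" "\<And>X. X \<in> \<D> \<Longrightarrow> \<exists>a b. X = cbox a b" "\<Union>\<D> = U"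
    using open_countable_Union_open_cbox[OF U(1)] by metis
  have cboxes: "emeasure (interval_measure g) (\<Union>\<F>) \<le> ennreal e" if \<F>: "finite \<F>" "\<F> \<subseteq> \<D>" for \<F>
  proof -
    obtain p where p: "p division_of \<Union>\<F>"
      using elementary_unions_intervals[of \<F>] \<F> \<D>(3) by blast
    note fin = division_ofD(1)[OF p]
    have ivl: "\<exists>a b. a \<le> b \<and> K = {a..b}" if "K \<in> p" for K
    proof -
      have "\<exists>a b. K = cbox a b" using division_ofD(4)[OF p that] .
      then obtain a b where "K = cbox a b" by blast
      then show ?thesis using division_ofD(3)[OF p that] by (intro exI[of _ a] exI[of _ b]) simp
    qed
    define l where "l K = Inf K" for K :: "real set"
    define r where "r K = Sup K" for K :: "real set"
    have K: "K = {l K..r K}" "l K \<le> r K" if "K \<in> p" for K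
      using ivl[OF that] by (auto simp: l_def r_def)
    have fam: "disjoint_family_on (\<lambda>K. {l K<..<r K}) p"
      unfolding disjoint_family_on_def
    proof (intro ballI impI)
      fix K1 K2 assume KK: "K1 \<in> p" "K2 \<in> p" "K1 \<noteq> K2"
      have "interior K1 = {l K1<..<r K1}" "interior K2 = {l K2<..<r K2}"
        using K(1)[OF KK(1)] K(1)[OF KK(2)] interior_atLeastAtMost_real by metis+
      then show "{l K1<..<r K1} \<inter> {l K2<..<r K2} = {}" using division_ofD(5)[OF p KK] by simp
    qed
    have "ennreal (\<Sum>K\<in>p. r K - l K) \<le> emeasure lborel U"
    proof (rule sum_lengths_le_emeasure[OF fin K(2) fam])
      fix K assume Kp: "K \<in> p"
      have "{l K<..<r K} \<subseteq> K" by (subst (3) K(1)[OF Kp]) auto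
      also have "K \<subseteq> U" using division_ofD(2)[OF p Kp] \<F>(2) \<D>(2) by blast
      finally show "{l K<..<r K} \<subseteq> U" .
    qed (use U in auto)
    then have "ennreal (\<Sum>K\<in>p. r K - l K) < ennreal d" using U(2) by (rule le_less_trans)
    then have "(\<Sum>K\<in>p. r K - l K) < d" by (simp add: ennreal_less_iff sum_nonneg K(2))
    then have lt: "(\<Sum>K\<in>p. norm (g (r K) - g (l K))) < e"
      using d[rule_format, OF fin K(2) fam] by blast
    have "emeasure (interval_measure g) (\<Union>\<F>) = emeasure (interval_measure g) (\<Union>K\<in>p. K)"
      using division_ofD(6)[OF p] by simp
    also have "\<dots> \<le> (\<Sum>K\<in>p. emeasure (interval_measure g) K)"
    proof (rule emeasure_subadditive_finite[OF fin])
      show "(\<lambda>K. K) ` p \<subseteq> sets (interval_measure g)"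
      proof clarify
        fix K assume "K \<in> p"
        then have "K = {l K..r K}" by (rule K)
        then show "K \<in> sets (interval_measure g)"
          by (metis borel_closed closed_atLeastAtMost sets_interval_measure)
      qed
    qed
    also have "\<dots> = (\<Sum>K\<in>p. ennreal (norm (g (r K) - g (l K))))"
    proof (rule sum.cong)
      fix K assume Kp: "K \<in> p"
      have "emeasure (interval_measure g) K = emeasure (interval_measure g) {l K..r K}"
        using K(1)[OF Kp] by simp
      also have "\<dots> = ennreal (g (r K) - g (l K))"
        by (rule emeasure_interval_measure_Icc[OF K(2)[OF Kp] mono' cont])
      finally show "emeasure (interval_measure g) K = ennreal (norm (g (r K) - g (l K)))"
        using mono'[OF K(2)[OF Kp]] by simp
    qed simp
    also have "\<dots> = ennreal (\<Sum>K\<in>p. norm (g (r K) - g (l K)))" by simp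
    also have "\<dots> \<le> ennreal e" using lt by (intro ennreal_leI) simp
    finally show ?thesis .
  qed
  show ?thesis
  proof (cases "\<D> = {}")
    case True
    then show ?thesis using \<D>(4) by simp
  next
    case False
    define F where "F n = \<Union>(from_nat_into \<D> ` {..<n})" for n :: nat
    have F1: "emeasure (interval_measure g) (F n) \<le> ennreal e" for n
      unfolding F_def using False by (intro cboxes) (auto intro: from_nat_into)
    have meas: "F n \<in> sets (interval_measure g)" for n
    proof -
      have "from_nat_into \<D> k \<in> sets borel" for k
        using \<D>(3)[OF from_nat_into[OF False, of k]] by auto
      then show ?thesis by (auto simp: F_def)
    qed
    have inc: "incseq F" unfolding incseq_def F_def by (auto intro!: Union_mono image_mono)
    have "(\<Union>n. F n) = U"
    proof -
      have "(\<Union>n. F n) = \<Union>(range (from_nat_into \<D>))" by (auto simp: F_def)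
      then show ?thesis using \<D>(4) range_from_nat_into[OF False \<D>(1)] by simp
    qed
    then have "emeasure (interval_measure g) U = (SUP n. emeasure (interval_measure g) (F n))"
      using SUP_emeasure_incseq[of F "interval_measure g"] meas inc by (auto simp: image_subset_iff)
    also have "\<dots> \<le> ennreal e" by (intro SUP_least F1)
    finally show ?thesis .
  qed
qed

text \<open>The Stieltjes measure of g is absolutely continuous: a Lebesgue null set sits in open
  sets of arbitrarily small length, whose Stieltjes measure is small. Radon-Nikodym then provides
  the density.\<close>

lemma mono_abs_continuous_line_integral:
  fixes g :: "real \<Rightarrow> real"
  assumes mono: "mono g" and ac: "abs_continuous_line g"
  shows "\<exists>u. integrable lborel u \<and> (\<forall>t\<in>{\<alpha>..\<beta>}. g t - g \<alpha> = (LINT s:{\<alpha>..t}|lborel. u s))"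
proof (cases "\<alpha> \<le> \<beta>")
  case True
  have mono': "\<And>x y. x \<le> y \<Longrightarrow> g x \<le> g y" using mono by (simp add: monoD)
  have cont: "continuous_on UNIV g" using ac by (rule abs_continuous_line_continuous)
  define \<mu> where "\<mu> = interval_measure g"
  have "absolutely_continuous (lborel :: real measure) \<mu>"
    unfolding absolutely_continuous_def
  proof
    fix N :: "real set" assume N: "N \<in> null_sets lborel"
    have "emeasure \<mu> N \<le> ennreal e" if e: "e > 0" for e
    proof -
      obtain d where d: "d > 0"
        "\<forall>(I::real set set) l r. finite I \<longrightarrow> (\<forall>i\<in>I. l i \<le> r i) \<longrightarrow> disjoint_family_on (\<lambda>i. {l i<..<r i}) I \<longrightarrow>
          (\<Sum>i\<in>I. r i - l i) < d \<longrightarrow> (\<Sum>i\<in>I. norm (g (r i) - g (l i))) < e"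
        by (rule abs_continuous_lineE[OF ac e])
      have Nl: "N \<in> sets lebesgue" "emeasure lebesgue N = 0" using N by (auto simp: null_sets_def)
      obtain U where U: "open U" "N \<subseteq> U" "U - N \<in> lmeasurable" "emeasure lebesgue (U - N) < ennreal d"
        by (rule sets_lebesgue_outer_open[OF Nl(1) d(1)])
      have "emeasure lborel U = emeasure lebesgue U" using U(1) by simp
      also have "\<dots> = emeasure lebesgue ((U - N) \<union> N)" using U(2) by (simp add: Un_absorb2)
      also have "\<dots> \<le> emeasure lebesgue (U - N) + emeasure lebesgue N"
        using U(3) Nl by (intro emeasure_subadditive) (auto simp: fmeasurable_def)
      finally have "emeasure lborel U < ennreal d" using U(4) Nl(2) by simp
      then have "emeasure \<mu> U \<le> ennreal e"
        unfolding \<mu>_def by (rule emeasure_interval_measure_open_le[OF mono cont U(1) _ d(2)])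
      moreover have "emeasure \<mu> N \<le> emeasure \<mu> U" using U by (intro emeasure_mono) (auto simp: \<mu>_def)
      ultimately show ?thesis by (rule order_trans[rotated])
    qed
    then have "emeasure \<mu> N \<le> 0 + ennreal e" if "e > 0" for e using that by simp
    then have "emeasure \<mu> N \<le> 0" by (rule ennreal_le_epsilon)
    then show "N \<in> null_sets \<mu>" using N by (auto simp: null_sets_def \<mu>_def)
  qed
  then obtain f where f: "f \<in> borel_measurable lborel" "density lborel f = \<mu>"
    using sigma_finite_measure.Radon_Nikodym[OF sigma_finite_lborel, of \<mu>] by (auto simp: \<mu>_def)
  have fm[measurable]: "f \<in> borel_measurable borel" using f(1) by simp
  have fint: "(\<integral>\<^sup>+s. f s * indicator {\<alpha>..t} s \<partial>lborel) = ennreal (g t - g \<alpha>)" if "\<alpha> \<le> t" for t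
  proof -
    have "(\<integral>\<^sup>+s. f s * indicator {\<alpha>..t} s \<partial>lborel) = emeasure \<mu> {\<alpha>..t}"
      unfolding f(2)[symmetric] by (simp add: emeasure_density)
    then show ?thesis unfolding \<mu>_def using emeasure_interval_measure_Icc[OF that mono' cont] by simp
  qed
  \<comment> \<open>The Radon-Nikodym density takes values in [0, infinity]; on [\<alpha>, \<beta>]
    it is finite almost everywhere because its integral there is the increment of g.\<close>
  have "AE s in lborel. f s * indicator {\<alpha>..\<beta>} s \<noteq> \<infinity>"
    by (rule nn_integral_PInf_AE) (use fint[OF True] in auto)
  then have fin: "AE s in lborel. s \<in> {\<alpha>..\<beta>} \<longrightarrow> f s = ennreal (enn2real (f s))"
    by eventually_elim (auto simp: ennreal_enn2real_if)
  define u where "u s = indicator {\<alpha>..\<beta>} s * enn2real (f s)" for s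
  have um[measurable]: "u \<in> borel_measurable borel" unfolding u_def by measurable
  have u0: "u s \<ge> 0" for s by (simp add: u_def)
  have uint: "(\<integral>\<^sup>+s. ennreal (indicator {\<alpha>..t} s * u s) \<partial>lborel) = ennreal (g t - g \<alpha>)" if "t \<in> {\<alpha>..\<beta>}" for t
  proof -
    have "(\<integral>\<^sup>+s. ennreal (indicator {\<alpha>..t} s * u s) \<partial>lborel) = (\<integral>\<^sup>+s. f s * indicator {\<alpha>..t} s \<partial>lborel)"
    proof (rule nn_integral_cong_AE)
      show "AE s in lborel. ennreal (indicator {\<alpha>..t} s * u s) = f s * indicator {\<alpha>..t} s"
        using fin by eventually_elim (use that in \<open>auto simp: u_def indicator_def\<close>)
    qed
    then show ?thesis using fint that by simp
  qed
  have "integrable lborel u"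
  proof (rule integrableI_nonneg)
    have "(\<integral>\<^sup>+s. ennreal (u s) \<partial>lborel) = (\<integral>\<^sup>+s. ennreal (indicator {\<alpha>..\<beta>} s * u s) \<partial>lborel)"
      by (rule nn_integral_cong) (simp add: u_def indicator_def)
    then show "(\<integral>\<^sup>+s. ennreal (u s) \<partial>lborel) < \<infinity>" using uint[of \<beta>] True by simp
  qed (use u0 in auto)
  moreover have "g t - g \<alpha> = (LINT s:{\<alpha>..t}|lborel. u s)" if t: "t \<in> {\<alpha>..\<beta>}" for t
  proof -
    have "(LINT s:{\<alpha>..t}|lborel. u s) = enn2real (\<integral>\<^sup>+s. ennreal (indicator {\<alpha>..t} s * u s) \<partial>lborel)"
      unfolding set_lebesgue_integral_def by (subst integral_eq_nn_integral) (use u0 in auto)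
    also have "\<dots> = g t - g \<alpha>" unfolding uint[OF t] using mono'[of \<alpha> t] t by simp
    finally show ?thesis by simp
  qed
  ultimately show ?thesis by blast
qed auto

text \<open>Jordan decomposition of each coordinate F: with g its variation, both g and g - F are
  monotone and absolutely continuous, so each of them has a density.\<close>

theorem abs_continuous_on_interval_integral:
  fixes f :: "real \<Rightarrow> 'a::euclidean_space"
  assumes "\<alpha> < \<beta>" and f: "abs_continuous_on_interval \<alpha> \<beta> f"
  obtains u where "integrable lborel u" "\<And>t. t \<in> {\<alpha>..\<beta>} \<Longrightarrow> f t - f \<alpha> = (LINT s:{\<alpha>..t}|lborel. u s)"
proof -
  have "\<exists>u. integrable lborel u \<and> (\<forall>t\<in>{\<alpha>..\<beta>}. (f t - f \<alpha>) \<bullet> i = (LINT s:{\<alpha>..t}|lborel. u s))"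
    if i: "i \<in> Basis" for i
  proof -
    \<comment> \<open>Clamping extends the coordinate by constants to the line, which is the setting
      of the variation lemmas.\<close>
    define F where "F t = f (max \<alpha> (min \<beta> t)) \<bullet> i" for t
    have "abs_continuous_on_interval \<alpha> \<beta> (\<lambda>t. f t \<bullet> i)"
      unfolding abs_continuous_on_interval_def
    proof (intro allI impI)
      fix e :: real assume "e > 0"
      from f[unfolded abs_continuous_on_interval_def, THEN spec, THEN mp, OF this]
      obtain d where d: "d > 0 \<and> (\<forall>D. finite D \<and> (\<forall>(a, b)\<in>D. \<alpha> \<le> a \<and> a < b \<and> b \<le> \<beta>) \<and>
        disjoint_family_on (\<lambda>(a, b). {a<..<b}) D \<and> (\<Sum>(a, b)\<in>D. b - a) < d
        \<longrightarrow> (\<Sum>(a, b)\<in>D. norm (f b - f a)) < e)" by (rule exE)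
      show "\<exists>d>0. \<forall>D. finite D \<and> (\<forall>(a, b)\<in>D. \<alpha> \<le> a \<and> a < b \<and> b \<le> \<beta>) \<and>
        disjoint_family_on (\<lambda>(a, b). {a<..<b}) D \<and> (\<Sum>(a, b)\<in>D. b - a) < d
        \<longrightarrow> (\<Sum>(a, b)\<in>D. norm (f b \<bullet> i - f a \<bullet> i)) < e"
      proof (rule exI[of _ d], rule conjI[OF d[THEN conjunct1]], intro allI impI)
        fix D assume D: "finite D \<and> (\<forall>(a, b)\<in>D. \<alpha> \<le> a \<and> a < b \<and> b \<le> \<beta>) \<and>
          disjoint_family_on (\<lambda>(a, b). {a<..<b}) D \<and> (\<Sum>(a, b)\<in>D. b - a) < d"
        have "(\<Sum>(a, b)\<in>D. norm (f b \<bullet> i - f a \<bullet> i)) \<le> (\<Sum>(a, b)\<in>D. norm (f b - f a))"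
          unfolding case_prod_beta
        proof (rule sum_mono)
          fix p
          show "norm (f (snd p) \<bullet> i - f (fst p) \<bullet> i) \<le> norm (f (snd p) - f (fst p))"
            using Basis_le_norm[OF i, of "f (snd p) - f (fst p)"] by (simp add: inner_diff_left)
        qed
        also have "\<dots> < e" using d[THEN conjunct2, THEN spec, THEN mp, OF D] .
        finally show "(\<Sum>(a, b)\<in>D. norm (f b \<bullet> i - f a \<bullet> i)) < e" .
      qed
    qed
    from abs_continuous_line_clamp[OF this less_imp_le[OF assms(1)]]
    have acF: "abs_continuous_line F" unfolding F_def .
    have "F (max \<alpha> (min \<beta> t)) = F t" for t using assms(1) by (simp add: F_def)
    then obtain B where B: "\<And>D. disjoint_intervals D \<Longrightarrow> (\<Sum>(a, b)\<in>D. norm (F b - F a)) \<le> B"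
      using abs_continuous_line_bounded_variation[OF acF assms(1)] by metis
    have B': "(\<Sum>(a, b)\<in>D. \<bar>F b - F a\<bar>) \<le> B" if "disjoint_intervals D" for D
      using B[OF that] by simp
    define g where "g = variation_upto F"
    define h where "h t = g t - F t" for t
    have acg: "abs_continuous_line g" unfolding g_def by (rule abs_continuous_line_variation_upto[OF B' acF])
    have ach: "abs_continuous_line h" unfolding h_def by (rule abs_continuous_line_diff[OF acg acF])
    have incr: "\<bar>F t - F s\<bar> \<le> g t - g s" if "s \<le> t" for s t
      unfolding g_def by (rule variation_upto_increment[OF B' that])
    have "mono g" by (rule monoI) (use incr in force)
    have "mono h"
    proof (rule monoI)
      fix s t :: real assume "s \<le> t"
      from incr[OF this] show "h s \<le> h t" unfolding h_def by linarith
    qed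
    obtain u1 where u1: "integrable lborel u1" "\<forall>t\<in>{\<alpha>..\<beta>}. g t - g \<alpha> = (LINT s:{\<alpha>..t}|lborel. u1 s)"
      using mono_abs_continuous_line_integral[OF \<open>mono g\<close> acg] by metis
    obtain u2 where u2: "integrable lborel u2" "\<forall>t\<in>{\<alpha>..\<beta>}. h t - h \<alpha> = (LINT s:{\<alpha>..t}|lborel. u2 s)"
      using mono_abs_continuous_line_integral[OF \<open>mono h\<close> ach] by metis
    have "(f t - f \<alpha>) \<bullet> i = (LINT s:{\<alpha>..t}|lborel. u1 s - u2 s)" if t: "t \<in> {\<alpha>..\<beta>}" for t
    proof -
      have "(f t - f \<alpha>) \<bullet> i = F t - F \<alpha>" using t by (simp add: F_def inner_diff_left)
      also have "\<dots> = (g t - g \<alpha>) - (h t - h \<alpha>)" by (simp add: h_def)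
      also have "\<dots> = (LINT s:{\<alpha>..t}|lborel. u1 s - u2 s)"
        unfolding u1(2)[rule_format, OF t] u2(2)[rule_format, OF t]
        by (rule set_integral_diff(2)[symmetric]; unfold set_integrable_def, rule integrable_mult_indicator) (use u1 u2 in auto)
      finally show ?thesis .
    qed
    moreover have "integrable lborel (\<lambda>s. u1 s - u2 s)" using u1(1) u2(1) by (rule Bochner_Integration.integrable_diff)
    ultimately show ?thesis by blast
  qed
  then obtain w where w: "\<And>i. i \<in> Basis \<Longrightarrow> integrable lborel (w i)"
    "\<And>i t. i \<in> Basis \<Longrightarrow> t \<in> {\<alpha>..\<beta>} \<Longrightarrow> (f t - f \<alpha>) \<bullet> i = (LINT s:{\<alpha>..t}|lborel. w i s)"
    by metis
  define u where "u s = (\<Sum>i\<in>Basis. w i s *\<^sub>R i)" for s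
  show thesis
  proof (rule that[of u])
    show "integrable lborel u" unfolding u_def using w(1)
      by (intro Bochner_Integration.integrable_sum integrable_scaleR_left)
    fix t assume t: "t \<in> {\<alpha>..\<beta>}"
    have wi: "integrable lborel (\<lambda>s. indicator {\<alpha>..t} s *\<^sub>R w i s)" if "i \<in> Basis" for i
      using w(1)[OF that] by (intro integrable_mult_indicator) auto
    have "(LINT s:{\<alpha>..t}|lborel. u s) = (\<integral>s. (\<Sum>i\<in>Basis. (indicator {\<alpha>..t} s *\<^sub>R w i s) *\<^sub>R i) \<partial>lborel)"
      unfolding set_lebesgue_integral_def u_def by (simp add: scaleR_sum_right)
    also have "\<dots> = (\<Sum>i\<in>Basis. (LINT s:{\<alpha>..t}|lborel. w i s) *\<^sub>R i)"
      unfolding set_lebesgue_integral_def using wi by (subst Bochner_Integration.integral_sum) (auto simp del: scaleR_scaleR)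
    also have "\<dots> = (\<Sum>i\<in>Basis. ((f t - f \<alpha>) \<bullet> i) *\<^sub>R i)"
      by (intro sum.cong) (simp_all add: w(2)[OF _ t])
    also have "\<dots> = f t - f \<alpha>" by (rule euclidean_representation)
    finally show "f t - f \<alpha> = (LINT s:{\<alpha>..t}|lborel. u s)" by simp
  qed
qed

section \<open>Cauchy-Schwarz and Minkowski inequalities on a general measure space\<close>

section \<open>Square integrable functions\<close>

text \<open>Functions are not identified modulo null sets, so \<open>square_norm\<close> is only a
  seminorm; this keeps all formulas at the level of functions, as in \<open>L2\<close>.\<close>

definition square_integrable :: "'a measure \<Rightarrow> ('a \<Rightarrow> 'b::euclidean_space) \<Rightarrow> bool" where
  "square_integrable M u \<longleftrightarrow> u \<in> borel_measurable M \<and> integrable M (\<lambda>s. (norm (u s))\<^sup>2)"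

definition square_norm :: "'a measure \<Rightarrow> ('a \<Rightarrow> 'b::euclidean_space) \<Rightarrow> real" where
  "square_norm M u = sqrt (\<integral>s. (norm (u s))\<^sup>2 \<partial>M)"

lemma square_integrable_measurable: "square_integrable M u \<Longrightarrow> u \<in> borel_measurable M"
  by (simp add: square_integrable_def)

lemma square_norm_nonneg [simp]: "square_norm M u \<ge> 0"
  by (simp add: square_norm_def)

lemma square_norm_squared: "(square_norm M u)\<^sup>2 = (\<integral>s. (norm (u s))\<^sup>2 \<partial>M)"
  by (simp add: square_norm_def)

lemma square_norm_norm [simp]: "square_norm M (\<lambda>s. norm (u s)) = square_norm M u"
  by (simp add: square_norm_def)

lemma square_integrable_norm: "square_integrable M u \<Longrightarrow> square_integrable M (\<lambda>s. norm (u s))"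
  by (auto simp: square_integrable_def)

lemma square_integrable_mult:
  fixes f g :: "'a \<Rightarrow> real"
  assumes "square_integrable M f" "square_integrable M g"
  shows "integrable M (\<lambda>s. f s * g s)"
proof (rule Bochner_Integration.integrable_bound)
  show "integrable M (\<lambda>s. (norm (f s))\<^sup>2 + (norm (g s))\<^sup>2)"
    using assms by (simp add: square_integrable_def)
  show "(\<lambda>s. f s * g s) \<in> borel_measurable M"
    using assms by (auto simp: square_integrable_def)
  show "AE s in M. norm (f s * g s) \<le> norm ((norm (f s))\<^sup>2 + (norm (g s))\<^sup>2)"
  proof (rule AE_I2)
    fix s
    have "0 \<le> (\<bar>f s\<bar> - \<bar>g s\<bar>)\<^sup>2" by simp
    then have "2 * (\<bar>f s\<bar> * \<bar>g s\<bar>) \<le> (f s)\<^sup>2 + (g s)\<^sup>2" by (simp add: power2_diff)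
    moreover have "\<bar>f s\<bar> * \<bar>g s\<bar> \<ge> 0" by simp
    ultimately have "\<bar>f s\<bar> * \<bar>g s\<bar> \<le> (f s)\<^sup>2 + (g s)\<^sup>2" by linarith
    then show "norm (f s * g s) \<le> norm ((norm (f s))\<^sup>2 + (norm (g s))\<^sup>2)" by (simp add: abs_mult)
  qed
qed

text \<open>Taken from the inequality for integrals with values in [0, infinity] and carried back to
  the reals, where all three integrals are finite.\<close>

lemma square_norm_Cauchy_Schwarz:
  fixes f g :: "'a \<Rightarrow> real"
  assumes f: "square_integrable M f" and g: "square_integrable M g"
  shows "(\<integral>s. \<bar>f s\<bar> * \<bar>g s\<bar> \<partial>M) \<le> square_norm M f * square_norm M g"
proof -
  have [measurable]: "f \<in> borel_measurable M" "g \<in> borel_measurable M"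
    using assms by (auto simp: square_integrable_def)
  have int: "integrable M (\<lambda>s. \<bar>f s\<bar> * \<bar>g s\<bar>)"
    using square_integrable_mult[OF square_integrable_norm[OF f] square_integrable_norm[OF g]] by simp
  define a where "a = (\<integral>s. \<bar>f s\<bar> * \<bar>g s\<bar> \<partial>M)"
  have a: "a \<ge> 0" unfolding a_def by (intro integral_nonneg_AE) auto
  have F: "(\<integral>\<^sup>+s. ennreal \<bar>h s\<bar> ^ 2 \<partial>M) = ennreal ((square_norm M h)\<^sup>2)"
    if "square_integrable M h" for h :: "'a \<Rightarrow> real"
  proof -
    have "(\<integral>\<^sup>+s. ennreal \<bar>h s\<bar> ^ 2 \<partial>M) = (\<integral>\<^sup>+s. ennreal ((norm (h s))\<^sup>2) \<partial>M)"
      by (intro nn_integral_cong) (simp add: ennreal_power)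
    also have "\<dots> = ennreal ((square_norm M h)\<^sup>2)"
      unfolding square_norm_squared
      by (rule nn_integral_eq_integral) (use that in \<open>auto simp: square_integrable_def\<close>)
    finally show ?thesis .
  qed
  have "(\<integral>\<^sup>+s. ennreal \<bar>f s\<bar> * ennreal \<bar>g s\<bar> \<partial>M) = (\<integral>\<^sup>+s. ennreal (\<bar>f s\<bar> * \<bar>g s\<bar>) \<partial>M)"
    by (intro nn_integral_cong) (simp add: ennreal_mult)
  also have "\<dots> = ennreal a" unfolding a_def by (rule nn_integral_eq_integral[OF int]) auto
  finally have eq: "(\<integral>\<^sup>+s. ennreal \<bar>f s\<bar> * ennreal \<bar>g s\<bar> \<partial>M) = ennreal a" .
  have "(ennreal a)\<^sup>2 \<le> ennreal ((square_norm M f)\<^sup>2) * ennreal ((square_norm M g)\<^sup>2)"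
    unfolding eq[symmetric] F[OF f, symmetric] F[OF g, symmetric]
    by (rule Cauchy_Schwarz_nn_integral) auto
  then have "ennreal (a\<^sup>2) \<le> ennreal ((square_norm M f)\<^sup>2) * ennreal ((square_norm M g)\<^sup>2)"
    using a by (simp add: ennreal_power)
  then have "a\<^sup>2 \<le> (square_norm M f * square_norm M g)\<^sup>2"
    by (simp add: ennreal_mult[symmetric] ennreal_le_iff power_mult_distrib)
  then show ?thesis unfolding a_def[symmetric] by (rule power2_le_imp_le) simp
qed

lemma square_norm_mono:
  assumes "square_integrable M w" "AE s in M. norm (u s) \<le> norm (w s)" "u \<in> borel_measurable M"
  shows "square_integrable M u" "square_norm M u \<le> square_norm M w"
proof -
  have le: "AE s in M. (norm (u s))\<^sup>2 \<le> (norm (w s))\<^sup>2"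
    using assms(2) by eventually_elim (simp add: power_mono)
  show u: "square_integrable M u"
    unfolding square_integrable_def
  proof (intro conjI)
    show "integrable M (\<lambda>s. (norm (u s))\<^sup>2)"
      by (rule Bochner_Integration.integrable_bound[of M "\<lambda>s. (norm (w s))\<^sup>2"])
        (use assms le in \<open>auto simp: square_integrable_def\<close>)
  qed (use assms in auto)
  show "square_norm M u \<le> square_norm M w"
    unfolding square_norm_def
    using u assms le by (intro real_sqrt_le_mono integral_mono_AE) (auto simp: square_integrable_def)
qed

text \<open>Minkowski's inequality: the square is expanded and Cauchy-Schwarz applied to the mixed
  term.\<close>

lemma square_integrable_add:
  assumes "square_integrable M u" "square_integrable M w"
  shows "square_integrable M (\<lambda>s. u s + w s)" "square_norm M (\<lambda>s. u s + w s) \<le> square_norm M u + square_norm M w"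
proof -
  have [measurable]: "u \<in> borel_measurable M" "w \<in> borel_measurable M"
    using assms by (auto simp: square_integrable_def)
  have int: "integrable M (\<lambda>s. norm (u s) * norm (w s))"
    using square_integrable_mult[OF assms[THEN square_integrable_norm]] by simp
  have le: "(norm (u s + w s))\<^sup>2 \<le> (norm (u s))\<^sup>2 + 2 * (norm (u s) * norm (w s)) + (norm (w s))\<^sup>2" for s
    using power_mono[OF norm_triangle_ineq[of "u s" "w s"], of 2] by (simp add: power2_sum)
  have int2: "integrable M (\<lambda>s. (norm (u s))\<^sup>2 + 2 * (norm (u s) * norm (w s)) + (norm (w s))\<^sup>2)"
    using assms int by (simp add: square_integrable_def)
  have int1: "integrable M (\<lambda>s. (norm (u s + w s))\<^sup>2)"
  proof (rule Bochner_Integration.integrable_bound[OF int2])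
    show "AE s in M. norm ((norm (u s + w s))\<^sup>2) \<le> norm ((norm (u s))\<^sup>2 + 2 * (norm (u s) * norm (w s)) + (norm (w s))\<^sup>2)"
      unfolding real_norm_def abs_power2 by (intro AE_I2 order_trans[OF le abs_ge_self])
  qed simp
  then show "square_integrable M (\<lambda>s. u s + w s)" by (simp add: square_integrable_def)
  have "(square_norm M (\<lambda>s. u s + w s))\<^sup>2 \<le> (\<integral>s. (norm (u s))\<^sup>2 + 2 * (norm (u s) * norm (w s)) + (norm (w s))\<^sup>2 \<partial>M)"
    unfolding square_norm_squared by (intro integral_mono int1 int2 le)
  also have "\<dots> = (square_norm M u)\<^sup>2 + 2 * (\<integral>s. norm (u s) * norm (w s) \<partial>M) + (square_norm M w)\<^sup>2"
    unfolding square_norm_squared using assms int by (simp add: square_integrable_def)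
  also have "\<dots> \<le> (square_norm M u)\<^sup>2 + 2 * (square_norm M u * square_norm M w) + (square_norm M w)\<^sup>2"
    using square_norm_Cauchy_Schwarz[OF assms[THEN square_integrable_norm]] by simp
  also have "\<dots> = (square_norm M u + square_norm M w)\<^sup>2" by (simp add: power2_sum)
  finally show "square_norm M (\<lambda>s. u s + w s) \<le> square_norm M u + square_norm M w"
    by (rule power2_le_imp_le) simp
qed

lemma square_integrable_scaleR:
  assumes "square_integrable M u"
  shows "square_integrable M (\<lambda>s. c *\<^sub>R u s)" "square_norm M (\<lambda>s. c *\<^sub>R u s) = \<bar>c\<bar> * square_norm M u"
  using assms by (auto simp: square_integrable_def square_norm_def power_mult_distrib real_sqrt_mult)

lemma square_integrable_diff:
  assumes "square_integrable M u" "square_integrable M w"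
  shows "square_integrable M (\<lambda>s. u s - w s)" "square_norm M (\<lambda>s. u s - w s) \<le> square_norm M u + square_norm M w"
  using square_integrable_add[OF assms(1) square_integrable_scaleR(1)[OF assms(2), of "-1"]]
    square_integrable_scaleR(2)[OF assms(2), of "-1"] by simp_all

lemma (in finite_measure) square_integrable_integrable:
  assumes "square_integrable M u"
  shows "integrable M u"
proof -
  have "integrable M (\<lambda>s. norm (u s))"
    by (rule square_integrable_imp_integrable) (use assms in \<open>auto simp: square_integrable_def\<close>)
  then show ?thesis using integrable_norm_iff[OF square_integrable_measurable[OF assms]] by simp
qed

lemma (in finite_measure) square_integrable_bounded:
  assumes "u \<in> borel_measurable M" "\<And>s. s \<in> space M \<Longrightarrow> norm (u s) \<le> B"
  shows "square_integrable M u" "square_norm M u \<le> sqrt (measure M (space M)) * \<bar>B\<bar>"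
proof -
  have c: "square_integrable M (\<lambda>_. B)" by (simp add: square_integrable_def)
  have le: "AE s in M. norm (u s) \<le> norm B" using assms(2) by (intro AE_I2) force
  show "square_integrable M u" by (rule square_norm_mono(1)[OF c le assms(1)])
  have "square_norm M u \<le> square_norm M (\<lambda>_. B)" by (rule square_norm_mono(2)[OF c le assms(1)])
  also have "\<dots> = sqrt (measure M (space M)) * \<bar>B\<bar>" by (simp add: square_norm_def real_sqrt_mult)
  finally show "square_norm M u \<le> sqrt (measure M (space M)) * \<bar>B\<bar>" .
qed

lemma square_norm_cong_AE:
  assumes "u \<in> borel_measurable M" "w \<in> borel_measurable M" "AE s in M. u s = w s"
  shows "square_integrable M u = square_integrable M w" "square_norm M u = square_norm M w"
proof -
  have ae: "AE s in M. (norm (u s))\<^sup>2 = (norm (w s))\<^sup>2" using assms(3) by eventually_elim simp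
  then show "square_integrable M u = square_integrable M w"
    unfolding square_integrable_def using assms integrable_cong_AE[OF _ _ ae] by simp
  show "square_norm M u = square_norm M w" unfolding square_norm_def
    by (rule arg_cong[where f=sqrt], rule integral_cong_AE[OF _ _ ae]) (use assms in auto)
qed

section \<open>The isometry between L2 and \<open>AC02\<close> given by primitives\<close>

section \<open>The space of primitives of square integrable functions\<close>

text \<open>Completeness of Lebesgue measure. It makes functions measurable that are known only
  almost everywhere, such as \<open>interval_deriv\<close> of a primitive.\<close>

lemma borel_measurable_lebesgue_on_cong_AE:
  fixes f g :: "'a::euclidean_space \<Rightarrow> 'b::euclidean_space"
  assumes S: "S \<in> sets lebesgue" and f: "f \<in> borel_measurable (lebesgue_on S)"
    and ae: "AE s in lebesgue_on S. f s = g s"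
  shows "g \<in> borel_measurable (lebesgue_on S)"
proof -
  have f': "(\<lambda>s. indicator S s *\<^sub>R f s) \<in> borel_measurable lebesgue"
    using f S by (simp add: borel_measurable_restrict_space_iff)
  have ae': "AE s in lebesgue. indicator S s *\<^sub>R f s = indicator S s *\<^sub>R g s"
  proof -
    have "AE s in lebesgue. s \<in> S \<longrightarrow> f s = g s" using ae S by (subst (asm) AE_restrict_space_iff) auto
    then show ?thesis by eventually_elim (auto simp: indicator_def)
  qed
  have "(\<lambda>s. indicator S s *\<^sub>R g s) \<in> borel_measurable lebesgue"
  proof (rule measurableI)
    fix A :: "'b set" assume A: "A \<in> sets borel"
    show "(\<lambda>s. indicator S s *\<^sub>R g s) -` A \<inter> space lebesgue \<in> sets lebesgue"
    proof (rule completion.in_sets_AE)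
      show "(\<lambda>s. indicator S s *\<^sub>R f s) -` A \<inter> space lebesgue \<in> sets lebesgue"
        using f' A by (rule measurable_sets)
      show "AE s in lebesgue. (s \<in> (\<lambda>s. indicator S s *\<^sub>R f s) -` A \<inter> space lebesgue) =
          (s \<in> (\<lambda>s. indicator S s *\<^sub>R g s) -` A \<inter> space lebesgue)"
        using ae' by eventually_elim (simp only: vimage_def mem_Collect_eq Int_iff)
    qed simp
  qed simp
  then show ?thesis using S by (simp add: borel_measurable_restrict_space_iff)
qed

text \<open>A bridge from the completed measure to Borel functions, the form in which Lebesgue
  points and Fubini on the plane are used. Coordinates are treated separately.\<close>

lemma integrable_lebesgue_on_borel_representative:
  fixes u :: "'a::euclidean_space \<Rightarrow> 'b::euclidean_space"
  assumes S: "S \<in> sets lebesgue" and u: "integrable (lebesgue_on S) u"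
  obtains w where "integrable lborel w" "AE s in lebesgue. indicator S s *\<^sub>R u s = w s"
proof -
  have ui: "integrable lebesgue (\<lambda>s. indicator S s *\<^sub>R u s)"
    using u S integrable_restrict_space[of S lebesgue u] by (simp add: set_integrable_def)
  have "\<exists>w. w \<in> borel_measurable lborel \<and> (AE s in lborel. (indicator S s *\<^sub>R u s) \<bullet> i = w s)" for i
  proof -
    have "(\<lambda>s. (indicator S s *\<^sub>R u s) \<bullet> i) \<in> borel_measurable lebesgue"
      using borel_measurable_integrable[OF ui] by (intro borel_measurable_inner borel_measurable_const)
    from completion_ex_borel_measurable_real[OF this] show ?thesis by blast
  qed
  then obtain w where w: "\<And>i. w i \<in> borel_measurable lborel" "\<And>i. AE s in lborel. (indicator S s *\<^sub>R u s) \<bullet> i = w i s"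
    by metis
  define W where "W s = (\<Sum>i\<in>Basis. w i s *\<^sub>R i)" for s
  have Wm: "W \<in> borel_measurable lborel"
    unfolding W_def using w(1) by (intro borel_measurable_sum borel_measurable_scaleR) auto
  have "AE s in lborel. \<forall>i\<in>Basis. (indicator S s *\<^sub>R u s) \<bullet> i = w i s"
    using w(2) by (intro AE_finite_allI) auto
  then have ae: "AE s in lebesgue. indicator S s *\<^sub>R u s = W s"
  proof (intro AE_completion, eventually_elim)
    case (elim s)
    then have "W s = (\<Sum>i\<in>Basis. ((indicator S s *\<^sub>R u s) \<bullet> i) *\<^sub>R i)"
      unfolding W_def by (intro sum.cong) simp_all
    then show ?case by (simp only: euclidean_representation)
  qed
  have "integrable lebesgue W"
    by (rule integrable_cong_AE_imp[OF ui]) (use ae Wm in \<open>auto intro: measurable_completion\<close>)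
  then have "integrable lborel W" using integrable_completion[OF Wm] by simp
  then show thesis using ae that by blast
qed

locale compact_interval =
  fixes \<alpha> \<beta> :: real
  assumes less: "\<alpha> < \<beta>"
begin

abbreviation "M \<equiv> lebesgue_on {\<alpha>..\<beta>}"

sublocale finite_measure M
  by (rule finite_measure_lebesgue_on) simp

lemma integrable_iff_set: "integrable M f \<longleftrightarrow> set_integrable lebesgue {\<alpha>..\<beta>} f"
  for f :: "real \<Rightarrow> 'a::euclidean_space"
  unfolding set_integrable_def by (subst integrable_restrict_space) auto

lemma set_integral_eq: "t \<le> \<beta> \<Longrightarrow> (LINT s:{\<alpha>..t}|lebesgue. f s) = (\<integral>s. indicator {..t} s *\<^sub>R f s \<partial>M)"
  for f :: "real \<Rightarrow> 'a::euclidean_space"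
  unfolding set_lebesgue_integral_def
  by (subst integral_restrict_space) (auto intro!: Bochner_Integration.integral_cong simp: indicator_def)

lemma AE_M_iff: "(AE s in M. P s) \<longleftrightarrow> (AE s in lebesgue. s \<in> {\<alpha>..\<beta>} \<longrightarrow> P s)"
  by (subst AE_restrict_space_iff) auto

lemma mem_L2_iff: "u \<in> L2 {\<alpha>..\<beta>} \<longleftrightarrow> square_integrable M u"
  unfolding L2_def square_integrable_def
  by (simp add: set_borel_measurable_def borel_measurable_restrict_space_iff integrable_iff_set)

lemma L2_norm_eq: "L2_norm {\<alpha>..\<beta>} u = square_norm M u"
  unfolding L2_norm_def square_norm_def
  by (subst set_integral_eq) (auto intro!: arg_cong[where f=sqrt] Bochner_Integration.integral_cong simp: indicator_def)

text \<open>The extension by 0 follows the convention of \<open>AC02\<close>; the indicator has no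
  lower end because the measure already lives on [\<alpha>, \<beta>].\<close>

definition primitive :: "(real \<Rightarrow> 'a::euclidean_space) \<Rightarrow> real \<Rightarrow> 'a" where
  "primitive u t = (if t \<in> {\<alpha>..\<beta>} then \<integral>s. indicator {..t} s *\<^sub>R u s \<partial>M else 0)"

lemma borel_measurable_indicator_M: "A \<in> sets borel \<Longrightarrow> indicator A \<in> borel_measurable M"
  by (intro measurable_restrict_space1 borel_measurable_indicator) auto

lemma integrable_indicator_M: "A \<in> sets borel \<Longrightarrow> integrable M (indicator A :: real \<Rightarrow> real)"
  by (rule integrable_const_bound[of _ 1]) (auto intro: borel_measurable_indicator_M)

lemma integral_indicator_M:
  assumes "\<alpha> \<le> a" "a \<le> b" "b \<le> \<beta>"
  shows "(\<integral>s. indicator {a<..b} s \<partial>M) = b - a"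
proof -
  have "{a<..b} \<inter> {\<alpha>..\<beta>} = {a<..b}" using assms by auto
  then have "(\<integral>s. indicator {a<..b} s \<partial>M) = measure M {a<..b}" by simp
  also have "\<dots> = b - a" using assms by (subst measure_restrict_space) auto
  finally show ?thesis .
qed

lemma integrable_indicator_scaleR:
  "integrable M u \<Longrightarrow> A \<in> sets borel \<Longrightarrow> integrable M (\<lambda>s. indicator A s *\<^sub>R u s)"
  for u :: "real \<Rightarrow> 'a::euclidean_space"
proof (rule Bochner_Integration.integrable_bound[of M u])
  assume "integrable M u" "A \<in> sets borel"
  then show "(\<lambda>s. indicator A s *\<^sub>R u s) \<in> borel_measurable M"
    by (intro borel_measurable_scaleR borel_measurable_indicator_M) auto
qed (auto simp: indicator_def)

lemma primitive_start [simp]: "primitive u \<alpha> = 0"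
proof -
  have "AE s in lebesgue. s \<notin> {\<alpha>}" by (rule AE_not_in) simp
  then have "AE s in M. indicator {..\<alpha>} s *\<^sub>R u s = 0"
    unfolding AE_M_iff by eventually_elim (auto simp: indicator_def)
  then show ?thesis unfolding primitive_def by (simp add: integral_eq_zero_AE)
qed

lemma primitive_cong_AE:
  assumes "u \<in> borel_measurable M" "w \<in> borel_measurable M" "AE s in M. u s = w s"
  shows "primitive u = primitive w"
proof
  fix t
  have "(\<integral>s. indicator {..t} s *\<^sub>R u s \<partial>M) = (\<integral>s. indicator {..t} s *\<^sub>R w s \<partial>M)"
  proof (rule integral_cong_AE)
    show "AE s in M. indicator {..t} s *\<^sub>R u s = indicator {..t} s *\<^sub>R w s"
      using assms(3) by eventually_elim simp
  qed (use assms in \<open>auto intro!: borel_measurable_scaleR borel_measurable_indicator_M\<close>)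
  then show "primitive u t = primitive w t" by (simp add: primitive_def)
qed

lemma primitive_linear:
  assumes "integrable M u" "integrable M w"
  shows "primitive (\<lambda>s. u s + w s) t = primitive u t + primitive w t"
    "primitive (\<lambda>s. u s - w s) t = primitive u t - primitive w t"
    "primitive (\<lambda>s. c *\<^sub>R u s) t = c *\<^sub>R primitive u t"
proof -
  have i: "integrable M (\<lambda>s. indicator {..t} s *\<^sub>R u s)" "integrable M (\<lambda>s. indicator {..t} s *\<^sub>R w s)"
    using assms by (auto intro: integrable_indicator_scaleR)
  show "primitive (\<lambda>s. u s + w s) t = primitive u t + primitive w t"
    "primitive (\<lambda>s. u s - w s) t = primitive u t - primitive w t"
    unfolding primitive_def using i by (auto simp: scaleR_add_right scaleR_diff_right)
  have "(\<integral>s. indicator {..t} s *\<^sub>R c *\<^sub>R u s \<partial>M) = c *\<^sub>R (\<integral>s. indicator {..t} s *\<^sub>R u s \<partial>M)"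
    by (subst integral_scaleR_right[symmetric]) (simp add: mult.commute)
  then show "primitive (\<lambda>s. c *\<^sub>R u s) t = c *\<^sub>R primitive u t"
    unfolding primitive_def by auto
qed

lemma norm_primitive_diff_le:
  assumes "integrable M u" "a \<in> {\<alpha>..\<beta>}" "b \<in> {\<alpha>..\<beta>}" "a \<le> b"
  shows "norm (primitive u b - primitive u a) \<le> (\<integral>s. indicator {a<..b} s * norm (u s) \<partial>M)"
proof -
  have "primitive u b - primitive u a = (\<integral>s. indicator {..b} s *\<^sub>R u s - indicator {..a} s *\<^sub>R u s \<partial>M)"
    using assms by (simp add: primitive_def integrable_indicator_scaleR)
  also have "\<dots> = (\<integral>s. indicator {a<..b} s *\<^sub>R u s \<partial>M)"
    using assms(4) by (intro Bochner_Integration.integral_cong) (auto simp: indicator_def)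
  also have "norm \<dots> \<le> (\<integral>s. norm (indicator {a<..b} s *\<^sub>R u s) \<partial>M)"
    by (rule integral_norm_bound)
  also have "(\<lambda>s. norm (indicator {a<..b} s *\<^sub>R u s)) = (\<lambda>s. indicator {a<..b} s * norm (u s))"
    by (auto simp: indicator_def fun_eq_iff)
  finally show ?thesis .
qed

text \<open>Cauchy-Schwarz against the indicator of (\<alpha>, t]. The factor sqrt(t - \<alpha>)
  reappears as the weight of \<open>c1\<close> in \<open>c_tilde\<close>.\<close>

lemma norm_primitive_le:
  assumes "square_integrable M u" "t \<in> {\<alpha>..\<beta>}"
  shows "norm (primitive u t) \<le> sqrt (t - \<alpha>) * square_norm M u"
proof -
  have ind: "square_integrable M (indicator {\<alpha><..t} :: real \<Rightarrow> real)"
    by (rule square_integrable_bounded(1)[of _ 1]) (auto intro: borel_measurable_indicator_M simp: indicator_def)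
  have "square_norm M (indicator {\<alpha><..t} :: real \<Rightarrow> real) = sqrt (t - \<alpha>)"
  proof -
    have "(\<integral>s. (norm (indicator {\<alpha><..t} s :: real))\<^sup>2 \<partial>M) = (\<integral>s. indicator {\<alpha><..t} s \<partial>M)"
      by (intro Bochner_Integration.integral_cong) (auto simp: indicator_def)
    also have "\<dots> = t - \<alpha>" using assms by (intro integral_indicator_M) auto
    finally show ?thesis by (simp add: square_norm_def)
  qed
  moreover have "norm (primitive u t) \<le> (\<integral>s. \<bar>indicator {\<alpha><..t} s\<bar> * \<bar>norm (u s)\<bar> \<partial>M)"
    using norm_primitive_diff_le[OF square_integrable_integrable[OF assms(1)], of \<alpha> t] assms less by simp
  ultimately show ?thesis
    using square_norm_Cauchy_Schwarz[OF ind square_integrable_norm[OF assms(1)]] by simp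
qed

lemma primitive_eq_lborel:
  fixes u :: "real \<Rightarrow> 'a::euclidean_space"
  assumes "integrable M u"
  obtains w where "integrable lborel w" "AE s in M. u s = w s"
    "\<And>t. t \<in> {\<alpha>..\<beta>} \<Longrightarrow> primitive u t = (LINT s:{\<alpha>..t}|lborel. w s)"
proof -
  obtain w where w: "integrable lborel w" "AE s in lebesgue. indicator {\<alpha>..\<beta>} s *\<^sub>R u s = w s"
    by (rule integrable_lebesgue_on_borel_representative[OF _ assms]) simp
  have [measurable]: "w \<in> borel_measurable borel" using borel_measurable_integrable[OF w(1)] by simp
  show thesis
  proof (rule that[OF w(1)])
    show ae: "AE s in M. u s = w s"
      unfolding AE_M_iff using w(2) by eventually_elim auto
    fix t assume t: "t \<in> {\<alpha>..\<beta>}"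
    have "primitive u t = primitive w t"
    proof (rule fun_cong[OF primitive_cong_AE[OF _ _ ae]])
      show "w \<in> borel_measurable M"
        by (rule borel_measurable_lebesgue_on_cong_AE[OF _ _ ae]) (use assms in auto)
    qed (use assms in auto)
    also have "\<dots> = (LINT s:{\<alpha>..t}|lebesgue. w s)" using t by (simp add: primitive_def set_integral_eq)
    also have "\<dots> = (LINT s:{\<alpha>..t}|lborel. w s)"
      unfolding set_lebesgue_integral_def by (rule integral_completion) simp
    finally show "primitive u t = (LINT s:{\<alpha>..t}|lborel. w s)" .
  qed
qed

text \<open>At an interior point the derivative within [\<alpha>, \<beta>] is the ordinary one, to
  which Lebesgue's differentiation theorem applies; the endpoints form a null set.\<close>

lemma AE_interval_deriv_primitive:
  fixes u :: "real \<Rightarrow> 'a::euclidean_space"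
  assumes "integrable M u"
  shows "AE t in M. interval_deriv \<alpha> \<beta> (primitive u) t = u t"
proof -
  obtain w where w: "integrable lborel w" "AE s in M. u s = w s"
    "\<And>t. t \<in> {\<alpha>..\<beta>} \<Longrightarrow> primitive u t = (LINT s:{\<alpha>..t}|lborel. w s)"
    using primitive_eq_lborel[OF assms] by metis
  have "AE t in lebesgue. t \<notin> {\<alpha>, \<beta>}" by (rule AE_not_in) simp
  moreover have "AE t in lebesgue. t \<in> {\<alpha>..\<beta>} \<longrightarrow> u t = w t" using w(2) by (simp add: AE_M_iff)
  moreover note AE_has_vector_derivative_integral_lborel[OF w(1), of \<alpha>]
  ultimately show ?thesis
    unfolding AE_M_iff
  proof eventually_elim
    case (elim t)
    show ?case
    proof
      assume "t \<in> {\<alpha>..\<beta>}"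
      with elim have t: "t \<in> {\<alpha><..<\<beta>}" "u t = w t"
        and d: "((\<lambda>t. LINT s:{\<alpha>..t}|lborel. w s) has_vector_derivative w t) (at t)" by auto
      have "(primitive u has_vector_derivative w t) (at t)"
        by (rule has_vector_derivative_transform_within_open[OF d, of "{\<alpha><..<\<beta>}"]) (use t w(3) in auto)
      then have "vector_derivative (primitive u) (at t) = w t" by (rule vector_derivative_at)
      moreover have "at t within {\<alpha>..\<beta>} = at t" using t by (intro at_within_interior) simp
      ultimately show "interval_deriv \<alpha> \<beta> (primitive u) t = u t" using t by (simp add: interval_deriv_def)
    qed
  qed
qed

text \<open>Cauchy-Schwarz in additive form: from 2 |u| \<le> c |u|^2 + 1 / c the sum of increments
  is at most half of c times the squared norm plus the total length over c, and both terms add up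
  over a disjoint family.\<close>

lemma primitive_abs_continuous:
  assumes u: "square_integrable M u"
  shows "abs_continuous_on_interval \<alpha> \<beta> (primitive u)"
  unfolding abs_continuous_on_interval_def
proof (intro allI impI)
  fix e :: real assume e: "e > 0"
  have iu: "integrable M (\<lambda>s. norm (u s))" using square_integrable_integrable[OF u] by simp
  define N where "N = (square_norm M u)\<^sup>2"
  have N: "N \<ge> 0" by (simp add: N_def)
  \<comment> \<open>With this c the term c N stays below e, and a total length below c e contributes
    less than e after division by c.\<close>
  define c where "c = e / (N + 1)"
  have c: "c > 0" using e N by (simp add: c_def)
  have cN: "c * N < e" using e N by (simp add: c_def field_simps)
  show "\<exists>\<delta>>0. \<forall>D. finite D \<and> (\<forall>(a, b)\<in>D. \<alpha> \<le> a \<and> a < b \<and> b \<le> \<beta>) \<and>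
      disjoint_family_on (\<lambda>(a, b). {a<..<b}) D \<and> (\<Sum>(a, b)\<in>D. b - a) < \<delta>
      \<longrightarrow> (\<Sum>(a, b)\<in>D. norm (primitive u b - primitive u a)) < e"
  proof (rule exI[of _ "c * e"], rule conjI, use c e in simp, intro allI impI)
    fix D assume D: "finite D \<and> (\<forall>(a, b)\<in>D. \<alpha> \<le> a \<and> a < b \<and> b \<le> \<beta>) \<and>
      disjoint_family_on (\<lambda>(a, b). {a<..<b}) D \<and> (\<Sum>(a, b)\<in>D. b - a) < c * e"
    have fin: "finite D" using D by simp
    have ab: "\<alpha> \<le> fst p" "fst p < snd p" "snd p \<le> \<beta>" if "p \<in> D" for p
      using D that by (auto simp: case_prod_beta)
    have sq_int: "integrable M (\<lambda>s. (norm (u s))\<^sup>2)" using u by (simp add: square_integrable_def)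
    define J where "J p = (\<integral>s. indicator {fst p<..<snd p} s * (norm (u s))\<^sup>2 \<partial>M)" for p
    have each: "norm (primitive u (snd p) - primitive u (fst p)) \<le> (c * J p + (snd p - fst p) / c) / 2" if p: "p \<in> D" for p
    proof -
      let ?I = "{fst p<..snd p}"
      have i1: "integrable M (\<lambda>s. indicator ?I s * (norm (u s))\<^sup>2)"
        using integrable_indicator_scaleR[OF sq_int, of ?I] by simp
      have i2: "integrable M (\<lambda>s. indicator ?I s :: real)"
        by (rule integrable_indicator_M) simp
      have i3: "integrable M (\<lambda>s. indicator ?I s * norm (u s))"
        using integrable_indicator_scaleR[OF iu, of ?I] by simp
      have "norm (primitive u (snd p) - primitive u (fst p)) \<le> (\<integral>s. indicator ?I s * norm (u s) \<partial>M)"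
        using norm_primitive_diff_le[OF square_integrable_integrable[OF u], of "fst p" "snd p"] ab[OF p] by simp
      also have "\<dots> \<le> (\<integral>s. (c * (indicator ?I s * (norm (u s))\<^sup>2) + indicator ?I s / c) / 2 \<partial>M)"
      proof (rule integral_mono[OF i3])
        show "integrable M (\<lambda>s. (c * (indicator ?I s * (norm (u s))\<^sup>2) + indicator ?I s / c) / 2)"
          using i1 i2 by simp
        fix s
        have "0 \<le> (c * norm (u s) - 1)\<^sup>2 / c" using c by simp
        then have "2 * norm (u s) \<le> c * (norm (u s))\<^sup>2 + 1 / c"
          using c by (simp add: power2_eq_square field_simps)
        then show "indicator ?I s * norm (u s) \<le> (c * (indicator ?I s * (norm (u s))\<^sup>2) + indicator ?I s / c) / 2"
          by (auto simp: indicator_def)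
      qed
      also have "\<dots> = (c * (\<integral>s. indicator ?I s * (norm (u s))\<^sup>2 \<partial>M) + (\<integral>s. indicator ?I s \<partial>M) / c) / 2"
        using i1 i2 by simp
      \<comment> \<open>The two sets differ in one point; the open intervals are those assumed to be
        disjoint.\<close>
      also have "(\<integral>s. indicator ?I s * (norm (u s))\<^sup>2 \<partial>M) = J p"
        unfolding J_def
      proof (rule integral_cong_AE)
        have "AE s in lebesgue. s \<notin> {snd p}" by (rule AE_not_in) simp
        then show "AE s in M. indicator ?I s * (norm (u s))\<^sup>2 = indicator {fst p<..<snd p} s * (norm (u s))\<^sup>2"
          unfolding AE_M_iff by eventually_elim (auto simp: indicator_def)
      qed (use i1 integrable_indicator_scaleR[OF sq_int, of "{fst p<..<snd p}"] in auto)
      also have "(\<integral>s. indicator ?I s \<partial>M) = snd p - fst p"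
        using ab[OF p] by (intro integral_indicator_M) auto
      finally show ?thesis .
    qed
    have sumJ: "(\<Sum>p\<in>D. J p) \<le> N"
    proof -
      have "(\<Sum>p\<in>D. J p) = (\<integral>s. (\<Sum>p\<in>D. indicator {fst p<..<snd p} s * (norm (u s))\<^sup>2) \<partial>M)"
        unfolding J_def
        by (rule Bochner_Integration.integral_sum[symmetric]) (use integrable_indicator_scaleR[OF sq_int] in auto)
      also have "\<dots> \<le> (\<integral>s. (norm (u s))\<^sup>2 \<partial>M)"
      proof (rule integral_mono[OF _ sq_int])
        show "integrable M (\<lambda>s. \<Sum>p\<in>D. indicator {fst p<..<snd p} s * (norm (u s))\<^sup>2)"
          by (rule Bochner_Integration.integrable_sum) (use integrable_indicator_scaleR[OF sq_int] in auto)
        fix s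
        have "(\<Sum>p\<in>D. indicator {fst p<..<snd p} s) = (indicator (\<Union>p\<in>D. {fst p<..<snd p}) s :: real)"
          by (rule indicator_UN_disjoint[symmetric]) (use D in \<open>auto simp: case_prod_beta'\<close>)
        also have "\<dots> \<le> 1" by (simp add: indicator_def)
        finally show "(\<Sum>p\<in>D. indicator {fst p<..<snd p} s * (norm (u s))\<^sup>2) \<le> (norm (u s))\<^sup>2"
          unfolding sum_distrib_right[symmetric] by (intro mult_left_le_one_le) (auto intro: sum_nonneg)
      qed
      finally show ?thesis unfolding N_def square_norm_squared .
    qed
    have "(\<Sum>(a, b)\<in>D. norm (primitive u b - primitive u a)) \<le> (\<Sum>p\<in>D. (c * J p + (snd p - fst p) / c) / 2)"
      unfolding case_prod_beta by (intro sum_mono each)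
    also have "\<dots> = (c * (\<Sum>p\<in>D. J p) + (\<Sum>p\<in>D. snd p - fst p) / c) / 2"
      by (simp add: sum_divide_distrib[symmetric] sum.distrib sum_distrib_left)
    also have "\<dots> < (e + e) / 2"
    proof -
      have "c * (\<Sum>p\<in>D. J p) \<le> c * N" using sumJ c by simp
      then have "c * (\<Sum>p\<in>D. J p) < e" using cN by simp
      moreover have "(\<Sum>p\<in>D. snd p - fst p) < c * e" using D by (simp add: case_prod_beta)
      then have "(\<Sum>p\<in>D. snd p - fst p) / c < e" using c by (simp add: field_simps)
      ultimately show ?thesis by simp
    qed
    finally show "(\<Sum>(a, b)\<in>D. norm (primitive u b - primitive u a)) < e" by simp
  qed
qed

lemma interval_deriv_primitive:
  assumes "square_integrable M u"
  shows "square_integrable M (interval_deriv \<alpha> \<beta> (primitive u))"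
    "square_norm M (interval_deriv \<alpha> \<beta> (primitive u)) = square_norm M u"
proof -
  have ae: "AE s in M. u s = interval_deriv \<alpha> \<beta> (primitive u) s"
    using AE_interval_deriv_primitive[OF square_integrable_integrable[OF assms]] by eventually_elim simp
  have m: "interval_deriv \<alpha> \<beta> (primitive u) \<in> borel_measurable M"
    by (rule borel_measurable_lebesgue_on_cong_AE[OF _ _ ae]) (use assms in \<open>auto simp: square_integrable_def\<close>)
  show "square_integrable M (interval_deriv \<alpha> \<beta> (primitive u))"
    "square_norm M (interval_deriv \<alpha> \<beta> (primitive u)) = square_norm M u"
    using square_norm_cong_AE[OF square_integrable_measurable[OF assms] m ae] assms by auto
qed

lemma primitive_mem_AC02:
  assumes "square_integrable M u"
  shows "primitive u \<in> AC02 \<alpha> \<beta>"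
  using interval_deriv_primitive[OF assms] primitive_abs_continuous[OF assms]
  by (simp add: AC02_def mem_L2_iff) (auto simp: primitive_def)

lemma AC02_norm_primitive:
  assumes "square_integrable M u"
  shows "AC02_norm \<alpha> \<beta> (primitive u) = square_norm M u"
  using interval_deriv_primitive[OF assms] by (simp add: AC02_norm_def L2_norm_eq)

text \<open>The derivative of x agrees almost everywhere with the integrable density that absolute
  continuity provides, so this density is square integrable.\<close>

lemma AC02_primitiveE:
  assumes "x \<in> AC02 \<alpha> \<beta>"
  obtains u where "square_integrable M u" "x = primitive u"
proof -
  have x: "abs_continuous_on_interval \<alpha> \<beta> x" "x \<alpha> = 0" "square_integrable M (interval_deriv \<alpha> \<beta> x)"
    "\<And>t. t \<notin> {\<alpha>..\<beta>} \<Longrightarrow> x t = 0"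
    using assms by (auto simp: AC02_def mem_L2_iff)
  obtain w where w: "integrable lborel w" "\<And>t. t \<in> {\<alpha>..\<beta>} \<Longrightarrow> x t - x \<alpha> = (LINT s:{\<alpha>..t}|lborel. w s)"
    using abs_continuous_on_interval_integral[OF less x(1)] by metis
  have [measurable]: "w \<in> borel_measurable borel" using borel_measurable_integrable[OF w(1)] by simp
  have "integrable lebesgue w" using w(1) integrable_completion[of w lborel] by simp
  then have iw: "integrable M w" using less
    unfolding integrable_iff_set set_integrable_def by (intro integrable_mult_indicator) auto
  have eq: "x = primitive w"
  proof
    fix t
    have "(LINT s:{\<alpha>..t}|lebesgue. w s) = (LINT s:{\<alpha>..t}|lborel. w s)"
      unfolding set_lebesgue_integral_def by (rule integral_completion) simp
    then show "x t = primitive w t" using w(2)[of t] x(2,4)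
      by (auto simp: primitive_def set_integral_eq[symmetric])
  qed
  have "AE s in M. interval_deriv \<alpha> \<beta> x s = w s"
    unfolding eq by (rule AE_interval_deriv_primitive[OF iw])
  then have "square_integrable M w"
    using square_norm_cong_AE(1)[OF square_integrable_measurable[OF x(3)] borel_measurable_integrable[OF iw]] x(3) by blast
  then show thesis using eq that by blast
qed

end

section \<open>Caratheodory functions and Fubini on the triangle\<close>

section \<open>Measurability of the coefficients\<close>

text \<open>Measurability in \<tau> is given for fixed t and x only. Hence \<xi> and \<sigma> are
  replaced by approximations with countably many values, and continuity of w in (t, x) yields the
  limit. Since w is controlled only for t \<ge> \<tau>, the approximations of \<sigma> come from
  above.\<close>

lemma caratheodory_measurable:
  fixes w :: "real \<Rightarrow> real \<Rightarrow> 'a::euclidean_space \<Rightarrow> 'b::euclidean_space"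
  assumes meas: "measurable_in_tau \<alpha> \<beta> w" and G: "G \<in> sets lebesgue" "G \<subseteq> {\<alpha>..\<beta>}"
    and cont: "\<And>\<tau>. \<tau> \<in> G \<Longrightarrow> continuous_on ({\<tau>..\<beta>} \<times> UNIV) (\<lambda>(t, x). w t \<tau> x)"
    and p: "p \<in> Z \<rightarrow>\<^sub>M lebesgue" and \<sigma>[measurable]: "\<sigma> \<in> borel_measurable Z"
    and \<xi>[measurable]: "\<xi> \<in> borel_measurable Z"
  shows "(\<lambda>z. if p z \<in> G \<and> p z \<le> \<sigma> z \<and> \<sigma> z \<le> \<beta> then w (\<sigma> z) (p z) (\<xi> z) else 0) \<in> borel_measurable Z"
proof (cases "G = {}")
  case True
  then show ?thesis by simp
next
  case False
  then have \<alpha>\<beta>: "\<alpha> \<le> \<beta>" using G(2) by auto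
  have [measurable]: "p \<in> borel_measurable Z"
    by (rule measurable_compose[OF p]) (simp add: measurable_completion)
  have [measurable]: "Measurable.pred Z (\<lambda>z. p z \<in> G)"
    using measurable_sets[OF p G(1)] by (simp add: pred_def vimage_def Int_def conj_commute)
  define S where "S z \<longleftrightarrow> p z \<in> G \<and> p z \<le> \<sigma> z \<and> \<sigma> z \<le> \<beta>" for z
  have [measurable]: "Measurable.pred Z S" unfolding S_def by measurable
  \<comment> \<open>\<open>T n (c n z)\<close> rounds \<open>\<sigma> z\<close> up to a multiple of
    1/(n+1) and clamps the result to [\<alpha>, \<beta>]; where \<open>S z\<close> holds it stays in
    [p z, \<beta>].\<close>
  define T where "T n i = max \<alpha> (min \<beta> (real_of_int i / real (Suc n)))" for n :: nat and i :: int
  define c where "c n z = \<lceil>\<sigma> z * real (Suc n)\<rceil>" for n :: nat and z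
  have [measurable]: "c n \<in> measurable Z (count_space UNIV)" for n unfolding c_def by measurable
  obtain F where F: "\<And>n. simple_function Z (F n)" "\<And>z. z \<in> space Z \<Longrightarrow> (\<lambda>n. F n z) \<longlonglongrightarrow> \<xi> z"
    using borel_measurable_implies_sequence_metric[OF \<xi>, of 0] by blast
  \<comment> \<open>The cut-off at t is the form in which measurability in \<tau> is assumed; at the
    rounded times it equals 1 wherever \<open>S z\<close> holds.\<close>
  define w' where "w' t x \<tau> = indicator {\<alpha>..t} \<tau> *\<^sub>R w t \<tau> x" for t x \<tau>
  have w': "(\<lambda>z. w' (T n i) x (p z)) \<in> borel_measurable Z" for n i x
  proof (rule measurable_compose[OF p])
    have "T n i \<in> {\<alpha>..\<beta>}" using \<alpha>\<beta> by (auto simp: T_def)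
    then show "(\<lambda>\<tau>. w' (T n i) x \<tau>) \<in> borel_measurable lebesgue"
      using meas by (simp add: measurable_in_tau_def set_borel_measurable_def w'_def)
  qed
  have step1: "(\<lambda>z. w' (T n i) (F n z) (p z)) \<in> borel_measurable Z" for n i
  proof (rule measurable_compose_countable'[where I = "F n ` space Z"])
    show cnt: "countable (F n ` space Z)" using simple_functionD(1)[OF F(1)] by (rule countable_finite)
    show "F n \<in> Z \<rightarrow>\<^sub>M count_space (F n ` space Z)"
      unfolding measurable_count_space_eq2[OF simple_functionD(1)[OF F(1)]] using simple_functionD(2)[OF F(1)] by auto
  qed (rule w')
  have step2: "(\<lambda>z. w' (T n (c n z)) (F n z) (p z)) \<in> borel_measurable Z" for n
    by (rule measurable_compose_countable[OF step1]) measurable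
  have step3: "(\<lambda>z. if S z then w' (T n (c n z)) (F n z) (p z) else 0) \<in> borel_measurable Z" for n
    using step2 by measurable
  show ?thesis
    unfolding S_def[symmetric]
  proof (rule borel_measurable_LIMSEQ_metric[OF step3])
    fix z assume z: "z \<in> space Z"
    show "(\<lambda>n. if S z then w' (T n (c n z)) (F n z) (p z) else 0) \<longlonglongrightarrow> (if S z then w (\<sigma> z) (p z) (\<xi> z) else 0)"
    proof (cases "S z")
      case True
      then have S: "p z \<in> G" "\<alpha> \<le> p z" "p z \<le> \<sigma> z" "\<sigma> z \<le> \<beta>" using G(2) by (auto simp: S_def)
      have low: "\<sigma> z \<le> real_of_int (c n z) / real (Suc n)" for n
        unfolding c_def by (simp add: pos_le_divide_eq del: of_nat_Suc)
      have up: "real_of_int (c n z) / real (Suc n) \<le> \<sigma> z + 1 / real (Suc n)" for n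
      proof -
        have "real_of_int (c n z) \<le> \<sigma> z * real (Suc n) + 1" unfolding c_def by linarith
        then have "real_of_int (c n z) / real (Suc n) \<le> (\<sigma> z * real (Suc n) + 1) / real (Suc n)"
          by (intro divide_right_mono) auto
        also have "\<dots> = \<sigma> z + 1 / real (Suc n)" by (simp add: add_divide_distrib del: of_nat_Suc)
        finally show ?thesis .
      qed
      have Tlow: "\<sigma> z \<le> T n (c n z)" for n using low[of n] S by (auto simp: T_def)
      have Tup: "T n (c n z) \<le> \<sigma> z + 1 / real (Suc n)" for n
      proof -
        have "0 < 1 / real (Suc n)" by simp
        then have "\<alpha> \<le> \<sigma> z + 1 / real (Suc n)" using S by linarith
        then show ?thesis unfolding T_def using up[of n] by (intro max.boundedI min.coboundedI2)
      qed
      have T_in: "T n (c n z) \<in> {p z..\<beta>}" for n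
        using Tlow[of n] S by (auto simp: T_def)
      have "(\<lambda>n. T n (c n z)) \<longlonglongrightarrow> \<sigma> z"
      proof (rule tendsto_sandwich[of "\<lambda>_. \<sigma> z" _ _ "\<lambda>n. \<sigma> z + 1 / real (Suc n)"])
        have "(\<lambda>n. \<sigma> z + 1 / real (Suc n)) \<longlonglongrightarrow> \<sigma> z + 0"
          by (intro tendsto_add tendsto_const LIMSEQ_Suc[OF lim_1_over_n])
        then show "(\<lambda>n. \<sigma> z + 1 / real (Suc n)) \<longlonglongrightarrow> \<sigma> z" by simp
      qed (use Tlow Tup in auto)
      then have "(\<lambda>n. (T n (c n z), F n z)) \<longlonglongrightarrow> (\<sigma> z, \<xi> z)"
        using F(2)[OF z] by (intro tendsto_Pair)
      from continuous_on_tendsto_compose[OF cont[OF S(1)] this]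
      have "(\<lambda>n. w (T n (c n z)) (p z) (F n z)) \<longlonglongrightarrow> w (\<sigma> z) (p z) (\<xi> z)"
        using S T_in by auto
      moreover have "w' (T n (c n z)) (F n z) (p z) = w (T n (c n z)) (p z) (F n z)" for n
        using T_in[of n] S by (simp add: w'_def)
      ultimately show ?thesis using True by simp
    qed simp
  qed
qed

context compact_interval
begin

lemma measurable_id_M: "(\<lambda>s. s) \<in> M \<rightarrow>\<^sub>M lebesgue"
  by (rule measurable_restrict_space1) simp

sublocale pair: pair_sigma_finite M M
  by (simp add: pair_sigma_finite.intro sigma_finite_measure_axioms)

text \<open>The inner root in \<open>c_tilde\<close>, written as a norm so that Cauchy-Schwarz in
  \<tau> applies to it.\<close>

definition section_norm :: "(real \<times> real \<Rightarrow> real) \<Rightarrow> real \<Rightarrow> real" where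
  "section_norm c s = square_norm M (\<lambda>\<tau>. indicator {..s} \<tau> * c (s, \<tau>))"

lemma section_norm_nonneg [simp]: "section_norm c s \<ge> 0"
  by (simp add: section_norm_def)

lemma section_norm_eq:
  assumes "s \<in> {\<alpha>..\<beta>}"
  shows "section_norm c s = sqrt (LINT \<tau>:{\<alpha>..s}|lebesgue. (c (s, \<tau>))\<^sup>2)"
  unfolding section_norm_def square_norm_def using assms
  by (subst set_integral_eq) (auto intro!: arg_cong[where f=sqrt] Bochner_Integration.integral_cong simp: indicator_def)

text \<open>Fubini on the triangle. Lebesgue measure on the plane is a completion and not a product
  measure, so the square of \<open>c\<close> is replaced by a Borel function w equal to it almost
  everywhere, and the sections of both are compared.\<close>

lemma L2_triangle_sections:
  assumes c: "c \<in> L2_nonneg (P_tri \<alpha> \<beta>)"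
  shows "AE s in M. square_integrable M (\<lambda>\<tau>. indicator {..s} \<tau> * c (s, \<tau>))"
    "square_integrable M (section_norm c)"
    "square_norm M (section_norm c) = L2_norm (P_tri \<alpha> \<beta>) c"
proof -
  let ?P = "P_tri \<alpha> \<beta>"
  have P_closed: "closed ?P"
  proof -
    have "?P = ({\<alpha>..\<beta>} \<times> {\<alpha>..\<beta>}) \<inter> {p. snd p \<le> fst p}" by (auto simp: P_tri_def)
    also have "closed \<dots>" by (intro closed_Int closed_Times closed_Collect_le continuous_intros)
    finally show ?thesis .
  qed
  then have P: "?P \<in> sets lebesgue" by (simp add: borel_closed)
  define f where "f z = indicator ?P z * (c z)\<^sup>2" for z
  have fi: "integrable lebesgue f"
    using c by (simp add: L2_nonneg_def L2_def set_integrable_def f_def[abs_def])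
  have f_sec: "f (s, \<tau>) = indicator {\<alpha>..\<beta>} \<tau> * (indicator {..s} \<tau> * c (s, \<tau>))\<^sup>2" if "s \<in> {\<alpha>..\<beta>}" for s \<tau>
    using that by (auto simp: f_def indicator_def P_tri_def)
  have f_sec0: "f (s, \<tau>) = 0" if "s \<notin> {\<alpha>..\<beta>}" for s \<tau>
    using that by (auto simp: f_def indicator_def P_tri_def)
  obtain w :: "real \<times> real \<Rightarrow> real" where w: "integrable lborel w" "AE z in lebesgue. indicator UNIV z *\<^sub>R f z = w z"
    using integrable_lebesgue_on_borel_representative[of UNIV f] fi by (auto simp: lebesgue_on_UNIV_eq)
  have wi: "integrable (lborel \<Otimes>\<^sub>M lborel) w" using w(1) by (simp add: lborel_prod)
  have wm[measurable]: "w \<in> borel_measurable (lborel \<Otimes>\<^sub>M lborel)" using wi by auto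
  have "AE z in lborel \<Otimes>\<^sub>M lborel. f z = w z"
    unfolding lborel_prod using w(2) by (simp add: AE_completion_iff)
  from lborel_pair.AE_pair[OF this] lborel_pair.AE_integrable_fst'[OF wi]
  have ae: "AE s in lborel. integrable lborel (\<lambda>\<tau>. w (s, \<tau>)) \<and> (AE \<tau> in lborel. f (s, \<tau>) = w (s, \<tau>))"
    by eventually_elim simp
  have sec_int: "integrable lebesgue (\<lambda>\<tau>. f (s, \<tau>)) \<and> (\<integral>\<tau>. f (s, \<tau>) \<partial>lebesgue) = (\<integral>\<tau>. w (s, \<tau>) \<partial>lborel)"
    if h: "integrable lborel (\<lambda>\<tau>. w (s, \<tau>))" "AE \<tau> in lborel. f (s, \<tau>) = w (s, \<tau>)" for s
  proof -
    have m: "(\<lambda>\<tau>. w (s, \<tau>)) \<in> borel_measurable lborel" using h(1) by auto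
    have i: "integrable lebesgue (\<lambda>\<tau>. w (s, \<tau>))" using h(1) integrable_completion[OF m] by simp
    have e: "AE \<tau> in lebesgue. w (s, \<tau>) = f (s, \<tau>)" using AE_completion[OF h(2)] by eventually_elim simp
    have "(\<lambda>\<tau>. f (s, \<tau>)) \<in> borel_measurable (lebesgue_on UNIV)"
    proof (rule borel_measurable_lebesgue_on_cong_AE)
      show "(\<lambda>\<tau>. w (s, \<tau>)) \<in> borel_measurable (lebesgue_on UNIV)"
        using i unfolding lebesgue_on_UNIV_eq by auto
      show "AE \<tau> in lebesgue_on UNIV. w (s, \<tau>) = f (s, \<tau>)"
        using e unfolding lebesgue_on_UNIV_eq .
    qed simp
    then have fm: "(\<lambda>\<tau>. f (s, \<tau>)) \<in> borel_measurable lebesgue" by (simp add: lebesgue_on_UNIV_eq)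
    have "integrable lebesgue (\<lambda>\<tau>. f (s, \<tau>))"
      by (rule integrable_cong_AE_imp[OF i fm e])
    moreover have "(\<integral>\<tau>. f (s, \<tau>) \<partial>lebesgue) = (\<integral>\<tau>. w (s, \<tau>) \<partial>lebesgue)"
      by (rule integral_cong_AE) (use i fm e in auto)
    ultimately show ?thesis using integral_completion[OF m] by simp
  qed
  have sec: "square_integrable M (\<lambda>\<tau>. indicator {..s} \<tau> * c (s, \<tau>)) \<and> (section_norm c s)\<^sup>2 = (\<integral>\<tau>. w (s, \<tau>) \<partial>lborel)"
    if s: "s \<in> {\<alpha>..\<beta>}" and h: "integrable lborel (\<lambda>\<tau>. w (s, \<tau>)) \<and> (AE \<tau> in lborel. f (s, \<tau>) = w (s, \<tau>))" for s
  proof -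
    from sec_int h have i: "integrable lebesgue (\<lambda>\<tau>. f (s, \<tau>))"
      and e: "(\<integral>\<tau>. f (s, \<tau>) \<partial>lebesgue) = (\<integral>\<tau>. w (s, \<tau>) \<partial>lborel)" by auto
    let ?g = "\<lambda>\<tau>. indicator {..s} \<tau> * c (s, \<tau>)"
    have gi: "integrable M (\<lambda>\<tau>. (?g \<tau>)\<^sup>2)"
      unfolding integrable_iff_set set_integrable_def using i f_sec[OF s] by simp
    \<comment> \<open>Only the square of the section is known to be measurable; as \<open>c\<close>
      is nonnegative, the section is recovered as its root.\<close>
    have gn: "sqrt ((?g \<tau>)\<^sup>2) = ?g \<tau>" if "\<tau> \<in> {\<alpha>..\<beta>}" for \<tau>
    proof -
      have "?g \<tau> \<ge> 0" using c s that by (auto simp: L2_nonneg_def P_tri_def indicator_def)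
      then show ?thesis by simp
    qed
    have "(\<lambda>\<tau>. sqrt ((?g \<tau>)\<^sup>2)) \<in> borel_measurable M"
      by (rule measurable_compose[OF borel_measurable_integrable[OF gi] borel_measurable_sqrt])
    then have "?g \<in> borel_measurable M" using gn by (subst measurable_cong[where g = "\<lambda>\<tau>. sqrt ((?g \<tau>)\<^sup>2)"]) auto
    then have "square_integrable M ?g" using gi by (simp add: square_integrable_def)
    moreover have "(section_norm c s)\<^sup>2 = (\<integral>\<tau>. f (s, \<tau>) \<partial>lebesgue)"
      unfolding section_norm_def square_norm_squared
      by (subst integral_restrict_space) (auto simp: set_lebesgue_integral_def f_sec[OF s])
    ultimately show ?thesis using e by simp
  qed
  have aeM: "AE s in M. integrable lborel (\<lambda>\<tau>. w (s, \<tau>)) \<and> (AE \<tau> in lborel. f (s, \<tau>) = w (s, \<tau>))"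
    unfolding AE_M_iff using AE_completion[OF ae] by eventually_elim simp
  then show "AE s in M. square_integrable M (\<lambda>\<tau>. indicator {..s} \<tau> * c (s, \<tau>))"
    unfolding AE_M_iff by eventually_elim (use sec in blast)
  define h where "h s = (\<integral>\<tau>. w (s, \<tau>) \<partial>lborel)" for s
  have hi: "integrable lborel h" unfolding h_def by (rule lborel_pair.integrable_fst'[OF wi])
  have hM: "integrable M h"
  proof -
    have "integrable lebesgue h" using hi integrable_completion[of h lborel] by auto
    then show ?thesis unfolding integrable_iff_set set_integrable_def by (intro integrable_mult_indicator) auto
  qed
  have sq: "AE s in M. h s = (section_norm c s)\<^sup>2"
    using aeM unfolding AE_M_iff by eventually_elim (use sec h_def in auto)
  have m2: "(\<lambda>s. (section_norm c s)\<^sup>2) \<in> borel_measurable M"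
    by (rule borel_measurable_lebesgue_on_cong_AE[OF _ _ sq]) (use hM in auto)
  have m1: "section_norm c \<in> borel_measurable M"
  proof -
    have "(\<lambda>s. sqrt ((section_norm c s)\<^sup>2)) \<in> borel_measurable M" using m2 by measurable
    then show ?thesis by simp
  qed
  have i2: "integrable M (\<lambda>s. (section_norm c s)\<^sup>2)" by (rule integrable_cong_AE_imp[OF hM m2]) (use sq in \<open>auto simp: eq_commute\<close>)
  then show "square_integrable M (section_norm c)" using m1 by (simp add: square_integrable_def)
  \<comment> \<open>Off [\<alpha>, \<beta>] the sections of f vanish, so restricting the outer
    integral to the interval loses nothing.\<close>
  have h0: "h s = 0" if "s \<notin> {\<alpha>..\<beta>}" "integrable lborel (\<lambda>\<tau>. w (s, \<tau>)) \<and> (AE \<tau> in lborel. f (s, \<tau>) = w (s, \<tau>))" for s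
    using sec_int[of s] that f_sec0[OF that(1)] by (simp add: h_def)
  have "(\<integral>s. (section_norm c s)\<^sup>2 \<partial>M) = (\<integral>s. h s \<partial>M)"
    by (rule integral_cong_AE) (use m2 hM sq in \<open>auto simp: eq_commute\<close>)
  also have "\<dots> = (\<integral>s. indicator {\<alpha>..\<beta>} s *\<^sub>R h s \<partial>lebesgue)"
    by (subst integral_restrict_space) (auto simp: set_lebesgue_integral_def)
  also have "\<dots> = (\<integral>s. indicator {\<alpha>..\<beta>} s *\<^sub>R h s \<partial>lborel)" using hi by (intro integral_completion) auto
  also have "\<dots> = (\<integral>s. h s \<partial>lborel)"
  proof (rule integral_cong_AE)
    show "AE s in lborel. indicator {\<alpha>..\<beta>} s *\<^sub>R h s = h s"
      using ae by eventually_elim (use h0 in \<open>auto simp: indicator_def\<close>)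
  qed (use hi in auto)
  also have "\<dots> = (\<integral>z. w z \<partial>(lborel \<Otimes>\<^sub>M lborel))" unfolding h_def by (rule lborel_pair.integral_fst'[OF wi])
  also have "\<dots> = (\<integral>z. w z \<partial>lborel)" by (simp add: lborel_prod)
  also have "\<dots> = (\<integral>z. w z \<partial>lebesgue)" using w(1) by (intro integral_completion[symmetric]) auto
  also have "\<dots> = (\<integral>z. f z \<partial>lebesgue)"
    by (rule integral_cong_AE) (use w fi in \<open>auto simp: eq_commute intro: measurable_completion\<close>)
  also have "\<dots> = (LINT z:?P|lebesgue. (norm (c z))\<^sup>2)" by (simp add: set_lebesgue_integral_def f_def)
  finally show "square_norm M (section_norm c) = L2_norm ?P c"
    by (simp add: square_norm_def L2_norm_def)
qed

end

section \<open>Volterra equations with causal Lipschitz right-hand sides, in the space of continuous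
  functions\<close>

section \<open>Causal Lipschitz operators\<close>

context compact_interval
begin

lemma integral_M_FTC:
  fixes F f :: "real \<Rightarrow> 'a::euclidean_space"
  assumes ab: "\<alpha> \<le> a" "a \<le> b" "b \<le> \<beta>"
    and F: "\<And>s. s \<in> {a..b} \<Longrightarrow> (F has_vector_derivative f s) (at s within {a..b})"
    and cont: "continuous_on {a..b} f"
  shows "(\<integral>s. indicator {a..b} s *\<^sub>R f s \<partial>M) = F b - F a"
proof -
  have "has_bochner_integral lborel (\<lambda>s. indicator {a..b} s *\<^sub>R f s) (F b - F a)"
    using ab F cont by (intro has_bochner_integral_FTC_Icc) auto
  then have i: "integrable lborel (\<lambda>s. indicator {a..b} s *\<^sub>R f s)"
    and e: "(\<integral>s. indicator {a..b} s *\<^sub>R f s \<partial>lborel) = F b - F a"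
    by (auto simp: has_bochner_integral_iff)
  have "(\<integral>s. indicator {a..b} s *\<^sub>R f s \<partial>M) = (\<integral>s. indicator {\<alpha>..\<beta>} s *\<^sub>R (indicator {a..b} s *\<^sub>R f s) \<partial>lebesgue)"
    by (subst integral_restrict_space) (auto simp: set_lebesgue_integral_def)
  also have "\<dots> = (\<integral>s. indicator {a..b} s *\<^sub>R f s \<partial>lebesgue)"
    using ab by (intro Bochner_Integration.integral_cong) (auto simp: indicator_def)
  also have "\<dots> = (\<integral>s. indicator {a..b} s *\<^sub>R f s \<partial>lborel)"
    using i by (intro integral_completion) auto
  finally show ?thesis using e by simp
qed

lemma integral_M_exp:
  assumes "k > 0" "t \<in> {\<alpha>..\<beta>}"
  shows "(\<integral>s. indicator {..t} s * exp (k * (s - \<alpha>)) \<partial>M) = (exp (k * (t - \<alpha>)) - 1) / k"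
proof -
  have "(\<integral>s. indicator {..t} s * exp (k * (s - \<alpha>)) \<partial>M) = (\<integral>s. indicator {\<alpha>..t} s *\<^sub>R exp (k * (s - \<alpha>)) \<partial>M)"
    using assms by (intro Bochner_Integration.integral_cong) (auto simp: indicator_def)
  also have "\<dots> = exp (k * (t - \<alpha>)) / k - exp (k * (\<alpha> - \<alpha>)) / k"
  proof (rule integral_M_FTC)
    fix s
    have "((\<lambda>s. exp (k * (s - \<alpha>)) / k) has_real_derivative exp (k * (s - \<alpha>))) (at s within {\<alpha>..t})"
      using assms(1) by (auto intro!: derivative_eq_intros)
    then show "((\<lambda>s. exp (k * (s - \<alpha>)) / k) has_vector_derivative exp (k * (s - \<alpha>))) (at s within {\<alpha>..t})"
      by (simp add: has_real_derivative_iff_has_vector_derivative)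
  qed (use assms in \<open>auto intro!: continuous_intros\<close>)
  finally show ?thesis by (simp add: diff_divide_distrib)
qed

lemma continuous_on_primitive:
  assumes "square_integrable M u"
  shows "continuous_on {\<alpha>..\<beta>} (primitive u)"
proof -
  have "continuous_on {\<alpha>..\<beta>} (\<lambda>t. primitive u (max \<alpha> (min \<beta> t)))"
    by (rule continuous_on_subset[OF abs_continuous_line_continuous[OF abs_continuous_line_clamp[OF
            primitive_abs_continuous[OF assms] less_imp_le[OF less]]]]) simp
  then show ?thesis
    by (subst continuous_on_cong[OF refl, of _ _ "\<lambda>t. primitive u (max \<alpha> (min \<beta> t))"]) auto
qed

text \<open>Integrating the exponential weight gains a factor 1 / k, the source of both the
  contraction and the Gronwall estimate below.\<close>

lemma norm_primitive_le_exp: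
  assumes u: "square_integrable M u" and k: "k > 0" and m: "m \<ge> 0" and t: "t \<in> {\<alpha>..\<beta>}"
    and le: "\<And>s. s \<in> {\<alpha>..\<beta>} \<Longrightarrow> norm (u s) \<le> m * exp (k * (s - \<alpha>))"
  shows "norm (primitive u t) \<le> m / k * exp (k * (t - \<alpha>))"
proof -
  have ecm: "(\<lambda>s. exp (k * (s - \<alpha>))) \<in> borel_measurable M"
    by (intro measurable_restrict_space1) (simp add: measurable_completion)
  have ei: "integrable M (\<lambda>s. exp (k * (s - \<alpha>)))"
    by (rule integrable_const_bound[of _ "exp (k * (\<beta> - \<alpha>))"]) (use k ecm in auto)
  have "norm (primitive u t) \<le> (\<integral>s. indicator {\<alpha><..t} s * norm (u s) \<partial>M)"
    using norm_primitive_diff_le[OF square_integrable_integrable[OF u], of \<alpha> t] t less by simp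
  also have "\<dots> \<le> (\<integral>s. m * (indicator {..t} s * exp (k * (s - \<alpha>))) \<partial>M)"
  proof (rule integral_mono)
    show "integrable M (\<lambda>s. indicator {\<alpha><..t} s * norm (u s))"
      using integrable_indicator_scaleR[of "\<lambda>s. norm (u s)"] square_integrable_integrable[OF u] by simp
    show "integrable M (\<lambda>s. m * (indicator {..t} s * exp (k * (s - \<alpha>))))"
      using integrable_indicator_scaleR[OF ei, of "{..t}"] by simp
    fix s assume "s \<in> space M"
    then show "indicator {\<alpha><..t} s * norm (u s) \<le> m * (indicator {..t} s * exp (k * (s - \<alpha>)))"
      using le[of s] m by (auto simp: indicator_def)
  qed
  also have "\<dots> = m * ((exp (k * (t - \<alpha>)) - 1) / k)" using integral_M_exp[OF k t] by simp
  also have "\<dots> \<le> m / k * exp (k * (t - \<alpha>))" using k m by (simp add: field_simps mult_left_mono)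
  finally show ?thesis .
qed

text \<open>A Lipschitz condition in the supremum over the past: c = 0 shows that
  \<open>\<Psi> x s\<close> depends on x only through its restriction to [\<alpha>, s].\<close>

definition causal_lipschitz :: "real \<Rightarrow> ((real \<Rightarrow> 'a::euclidean_space) \<Rightarrow> real \<Rightarrow> 'a) \<Rightarrow> bool" where
  "causal_lipschitz K \<Psi> \<longleftrightarrow> (\<forall>x y s c. continuous_on {\<alpha>..\<beta>} x \<longrightarrow> continuous_on {\<alpha>..\<beta>} y \<longrightarrow>
     s \<in> {\<alpha>..\<beta>} \<longrightarrow> (\<forall>\<tau>\<in>{\<alpha>..s}. norm (x \<tau> - y \<tau>) \<le> c) \<longrightarrow> norm (\<Psi> x s - \<Psi> y s) \<le> K * c)"

lemma causal_lipschitzD: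
  assumes "causal_lipschitz K \<Psi>" "continuous_on {\<alpha>..\<beta>} x" "continuous_on {\<alpha>..\<beta>} y" "s \<in> {\<alpha>..\<beta>}"
    "\<And>\<tau>. \<tau> \<in> {\<alpha>..s} \<Longrightarrow> norm (x \<tau> - y \<tau>) \<le> c"
  shows "norm (\<Psi> x s - \<Psi> y s) \<le> K * c"
  using assms unfolding causal_lipschitz_def by blast

text \<open>Gronwall's inequality with a crude constant: compare with the maximum of
  \<open>norm (z t) * exp (- 2 K (t - \<alpha>))\<close>.\<close>

lemma causal_stability:
  fixes z :: "real \<Rightarrow> 'a::euclidean_space"
  assumes K: "K > 0" and z: "continuous_on {\<alpha>..\<beta>} z" and r: "square_integrable M r"
    and le: "\<And>t. t \<in> {\<alpha>..\<beta>} \<Longrightarrow> norm (z t) \<le> A + norm (primitive r t)"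
    and causal: "\<And>s c. s \<in> {\<alpha>..\<beta>} \<Longrightarrow> (\<And>\<tau>. \<tau> \<in> {\<alpha>..s} \<Longrightarrow> norm (z \<tau>) \<le> c) \<Longrightarrow> norm (r s) \<le> K * c"
    and t: "t \<in> {\<alpha>..\<beta>}"
  shows "norm (z t) \<le> 2 * A * exp (2 * K * (\<beta> - \<alpha>))"
proof -
  define e where "e t = exp (2 * K * (t - \<alpha>))" for t
  have e1: "e t \<ge> 1" if "t \<in> {\<alpha>..\<beta>}" for t using that K by (simp add: e_def)
  have emono: "e s \<le> e t" if "s \<le> t" for s t using that K by (simp add: e_def)
  have "continuous_on {\<alpha>..\<beta>} (\<lambda>t. norm (z t) / e t)"
    unfolding e_def by (intro continuous_intros z) auto
  then obtain t0 where t0: "t0 \<in> {\<alpha>..\<beta>}" "\<forall>t\<in>{\<alpha>..\<beta>}. norm (z t) / e t \<le> norm (z t0) / e t0"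
    using continuous_attains_sup[of "{\<alpha>..\<beta>}" "\<lambda>t. norm (z t) / e t"] less by auto
  define m where "m = norm (z t0) / e t0"
  have epos: "e t > 0" for t by (simp add: e_def)
  have m: "m \<ge> 0" using epos[of t0] by (simp add: m_def)
  have zm: "norm (z t) \<le> m * e t" if "t \<in> {\<alpha>..\<beta>}" for t
    using t0(2)[rule_format, OF that] epos[of t] by (simp add: m_def[symmetric] field_simps)
  have rm: "norm (r s) \<le> (K * m) * exp (2 * K * (s - \<alpha>))" if s: "s \<in> {\<alpha>..\<beta>}" for s
  proof -
    have "norm (r s) \<le> K * (m * e s)"
    proof (rule causal[OF s])
      fix \<tau> assume \<tau>: "\<tau> \<in> {\<alpha>..s}"
      have "norm (z \<tau>) \<le> m * e \<tau>" using \<tau> s by (intro zm) auto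
      also have "\<dots> \<le> m * e s" using emono[of \<tau> s] m \<tau> by (intro mult_left_mono) auto
      finally show "norm (z \<tau>) \<le> m * e s" .
    qed
    then show ?thesis by (simp add: e_def mult.assoc)
  qed
  have "m * e t0 = norm (z t0)" using epos[of t0] by (simp add: m_def)
  also have "\<dots> \<le> A + norm (primitive r t0)" by (rule le[OF t0(1)])
  \<comment> \<open>The exponent 2 K halves the contribution of the primitive, which can thus be
    absorbed into the left-hand side.\<close>
  also have "norm (primitive r t0) \<le> (K * m) / (2 * K) * exp (2 * K * (t0 - \<alpha>))"
    by (rule norm_primitive_le_exp[OF r _ _ t0(1) rm]) (use K m in auto)
  also have "\<dots> = m * e t0 / 2" using K by (simp add: e_def)
  finally have me: "m * e t0 \<le> 2 * A" by simp
  have "m \<le> m * e t0" using e1[OF t0(1)] m by (simp add: mult_le_cancel_left1)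
  then have mA: "m \<le> 2 * A" using me by simp
  have "norm (z t) \<le> m * e t" by (rule zm[OF t])
  also have "\<dots> \<le> 2 * A * e \<beta>"
    using mA m emono[of t \<beta>] t epos[of t] by (intro mult_mono) auto
  finally show ?thesis by (simp add: e_def)
qed

text \<open>The unknown is z = x / e with the weight e(t) = exp (2 K (t - \<alpha>)). A Lipschitz
  constant K over the past becomes 1 / 2 for z, whatever the length of the interval.\<close>

lemma causal_solution_exists:
  fixes y :: "real \<Rightarrow> 'a::euclidean_space"
  assumes lip: "causal_lipschitz K \<Psi>" and K: "K > 0"
    and sq: "\<And>x. continuous_on {\<alpha>..\<beta>} x \<Longrightarrow> square_integrable M (\<Psi> x)"
    and y: "continuous_on {\<alpha>..\<beta>} y"
  obtains x where "continuous_on {\<alpha>..\<beta>} x" "\<And>t. t \<in> {\<alpha>..\<beta>} \<Longrightarrow> x t + primitive (\<Psi> x) t = y t"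
proof -
  define e where "e t = exp (2 * K * (t - \<alpha>))" for t
  have epos: "e t > 0" for t by (simp add: e_def)
  \<comment> \<open>The complete space consists of bounded continuous functions on the whole line;
    clamping the argument extends the image from [\<alpha>, \<beta>] to it.\<close>
  define cl where "cl t = max \<alpha> (min \<beta> t)" for t
  have cl: "cl t \<in> {\<alpha>..\<beta>}" for t using less by (auto simp: cl_def)
  have cl_id: "cl t = t" if "t \<in> {\<alpha>..\<beta>}" for t using that by (auto simp: cl_def)
  have cl_cont: "continuous_on UNIV cl" unfolding cl_def by (intro continuous_intros)
  define X where "X z t = e t *\<^sub>R apply_bcontfun z t" for z :: "real \<Rightarrow>\<^sub>C 'a" and t
  have X_cont: "continuous_on {\<alpha>..\<beta>} (X z)" for z
    unfolding X_def e_def by (intro continuous_intros) auto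
  define h where "h z t = (1 / e t) *\<^sub>R (y t - primitive (\<Psi> (X z)) t)" for z t
  have h_cont: "continuous_on {\<alpha>..\<beta>} (h z)" for z
    unfolding h_def using epos
    by (intro continuous_intros y continuous_on_primitive sq X_cont) (auto simp: e_def intro!: continuous_intros)
  have mem: "(\<lambda>t. h z (cl t)) \<in> bcontfun" for z
  proof -
    have "continuous_on UNIV (\<lambda>t. h z (cl t))"
      by (rule continuous_on_compose2[OF h_cont cl_cont]) (use cl in auto)
    moreover have "bounded (h z ` {\<alpha>..\<beta>})"
      by (intro compact_imp_bounded compact_continuous_image h_cont compact_Icc)
    then have "bounded (range (\<lambda>t. h z (cl t)))"
      by (rule bounded_subset) (use cl in auto)
    ultimately show ?thesis by (simp add: bcontfun_def)
  qed
  define T where "T z = Bcontfun (\<lambda>t. h z (cl t))" for z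
  have T: "apply_bcontfun (T z) t = h z (cl t)" for z t
    unfolding T_def using mem by (simp add: Bcontfun_inverse)
  have contr: "dist (T z) (T z') \<le> 1 / 2 * dist z z'" for z z'
  proof (rule dist_bound)
    fix t'
    define t where "t = cl t'"
    have t: "t \<in> {\<alpha>..\<beta>}" unfolding t_def by (rule cl)
    define d where "d = dist z z'"
    have d: "d \<ge> 0" by (simp add: d_def)
    have i: "square_integrable M (\<Psi> (X z))" "square_integrable M (\<Psi> (X z'))" by (intro sq X_cont)+
    have "norm (primitive (\<lambda>s. \<Psi> (X z) s - \<Psi> (X z') s) t) \<le> (K * d) / (2 * K) * exp (2 * K * (t - \<alpha>))"
    proof (rule norm_primitive_le_exp[OF _ _ _ t])
      show "square_integrable M (\<lambda>s. \<Psi> (X z) s - \<Psi> (X z') s)" by (rule square_integrable_diff(1)[OF i])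
      fix s assume s: "s \<in> {\<alpha>..\<beta>}"
      have "norm (\<Psi> (X z) s - \<Psi> (X z') s) \<le> K * (d * e s)"
      proof (rule causal_lipschitzD[OF lip X_cont X_cont s])
        fix \<tau> assume \<tau>: "\<tau> \<in> {\<alpha>..s}"
        have "norm (X z \<tau> - X z' \<tau>) = e \<tau> * dist (apply_bcontfun z \<tau>) (apply_bcontfun z' \<tau>)"
          using epos[of \<tau>] by (simp add: X_def dist_norm flip: scaleR_diff_right)
        also have "\<dots> \<le> e s * d"
          unfolding d_def using \<tau> K epos by (intro mult_mono dist_bounded) (auto simp: e_def)
        finally show "norm (X z \<tau> - X z' \<tau>) \<le> d * e s" by (simp add: mult.commute)
      qed
      then show "norm (\<Psi> (X z) s - \<Psi> (X z') s) \<le> (K * d) * exp (2 * K * (s - \<alpha>))"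
        by (simp add: e_def mult.assoc)
    qed (use K d in auto)
    then have le: "norm (primitive (\<Psi> (X z)) t - primitive (\<Psi> (X z')) t) \<le> d / 2 * e t"
      using K primitive_linear(2)[OF i[THEN square_integrable_integrable], of t] by (simp add: e_def)
    have "dist (apply_bcontfun (T z) t') (apply_bcontfun (T z') t') = norm (h z t - h z' t)"
      unfolding T t_def[symmetric] by (simp add: dist_norm)
    also have "h z t - h z' t = (1 / e t) *\<^sub>R (primitive (\<Psi> (X z')) t - primitive (\<Psi> (X z)) t)"
      by (simp add: h_def flip: scaleR_diff_right)
    also have "norm \<dots> = norm (primitive (\<Psi> (X z)) t - primitive (\<Psi> (X z')) t) / e t"
      using epos[of t] by (simp add: norm_minus_commute)
    also have "\<dots> \<le> d / 2" using le epos[of t] by (simp add: divide_le_eq)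
    finally show "dist (apply_bcontfun (T z) t') (apply_bcontfun (T z') t') \<le> 1 / 2 * dist z z'"
      by (simp add: d_def)
  qed
  have "\<exists>!z. T z = z"
    by (rule banach_fix_type[of "1/2"]) (use contr in auto)
  then obtain z where z: "T z = z" by blast
  show thesis
  proof (rule that[of "X z"])
    show "continuous_on {\<alpha>..\<beta>} (X z)" by (rule X_cont)
    fix t assume t: "t \<in> {\<alpha>..\<beta>}"
    have "apply_bcontfun z t = h z t" using T[of z t] z cl_id[OF t] by simp
    then have "X z t = y t - primitive (\<Psi> (X z)) t"
      using epos[of t] by (simp add: X_def h_def)
    then show "X z t + primitive (\<Psi> (X z)) t = y t" by simp
  qed
qed

end

section \<open>Solvability and stability of causal equations in \<open>AC02\<close>\<close>

context compact_interval
begin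

abbreviation "X \<equiv> AC02 \<alpha> \<beta>"
abbreviation "N \<equiv> AC02_norm \<alpha> \<beta>"

lemma AC02_norm_nonneg [simp]: "N x \<ge> 0"
  by (simp add: AC02_norm_def L2_norm_eq)

lemma AC02_linear:
  assumes "x \<in> X" "y \<in> X"
  shows "(\<lambda>t. x t + y t) \<in> X" "N (\<lambda>t. x t + y t) \<le> N x + N y"
    "(\<lambda>t. x t - y t) \<in> X" "N (\<lambda>t. x t - y t) \<le> N x + N y"
    "(\<lambda>t. c *\<^sub>R x t) \<in> X"
proof -
  obtain u where u: "square_integrable M u" "x = primitive u" using assms(1) by (rule AC02_primitiveE)
  obtain w where w: "square_integrable M w" "y = primitive w" using assms(2) by (rule AC02_primitiveE)
  note i = u(1)[THEN square_integrable_integrable] w(1)[THEN square_integrable_integrable]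
  note add = square_integrable_add[OF u(1) w(1)] and diff = square_integrable_diff[OF u(1) w(1)]
    and sc = square_integrable_scaleR[OF u(1), of c]
  have 1: "(\<lambda>t. x t + y t) = primitive (\<lambda>s. u s + w s)" using primitive_linear(1)[OF i] u w by auto
  have 2: "(\<lambda>t. x t - y t) = primitive (\<lambda>s. u s - w s)" using primitive_linear(2)[OF i] u w by auto
  have 3: "(\<lambda>t. c *\<^sub>R x t) = primitive (\<lambda>s. c *\<^sub>R u s)" using primitive_linear(3)[OF i] u by auto
  show "(\<lambda>t. x t + y t) \<in> X" "(\<lambda>t. x t - y t) \<in> X" "(\<lambda>t. c *\<^sub>R x t) \<in> X"
    unfolding 1 2 3 using add diff sc by (auto intro: primitive_mem_AC02)
  show "N (\<lambda>t. x t + y t) \<le> N x + N y" "N (\<lambda>t. x t - y t) \<le> N x + N y"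
    unfolding 1 2 using add diff u w by (auto simp: AC02_norm_primitive)
qed

lemma AC02_continuous: "x \<in> X \<Longrightarrow> continuous_on {\<alpha>..\<beta>} x"
  by (erule AC02_primitiveE) (auto intro: continuous_on_primitive)

lemma AC02_norm_le:
  assumes "x \<in> X" "t \<in> {\<alpha>..\<beta>}"
  shows "norm (x t) \<le> sqrt (t - \<alpha>) * N x"
proof -
  obtain u where u: "square_integrable M u" "x = primitive u" using assms(1) by (rule AC02_primitiveE)
  show ?thesis unfolding u(2) AC02_norm_primitive[OF u(1)] by (rule norm_primitive_le[OF u(1) assms(2)])
qed

lemma AC02_norm_le':
  assumes "x \<in> X" "t \<in> {\<alpha>..\<beta>}"
  shows "norm (x t) \<le> sqrt (\<beta> - \<alpha>) * N x"
  by (rule order_trans[OF AC02_norm_le[OF assms]]) (use assms(2) in \<open>auto intro!: mult_right_mono\<close>)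

lemma AC02_outside: "x \<in> X \<Longrightarrow> t \<notin> {\<alpha>..\<beta>} \<Longrightarrow> x t = 0"
  by (simp add: AC02_def)

lemma measure_space_M: "measure M (space M) = \<beta> - \<alpha>"
  using less by (simp add: measure_restrict_space)

lemma square_integrable_bounded_M:
  fixes u :: "real \<Rightarrow> 'a::euclidean_space"
  assumes "u \<in> borel_measurable M" "\<And>s. s \<in> {\<alpha>..\<beta>} \<Longrightarrow> norm (u s) \<le> B" "B \<ge> 0"
  shows "square_integrable M u" "square_norm M u \<le> sqrt (\<beta> - \<alpha>) * B"
  using square_integrable_bounded[OF assms(1), of B, unfolded measure_space_M] assms(2,3) by simp_all

lemma primitive_cong:
  assumes "\<And>s. s \<in> {\<alpha>..\<beta>} \<Longrightarrow> u s = w s"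
  shows "primitive u = primitive w"
  unfolding primitive_def
  by (intro ext if_cong refl Bochner_Integration.integral_cong) (simp_all add: assms)

text \<open>Turns the Gronwall estimate for the supremum into one for the norm of
  \<open>AC02\<close>. The factor \<beta> - \<alpha> is sqrt(\<beta> - \<alpha>) taken twice, from
  the norm of p to its supremum and from the supremum of r to its L2 norm. The operator and its
  linearisation are both estimated in this way.\<close>

lemma causal_perturbation_norm_le:
  assumes K: "K > 0" and z: "z \<in> X" and p: "p \<in> X" and r: "square_integrable M r"
    and eq: "\<And>t. z t = p t - primitive r t"
    and causal: "\<And>s c. s \<in> {\<alpha>..\<beta>} \<Longrightarrow> (\<And>\<tau>. \<tau> \<in> {\<alpha>..s} \<Longrightarrow> norm (z \<tau>) \<le> c) \<Longrightarrow> norm (r s) \<le> K * c"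
  shows "N z \<le> (1 + 2 * K * (\<beta> - \<alpha>) * exp (2 * K * (\<beta> - \<alpha>))) * N p"
proof -
  define E where "E = exp (2 * K * (\<beta> - \<alpha>))"
  define A where "A = sqrt (\<beta> - \<alpha>) * N p"
  have A: "A \<ge> 0" using less by (simp add: A_def)
  have zt: "norm (z t) \<le> 2 * A * E" if t: "t \<in> {\<alpha>..\<beta>}" for t
    unfolding E_def
  proof (rule causal_stability[OF K AC02_continuous[OF z] r _ causal t])
    fix t assume t: "t \<in> {\<alpha>..\<beta>}"
    have "norm (z t) \<le> norm (p t) + norm (primitive r t)" unfolding eq by (rule norm_triangle_ineq4)
    then show "norm (z t) \<le> A + norm (primitive r t)" using AC02_norm_le'[OF p t] by (simp add: A_def)
  qed
  have rs: "norm (r s) \<le> K * (2 * A * E)" if "s \<in> {\<alpha>..\<beta>}" for s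
    by (rule causal[OF that]) (use that zt in auto)
  have "square_norm M r \<le> sqrt (\<beta> - \<alpha>) * (K * (2 * A * E))"
    by (rule square_integrable_bounded_M(2)[OF square_integrable_measurable[OF r] rs]) (use K A in \<open>auto simp: E_def\<close>)
  also have "\<dots> = 2 * K * (sqrt (\<beta> - \<alpha>) * sqrt (\<beta> - \<alpha>)) * E * N p" by (simp add: A_def)
  also have "sqrt (\<beta> - \<alpha>) * sqrt (\<beta> - \<alpha>) = \<beta> - \<alpha>" using less by simp
  finally have r_le: "N (primitive r) \<le> 2 * K * (\<beta> - \<alpha>) * E * N p" by (simp add: AC02_norm_primitive[OF r])
  have "N z = N (\<lambda>t. p t - primitive r t)" by (simp add: eq[abs_def])
  also have "\<dots> \<le> N p + N (primitive r)" by (rule AC02_linear(4)[OF p primitive_mem_AC02[OF r]])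
  also have "\<dots> \<le> (1 + 2 * K * (\<beta> - \<alpha>) * E) * N p" using r_le by (simp add: algebra_simps)
  finally show ?thesis by (simp add: E_def)
qed

text \<open>A continuous solution is arbitrary off [\<alpha>, \<beta>] and not visibly in
  \<open>AC02\<close>. The equation itself supplies the representative \<open>x0\<close>, and
  causality with c = 0 shows that \<Psi> takes the same values on both inside the interval.\<close>

lemma causal_equation_solvable:
  fixes y :: "real \<Rightarrow> 'a::euclidean_space"
  assumes lip: "causal_lipschitz K \<Psi>" and K: "K > 0"
    and sq: "\<And>x. continuous_on {\<alpha>..\<beta>} x \<Longrightarrow> square_integrable M (\<Psi> x)"
    and y: "y \<in> X"
  obtains x where "x \<in> X" "\<And>t. x t + primitive (\<Psi> x) t = y t"
proof -
  obtain x where x: "continuous_on {\<alpha>..\<beta>} x" "\<And>t. t \<in> {\<alpha>..\<beta>} \<Longrightarrow> x t + primitive (\<Psi> x) t = y t"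
    using causal_solution_exists[OF lip K sq AC02_continuous[OF y]] by metis
  define x0 where "x0 t = y t - primitive (\<Psi> x) t" for t
  have x0: "x0 \<in> X" unfolding x0_def by (intro AC02_linear(3) y primitive_mem_AC02 sq x)
  have eq: "x0 t = x t" if "t \<in> {\<alpha>..\<beta>}" for t using x(2)[OF that] by (simp add: x0_def algebra_simps)
  have "\<Psi> x0 s = \<Psi> x s" if s: "s \<in> {\<alpha>..\<beta>}" for s
  proof -
    have "norm (\<Psi> x0 s - \<Psi> x s) \<le> K * 0"
      by (rule causal_lipschitzD[OF lip AC02_continuous[OF x0] x(1) s]) (use eq s in auto)
    then show ?thesis by simp
  qed
  then have "primitive (\<Psi> x0) = primitive (\<Psi> x)" by (rule primitive_cong)
  then show thesis using that[OF x0] by (simp add: x0_def)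
qed

lemma continuous_imp_bounded_measurable:
  fixes x :: "real \<Rightarrow> 'a::euclidean_space"
  assumes "continuous_on {\<alpha>..\<beta>} x"
  shows "x \<in> borel_measurable M" "\<exists>\<rho>\<ge>0. \<forall>t\<in>{\<alpha>..\<beta>}. norm (x t) \<le> \<rho>"
proof -
  show "x \<in> borel_measurable M" using assms by (intro continuous_imp_measurable_on_sets_lebesgue) auto
  have "bounded (x ` {\<alpha>..\<beta>})" using assms by (intro compact_imp_bounded compact_continuous_image) auto
  then obtain \<rho> where "\<rho> > 0" "\<forall>z\<in>x ` {\<alpha>..\<beta>}. norm z \<le> \<rho>" unfolding bounded_pos by blast
  then show "\<exists>\<rho>\<ge>0. \<forall>t\<in>{\<alpha>..\<beta>}. norm (x t) \<le> \<rho>" by (intro exI[of _ \<rho>]) auto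
qed

end

text \<open>The remainder is divided by \<open>\<nu> n\<close> and not by the norm of
  \<open>k n\<close>, which may vanish: in the application \<open>k n\<close> is the value of a
  direction at one point and \<open>\<nu> n\<close> the norm of that direction in
  \<open>AC02\<close>.\<close>

lemma has_derivative_scaled_remainder_tendsto:
  fixes f :: "'a::real_normed_vector \<Rightarrow> 'b::real_normed_vector"
  assumes f: "(f has_derivative f') (at x)" and k: "\<And>n. norm (k n) \<le> c * \<nu> n" and \<nu>: "\<And>n. \<nu> n > 0" "\<nu> \<longlonglongrightarrow> 0"
  shows "(\<lambda>n. (f (x + k n) - f x - f' (k n)) /\<^sub>R \<nu> n) \<longlonglongrightarrow> 0"
proof (rule LIMSEQ_I)
  fix e :: real assume e: "e > 0"
  define C where "C = \<bar>c\<bar> + 1"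
  have C: "C > 0" "c \<le> C" by (simp_all add: C_def)
  define e' where "e' = e / (2 * C)"
  have e': "e' > 0" using e C by (simp add: e'_def)
  from f[unfolded has_derivative_at_alt, THEN conjunct2, THEN spec, THEN mp, OF e']
  obtain d where dd: "d > 0 \<and> (\<forall>y. norm (y - x) < d \<longrightarrow> norm (f y - f x - f' (y - x)) \<le> e' * norm (y - x))"
    by (rule exE)
  have d: "d > 0" "norm (y - x) < d \<Longrightarrow> norm (f y - f x - f' (y - x)) \<le> e' * norm (y - x)" for y
    using dd by simp_all
  have "d / C > 0" using d(1) C by simp
  from LIMSEQ_D[OF \<nu>(2) this] obtain n0 where n0: "\<And>n. n \<ge> n0 \<Longrightarrow> norm (\<nu> n) < d / C" by auto
  show "\<exists>no. \<forall>n\<ge>no. norm ((f (x + k n) - f x - f' (k n)) /\<^sub>R \<nu> n - 0) < e"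
  proof (intro exI[of _ n0] allI impI)
    fix n assume n: "n \<ge> n0"
    have kn: "norm (k n) \<le> C * \<nu> n"
      by (rule order_trans[OF k]) (use \<nu>(1)[of n] C in \<open>auto intro!: mult_right_mono\<close>)
    have "C * \<nu> n < d" using n0[OF n] \<nu>(1)[of n] C by (simp add: pos_less_divide_eq mult.commute)
    then have "norm (k n) < d" using kn by simp
    then have "norm (f (x + k n) - f x - f' (k n)) \<le> e' * norm (k n)" using d(2)[of "x + k n"] by simp
    also have "\<dots> \<le> e' * (C * \<nu> n)" using kn e' by simp
    also have "\<dots> = e / 2 * \<nu> n" using C by (simp add: e'_def)
    finally have "norm (f (x + k n) - f x - f' (k n)) / \<nu> n \<le> e / 2"
      using \<nu>(1)[of n] by (simp add: pos_divide_le_eq)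
    moreover have "norm ((f (x + k n) - f x - f' (k n)) /\<^sub>R \<nu> n) = norm (f (x + k n) - f x - f' (k n)) / \<nu> n"
      using \<nu>(1)[of n] by (simp add: divide_inverse_commute)
    ultimately show "norm ((f (x + k n) - f x - f' (k n)) /\<^sub>R \<nu> n - 0) < e"
      using e unfolding diff_zero by linarith
  qed
qed

section \<open>Local bounds and causal Lipschitz estimates for the derivative part of the
  operator\<close>

section \<open>Operators with differentiable coefficients\<close>

text \<open>The mean value inequality, applied on a convex ball.\<close>

lemma norm_diff_le_on_cball:
  fixes f :: "'a::euclidean_space \<Rightarrow> 'b::real_normed_vector"
  assumes f: "\<And>z. (f has_derivative f' z) (at z)" and le: "\<And>z h. norm z \<le> \<rho> \<Longrightarrow> norm (f' z h) \<le> l * norm h"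
    and uw: "norm u \<le> \<rho>" "norm w \<le> \<rho>"
  shows "norm (f u - f w) \<le> l * norm (u - w)"
proof (rule differentiable_bound[of "cball 0 \<rho>" f f'])
  fix z :: 'a assume "z \<in> cball 0 \<rho>"
  then have z: "norm z \<le> \<rho>" by simp
  show "onorm (f' z) \<le> l" by (rule onorm_le, rule le[OF z])
  show "(f has_derivative f' z) (at z within cball 0 \<rho>)" using f by (rule has_derivative_at_withinI)
qed (use uw in auto)

text \<open>The values \<open>a s x\<close> and \<open>b s \<tau> x\<close> play the roles of \<open>v s s x\<close> and \<open>v\<^sub>t s \<tau> x\<close>, and \<open>a' s x h\<close>,
  \<open>b' s \<tau> x h\<close> are their differentials in \<open>x\<close>. In terms of them, the derivative of the Volterra
  operator at \<open>x\<close> is \<open>x'\<close> plus \<open>integrand x\<close> below.\<close>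

locale volterra_coefficients = compact_interval +
  fixes a :: "real \<Rightarrow> 'v::euclidean_space \<Rightarrow> 'v" and b :: "real \<Rightarrow> real \<Rightarrow> 'v \<Rightarrow> 'v"
    and a' :: "real \<Rightarrow> 'v \<Rightarrow> 'v \<Rightarrow> 'v" and b' :: "real \<Rightarrow> real \<Rightarrow> 'v \<Rightarrow> 'v \<Rightarrow> 'v"
    and \<kappa> D :: real
  assumes a_meas: "x \<in> borel_measurable M \<Longrightarrow> (\<lambda>s. a s (x s)) \<in> borel_measurable M"
    and b_meas: "x \<in> borel_measurable M \<Longrightarrow> (\<lambda>(s, \<tau>). b s \<tau> (x \<tau>)) \<in> borel_measurable (M \<Otimes>\<^sub>M M)"
    and a'_meas: "x \<in> borel_measurable M \<Longrightarrow> h \<in> borel_measurable M \<Longrightarrow>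
      (\<lambda>s. a' s (x s) (h s)) \<in> borel_measurable M"
    and b'_meas: "x \<in> borel_measurable M \<Longrightarrow> h \<in> borel_measurable M \<Longrightarrow>
      (\<lambda>(s, \<tau>). b' s \<tau> (x \<tau>) (h \<tau>)) \<in> borel_measurable (M \<Otimes>\<^sub>M M)"
    and bound: "\<exists>l>0. \<forall>s\<in>{\<alpha>..\<beta>}. \<forall>\<tau>\<in>{\<alpha>..\<beta>}. \<forall>x. norm x \<le> \<rho> \<longrightarrow>
      norm (a s x) \<le> l \<and> norm (b s \<tau> x) \<le> l \<and>
      (\<forall>h. norm (a' s x h) \<le> l * norm h) \<and> (\<forall>h. norm (b' s \<tau> x h) \<le> l * norm h)"
    and a_deriv: "s \<in> {\<alpha>..\<beta>} \<Longrightarrow> (a s has_derivative a' s z) (at z)"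
    and b_deriv: "s \<in> {\<alpha>..\<beta>} \<Longrightarrow> \<tau> \<in> {\<alpha>..\<beta>} \<Longrightarrow> (b s \<tau> has_derivative b' s \<tau> z) (at z)"
    and b_causal: "s < \<tau> \<Longrightarrow> b s \<tau> z = 0"
    and b'_causal: "s < \<tau> \<Longrightarrow> b' s \<tau> z k = 0"
    and \<kappa>: "\<kappa> < 1"
    and growth: "x \<in> borel_measurable M \<Longrightarrow> m \<ge> 0 \<Longrightarrow>
      (\<And>\<tau>. \<tau> \<in> {\<alpha>..\<beta>} \<Longrightarrow> norm (x \<tau>) \<le> sqrt (\<tau> - \<alpha>) * m) \<Longrightarrow>
      square_norm M (\<lambda>s. a s (x s) + (\<integral>\<tau>. b s \<tau> (x \<tau>) \<partial>M)) \<le> \<kappa> * m + D"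
begin

definition integrand :: "(real \<Rightarrow> 'v) \<Rightarrow> real \<Rightarrow> 'v" where
  "integrand x s = a s (x s) + (\<integral>\<tau>. b s \<tau> (x \<tau>) \<partial>M)"

definition d_integrand :: "(real \<Rightarrow> 'v) \<Rightarrow> (real \<Rightarrow> 'v) \<Rightarrow> real \<Rightarrow> 'v" where
  "d_integrand x h s = a' s (x s) (h s) + (\<integral>\<tau>. b' s \<tau> (x \<tau>) (h \<tau>) \<partial>M)"

text \<open>Chosen once for every radius, so that the constants built from it are functions of
  \<rho>.\<close>

definition local_bound :: "real \<Rightarrow> real" where
  "local_bound \<rho> = (SOME l. l > 0 \<and> (\<forall>s\<in>{\<alpha>..\<beta>}. \<forall>\<tau>\<in>{\<alpha>..\<beta>}. \<forall>x. norm x \<le> \<rho> \<longrightarrow>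
      norm (a s x) \<le> l \<and> norm (b s \<tau> x) \<le> l \<and>
      (\<forall>h. norm (a' s x h) \<le> l * norm h) \<and> (\<forall>h. norm (b' s \<tau> x h) \<le> l * norm h)))"

lemma local_bound:
  shows local_bound_pos: "local_bound \<rho> > 0"
    and "s \<in> {\<alpha>..\<beta>} \<Longrightarrow> norm x \<le> \<rho> \<Longrightarrow> norm (a s x) \<le> local_bound \<rho>"
    and "s \<in> {\<alpha>..\<beta>} \<Longrightarrow> \<tau> \<in> {\<alpha>..\<beta>} \<Longrightarrow> norm x \<le> \<rho> \<Longrightarrow> norm (b s \<tau> x) \<le> local_bound \<rho>"
    and "s \<in> {\<alpha>..\<beta>} \<Longrightarrow> norm x \<le> \<rho> \<Longrightarrow> norm (a' s x h) \<le> local_bound \<rho> * norm h"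
    and "s \<in> {\<alpha>..\<beta>} \<Longrightarrow> \<tau> \<in> {\<alpha>..\<beta>} \<Longrightarrow> norm x \<le> \<rho> \<Longrightarrow> norm (b' s \<tau> x h) \<le> local_bound \<rho> * norm h"
proof -
  note * = someI_ex[OF bound[of \<rho>], folded local_bound_def]
  have \<alpha>: "\<alpha> \<in> {\<alpha>..\<beta>}" using less by simp
  show "local_bound \<rho> > 0" using * by (rule conjunct1)
  show "s \<in> {\<alpha>..\<beta>} \<Longrightarrow> norm x \<le> \<rho> \<Longrightarrow> norm (a s x) \<le> local_bound \<rho>"
    "s \<in> {\<alpha>..\<beta>} \<Longrightarrow> norm x \<le> \<rho> \<Longrightarrow> norm (a' s x h) \<le> local_bound \<rho> * norm h"
    using *[THEN conjunct2, THEN bspec, THEN bspec, OF _ \<alpha>] by simp_all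
  show "s \<in> {\<alpha>..\<beta>} \<Longrightarrow> \<tau> \<in> {\<alpha>..\<beta>} \<Longrightarrow> norm x \<le> \<rho> \<Longrightarrow> norm (b s \<tau> x) \<le> local_bound \<rho>"
    "s \<in> {\<alpha>..\<beta>} \<Longrightarrow> \<tau> \<in> {\<alpha>..\<beta>} \<Longrightarrow> norm x \<le> \<rho> \<Longrightarrow> norm (b' s \<tau> x h) \<le> local_bound \<rho> * norm h"
    using *[THEN conjunct2, THEN bspec, THEN bspec] by simp_all
qed

lemma section_measurable:
  assumes "(\<lambda>(s, \<tau>). f s \<tau>) \<in> borel_measurable (M \<Otimes>\<^sub>M M)" "s \<in> {\<alpha>..\<beta>}"
  shows "f s \<in> borel_measurable M"
  using measurable_compose[OF measurable_Pair1' assms(1), of s] assms(2) by simp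

lemma integrable_bounded_M:
  fixes f :: "real \<Rightarrow> 'v"
  assumes "f \<in> borel_measurable M" "\<And>s. s \<in> {\<alpha>..\<beta>} \<Longrightarrow> norm (f s) \<le> B"
  shows "integrable M f"
  by (rule integrable_const_bound[of _ B]) (use assms in auto)

lemma norm_integral_le_M:
  fixes f :: "real \<Rightarrow> 'v"
  assumes "\<And>s. s \<in> {\<alpha>..\<beta>} \<Longrightarrow> norm (f s) \<le> B" "B \<ge> 0"
  shows "norm (\<integral>s. f s \<partial>M) \<le> (\<beta> - \<alpha>) * B"
proof (cases "integrable M f")
  case True
  have "norm (\<integral>s. f s \<partial>M) \<le> (\<integral>s. norm (f s) \<partial>M)" by (rule integral_norm_bound)
  also have "\<dots> \<le> (\<integral>s. B \<partial>M)" using True assms by (intro integral_mono) auto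
  also have "\<dots> = (\<beta> - \<alpha>) * B" using measure_space_M by simp
  finally show ?thesis .
qed (use assms less in \<open>simp add: not_integrable_integral_eq\<close>)

text \<open>The summand 1 stems from the diagonal term, \<beta> - \<alpha> from integrating the
  kernel over \<tau>.\<close>

definition lip_const :: "real \<Rightarrow> real" where
  "lip_const \<rho> = local_bound \<rho> * (1 + (\<beta> - \<alpha>))"

lemma lip_const_pos: "lip_const \<rho> > 0"
  using less local_bound_pos[of \<rho>] by (simp add: lip_const_def add_pos_pos)

context
  fixes x :: "real \<Rightarrow> 'v" and \<rho> :: real
  assumes x: "x \<in> borel_measurable M" and x_le: "\<And>t. t \<in> {\<alpha>..\<beta>} \<Longrightarrow> norm (x t) \<le> \<rho>"
begin

lemma b_integrable:
  assumes s: "s \<in> {\<alpha>..\<beta>}"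
  shows "integrable M (\<lambda>\<tau>. b s \<tau> (x \<tau>))"
  by (rule integrable_bounded_M[OF section_measurable[OF b_meas[OF x] s]])
    (rule local_bound(3)[OF s _ x_le]; assumption)

lemma norm_integrand_le:
  assumes s: "s \<in> {\<alpha>..\<beta>}"
  shows "norm (integrand x s) \<le> lip_const \<rho>"
proof -
  have "norm (integrand x s) \<le> norm (a s (x s)) + norm (\<integral>\<tau>. b s \<tau> (x \<tau>) \<partial>M)"
    unfolding integrand_def by (rule norm_triangle_ineq)
  also have "\<dots> \<le> local_bound \<rho> + (\<beta> - \<alpha>) * local_bound \<rho>"
    by (intro add_mono norm_integral_le_M local_bound(2,3) s x_le less_imp_le[OF local_bound_pos])
  finally show ?thesis by (simp add: lip_const_def algebra_simps)
qed

lemma integrand_measurable: "integrand x \<in> borel_measurable M"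
  unfolding integrand_def
  by (intro borel_measurable_add a_meas x borel_measurable_lebesgue_integral b_meas)

lemma square_integrable_integrand: "square_integrable M (integrand x)"
  by (rule square_integrable_bounded_M(1)[OF integrand_measurable norm_integrand_le])
    (use lip_const_pos[of \<rho>] in auto)

text \<open>For \<tau> \<le> s the mean value inequality on the ball of radius \<rho> applies, and
  for \<tau> > s the kernel vanishes, so only differences in the past enter.\<close>

lemma integrand_lipschitz:
  assumes y: "y \<in> borel_measurable M" "\<And>t. t \<in> {\<alpha>..\<beta>} \<Longrightarrow> norm (y t) \<le> \<rho>"
    and s: "s \<in> {\<alpha>..\<beta>}" and c: "\<And>\<tau>. \<tau> \<in> {\<alpha>..s} \<Longrightarrow> norm (x \<tau> - y \<tau>) \<le> c"
  shows "norm (integrand x s - integrand y s) \<le> lip_const \<rho> * c"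
proof -
  let ?l = "local_bound \<rho>"
  have l: "?l > 0" by (rule local_bound_pos)
  have c0: "c \<ge> 0" by (rule order_trans[OF norm_ge_zero c[of \<alpha>]]) (use s in auto)
  have A: "norm (a s (x s) - a s (y s)) \<le> ?l * c"
  proof -
    have "norm (a s (x s) - a s (y s)) \<le> ?l * norm (x s - y s)"
      by (rule norm_diff_le_on_cball[OF a_deriv[OF s] local_bound(4)[OF s] x_le[OF s] y(2)[OF s]])
    also have "\<dots> \<le> ?l * c" using c[of s] s l by simp
    finally show ?thesis .
  qed
  have B: "norm (b s \<tau> (x \<tau>) - b s \<tau> (y \<tau>)) \<le> ?l * c" if \<tau>: "\<tau> \<in> {\<alpha>..\<beta>}" for \<tau>
  proof (cases "\<tau> \<le> s")
    case True
    have "norm (b s \<tau> (x \<tau>) - b s \<tau> (y \<tau>)) \<le> ?l * norm (x \<tau> - y \<tau>)"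
      by (rule norm_diff_le_on_cball[OF b_deriv[OF s \<tau>] local_bound(5)[OF s \<tau>] x_le[OF \<tau>] y(2)[OF \<tau>]])
    also have "\<dots> \<le> ?l * c" using c[of \<tau>] True \<tau> l by simp
    finally show ?thesis .
  next
    case False
    then show ?thesis using l c0 by (simp add: b_causal)
  qed
  have by': "integrable M (\<lambda>\<tau>. b s \<tau> (y \<tau>))"
    by (rule integrable_bounded_M[OF section_measurable[OF b_meas[OF y(1)] s]])
      (rule local_bound(3)[OF s _ y(2)]; assumption)
  have "integrand x s - integrand y s = (a s (x s) - a s (y s)) + (\<integral>\<tau>. b s \<tau> (x \<tau>) - b s \<tau> (y \<tau>) \<partial>M)"
    unfolding integrand_def using b_integrable[OF s] by' by simp
  also have "norm \<dots> \<le> norm (a s (x s) - a s (y s)) + norm (\<integral>\<tau>. b s \<tau> (x \<tau>) - b s \<tau> (y \<tau>) \<partial>M)"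
    by (rule norm_triangle_ineq)
  also have "\<dots> \<le> ?l * c + (\<beta> - \<alpha>) * (?l * c)"
    by (intro add_mono A norm_integral_le_M B) (use l c0 in auto)
  finally show ?thesis by (simp add: lip_const_def algebra_simps)
qed

lemma b'_integrable:
  assumes s: "s \<in> {\<alpha>..\<beta>}" and h: "h \<in> borel_measurable M" "\<And>t. t \<in> {\<alpha>..\<beta>} \<Longrightarrow> norm (h t) \<le> c"
  shows "integrable M (\<lambda>\<tau>. b' s \<tau> (x \<tau>) (h \<tau>))"
proof (rule integrable_bounded_M[OF section_measurable[OF b'_meas[OF x h(1)] s]])
  fix \<tau> assume \<tau>: "\<tau> \<in> {\<alpha>..\<beta>}"
  have "norm (b' s \<tau> (x \<tau>) (h \<tau>)) \<le> local_bound \<rho> * norm (h \<tau>)" by (rule local_bound(5)[OF s \<tau> x_le[OF \<tau>]])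
  also have "\<dots> \<le> local_bound \<rho> * c" using h(2)[OF \<tau>] local_bound_pos by simp
  finally show "norm (b' s \<tau> (x \<tau>) (h \<tau>)) \<le> local_bound \<rho> * c" .
qed

lemma b'_integrable_continuous:
  assumes s: "s \<in> {\<alpha>..\<beta>}" and h: "continuous_on {\<alpha>..\<beta>} h"
  shows "integrable M (\<lambda>\<tau>. b' s \<tau> (x \<tau>) (h \<tau>))"
proof -
  obtain c where "c \<ge> 0 \<and> (\<forall>t\<in>{\<alpha>..\<beta>}. norm (h t) \<le> c)"
    by (rule exE[OF continuous_imp_bounded_measurable(2)[OF h]])
  then have "norm (h t) \<le> c" if "t \<in> {\<alpha>..\<beta>}" for t using that by simp
  then show ?thesis by (rule b'_integrable[OF s continuous_imp_bounded_measurable(1)[OF h]])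
qed

lemma norm_d_integrand_le:
  assumes s: "s \<in> {\<alpha>..\<beta>}" and c: "\<And>\<tau>. \<tau> \<in> {\<alpha>..s} \<Longrightarrow> norm (h \<tau>) \<le> c"
  shows "norm (d_integrand x h s) \<le> lip_const \<rho> * c"
proof -
  let ?l = "local_bound \<rho>"
  have l: "?l > 0" by (rule local_bound_pos)
  have c0: "c \<ge> 0" by (rule order_trans[OF norm_ge_zero c[of \<alpha>]]) (use s in auto)
  have A: "norm (a' s (x s) (h s)) \<le> ?l * c"
    by (rule order_trans[OF local_bound(4)[OF s x_le[OF s]]]) (use c[of s] s l in simp)
  have B: "norm (b' s \<tau> (x \<tau>) (h \<tau>)) \<le> ?l * c" if \<tau>: "\<tau> \<in> {\<alpha>..\<beta>}" for \<tau>
  proof (cases "\<tau> \<le> s")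
    case True
    show ?thesis
      by (rule order_trans[OF local_bound(5)[OF s \<tau> x_le[OF \<tau>]]]) (use c[of \<tau>] True \<tau> l in simp)
  next
    case False
    then show ?thesis using l c0 by (simp add: b'_causal)
  qed
  have "norm (d_integrand x h s) \<le> norm (a' s (x s) (h s)) + norm (\<integral>\<tau>. b' s \<tau> (x \<tau>) (h \<tau>) \<partial>M)"
    unfolding d_integrand_def by (rule norm_triangle_ineq)
  also have "\<dots> \<le> ?l * c + (\<beta> - \<alpha>) * (?l * c)"
    by (intro add_mono A norm_integral_le_M B) (use l c0 in auto)
  finally show ?thesis by (simp add: lip_const_def algebra_simps)
qed

lemma d_integrand_measurable: "h \<in> borel_measurable M \<Longrightarrow> d_integrand x h \<in> borel_measurable M"
  unfolding d_integrand_def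
  by (intro borel_measurable_add a'_meas x borel_measurable_lebesgue_integral b'_meas)

lemma d_integrand_linear:
  assumes s: "s \<in> {\<alpha>..\<beta>}" and h: "continuous_on {\<alpha>..\<beta>} h" and k: "continuous_on {\<alpha>..\<beta>} k"
  shows "d_integrand x (\<lambda>t. h t + k t) s = d_integrand x h s + d_integrand x k s"
    "d_integrand x (\<lambda>t. h t - k t) s = d_integrand x h s - d_integrand x k s"
    "d_integrand x (\<lambda>t. c *\<^sub>R h t) s = c *\<^sub>R d_integrand x h s"
proof -
  have la: "linear (a' s (x s))" using a_deriv[OF s] by (rule has_derivative_linear)
  have lb: "linear (b' s \<tau> (x \<tau>))" if "\<tau> \<in> {\<alpha>..\<beta>}" for \<tau> using b_deriv[OF s that] by (rule has_derivative_linear)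
  note ih = b'_integrable_continuous[OF s h] and ik = b'_integrable_continuous[OF s k]
  have "(\<integral>\<tau>. b' s \<tau> (x \<tau>) (h \<tau> + k \<tau>) \<partial>M) = (\<integral>\<tau>. b' s \<tau> (x \<tau>) (h \<tau>) + b' s \<tau> (x \<tau>) (k \<tau>) \<partial>M)"
    by (intro Bochner_Integration.integral_cong) (auto simp: linear_add[OF lb])
  then show "d_integrand x (\<lambda>t. h t + k t) s = d_integrand x h s + d_integrand x k s"
    using ih ik by (simp add: d_integrand_def linear_add[OF la])
  have "(\<integral>\<tau>. b' s \<tau> (x \<tau>) (h \<tau> - k \<tau>) \<partial>M) = (\<integral>\<tau>. b' s \<tau> (x \<tau>) (h \<tau>) - b' s \<tau> (x \<tau>) (k \<tau>) \<partial>M)"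
    by (intro Bochner_Integration.integral_cong) (auto simp: linear_diff[OF lb])
  then show "d_integrand x (\<lambda>t. h t - k t) s = d_integrand x h s - d_integrand x k s"
    using ih ik by (simp add: d_integrand_def linear_diff[OF la])
  have "(\<integral>\<tau>. b' s \<tau> (x \<tau>) (c *\<^sub>R h \<tau>) \<partial>M) = (\<integral>\<tau>. c *\<^sub>R b' s \<tau> (x \<tau>) (h \<tau>) \<partial>M)"
    by (intro Bochner_Integration.integral_cong) (auto simp: linear_scale[OF lb])
  then show "d_integrand x (\<lambda>t. c *\<^sub>R h t) s = c *\<^sub>R d_integrand x h s"
    by (simp add: d_integrand_def linear_scale[OF la] scaleR_add_right)
qed

text \<open>Linearity in the direction reduces this to the bound for a single direction.\<close>

lemma causal_lipschitz_d_integrand: "causal_lipschitz (lip_const \<rho>) (d_integrand x)"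
  unfolding causal_lipschitz_def
proof (intro allI impI)
  fix h k :: "real \<Rightarrow> 'v" and s c
  assume "continuous_on {\<alpha>..\<beta>} h" "continuous_on {\<alpha>..\<beta>} k" "s \<in> {\<alpha>..\<beta>}" "\<forall>\<tau>\<in>{\<alpha>..s}. norm (h \<tau> - k \<tau>) \<le> c"
  then show "norm (d_integrand x h s - d_integrand x k s) \<le> lip_const \<rho> * c"
    using norm_d_integrand_le[of s "\<lambda>t. h t - k t" c] by (simp add: d_integrand_linear(2))
qed

lemma square_integrable_d_integrand:
  assumes "continuous_on {\<alpha>..\<beta>} h"
  shows "square_integrable M (d_integrand x h)"
proof -
  obtain c where c: "c \<ge> 0" "\<forall>t\<in>{\<alpha>..\<beta>}. norm (h t) \<le> c" using continuous_imp_bounded_measurable(2)[OF assms] by blast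
  have le: "norm (d_integrand x h s) \<le> lip_const \<rho> * c" if "s \<in> {\<alpha>..\<beta>}" for s
    by (rule norm_d_integrand_le[OF that]) (use c(2) that in auto)
  show ?thesis
    by (rule square_integrable_bounded_M(1)[OF d_integrand_measurable[OF continuous_imp_bounded_measurable(1)[OF assms]] le])
      (use c lip_const_pos[of \<rho>] in auto)
qed

end

end

section \<open>Bijectivity and stability of the operator and of its linearisation\<close>

context volterra_coefficients
begin

definition V :: "(real \<Rightarrow> 'v) \<Rightarrow> real \<Rightarrow> 'v" where
  "V x t = x t + primitive (integrand x) t"

definition dV :: "(real \<Rightarrow> 'v) \<Rightarrow> (real \<Rightarrow> 'v) \<Rightarrow> real \<Rightarrow> 'v" where
  "dV x h t = h t + primitive (d_integrand x h) t"

lemma AC02_measurable: "x \<in> X \<Longrightarrow> x \<in> borel_measurable M"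
  by (rule continuous_imp_bounded_measurable(1)[OF AC02_continuous])

lemma AC02_bounded:
  assumes "x \<in> X" "N x \<le> R" "t \<in> {\<alpha>..\<beta>}"
  shows "norm (x t) \<le> sqrt (\<beta> - \<alpha>) * R"
  by (rule order_trans[OF AC02_norm_le'[OF assms(1,3)]]) (use assms(2) less in \<open>auto intro!: mult_left_mono\<close>)

lemma square_integrable_integrand_AC02: "x \<in> X \<Longrightarrow> square_integrable M (integrand x)"
  by (rule square_integrable_integrand[OF AC02_measurable AC02_norm_le'])

lemma V_mem: "x \<in> X \<Longrightarrow> V x \<in> X"
  unfolding V_def[abs_def]
  by (intro AC02_linear(1) primitive_mem_AC02 square_integrable_integrand_AC02)

lemma square_norm_integrand_le:
  assumes x: "x \<in> X"
  shows "square_norm M (integrand x) \<le> \<kappa> * N x + D"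
  unfolding integrand_def[abs_def]
  by (rule growth[OF AC02_measurable[OF x] AC02_norm_nonneg AC02_norm_le[OF x]])

lemma a_priori_bound:
  assumes x: "x \<in> X"
  shows "N x \<le> (N (V x) + D) / (1 - \<kappa>)"
proof -
  note sq = square_integrable_integrand_AC02[OF x]
  have "N x = N (\<lambda>t. V x t - primitive (integrand x) t)" by (simp add: V_def)
  also have "\<dots> \<le> N (V x) + N (primitive (integrand x))"
    by (rule AC02_linear(4)[OF V_mem[OF x] primitive_mem_AC02[OF sq]])
  also have "\<dots> \<le> N (V x) + (\<kappa> * N x + D)"
    unfolding AC02_norm_primitive[OF sq] using square_norm_integrand_le[OF x] by simp
  finally have "N x * (1 - \<kappa>) \<le> N (V x) + D" by (simp add: algebra_simps)
  then show ?thesis using \<kappa> by (simp add: pos_le_divide_eq)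
qed

text \<open>The coefficients are composed with the retraction onto a ball so large that, by the growth
  condition, solutions of the modified equation never leave it.\<close>

lemma V_surj:
  assumes y: "y \<in> X"
  obtains x where "x \<in> X" "V x = y"
proof -
  \<comment> \<open>The a priori bound gives m as a bound on the norm of every solution, and \<rho>
    then bounds its values; the maximum with 0 keeps the ball nonempty.\<close>
  define m where "m = (N y + D) / (1 - \<kappa>)"
  define \<rho> where "\<rho> = max 0 (sqrt (\<beta> - \<alpha>) * m)"
  have \<rho>: "\<rho> \<ge> 0" by (simp add: \<rho>_def)
  define \<pi> where "\<pi> = closest_point (cball (0::'v) \<rho>)"
  have ball: "convex (cball (0::'v) \<rho>)" "closed (cball (0::'v) \<rho>)" "cball (0::'v) \<rho> \<noteq> {}" using \<rho> by auto
  have \<pi>_le: "norm (\<pi> z) \<le> \<rho>" for z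
    using closest_point_in_set[OF ball(2,3), of z] by (simp add: \<pi>_def)
  have \<pi>_lip: "norm (\<pi> z - \<pi> w) \<le> norm (z - w)" for z w
    using closest_point_lipschitz[OF ball, of z w] by (simp add: \<pi>_def dist_norm)
  have \<pi>_id: "\<pi> z = z" if "norm z \<le> \<rho>" for z
    unfolding \<pi>_def using that by (intro closest_point_self) simp
  \<comment> \<open>As 0 is a fixed point, the retraction does not increase norms; this is what
    saves the growth bound for the modified equation.\<close>
  have \<pi>_norm: "norm (\<pi> z) \<le> norm z" for z
    using \<pi>_lip[of z 0] \<pi>_id[of 0] \<rho> by simp
  have \<pi>_cont: "continuous_on {\<alpha>..\<beta>} (\<lambda>t. \<pi> (x t))" if "continuous_on {\<alpha>..\<beta>} x" for x
    unfolding \<pi>_def by (rule continuous_on_compose2[OF continuous_on_closest_point[OF ball] that]) auto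
  define \<Psi> where "\<Psi> x = integrand (\<lambda>t. \<pi> (x t))" for x
  have lip: "causal_lipschitz (lip_const \<rho>) \<Psi>"
    unfolding causal_lipschitz_def \<Psi>_def
  proof (intro allI impI)
    fix x y :: "real \<Rightarrow> 'v" and s c
    assume x: "continuous_on {\<alpha>..\<beta>} x" and y: "continuous_on {\<alpha>..\<beta>} y" and s: "s \<in> {\<alpha>..\<beta>}"
      and c: "\<forall>\<tau>\<in>{\<alpha>..s}. norm (x \<tau> - y \<tau>) \<le> c"
    show "norm (integrand (\<lambda>t. \<pi> (x t)) s - integrand (\<lambda>t. \<pi> (y t)) s) \<le> lip_const \<rho> * c"
    proof (rule integrand_lipschitz[OF _ \<pi>_le _ \<pi>_le s])
      fix \<tau> assume "\<tau> \<in> {\<alpha>..s}"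
      then show "norm (\<pi> (x \<tau>) - \<pi> (y \<tau>)) \<le> c" using order_trans[OF \<pi>_lip c[rule_format]] by simp
    qed (intro continuous_imp_bounded_measurable(1) \<pi>_cont x y)+
  qed
  have sq: "square_integrable M (\<Psi> x)" if "continuous_on {\<alpha>..\<beta>} x" for x
    unfolding \<Psi>_def
    by (rule square_integrable_integrand[OF continuous_imp_bounded_measurable(1)[OF \<pi>_cont[OF that]] \<pi>_le])
  obtain x where x: "x \<in> X" and eq: "\<And>t. x t + primitive (\<Psi> x) t = y t"
    using causal_equation_solvable[OF lip lip_const_pos sq y] by blast
  note sqx = sq[OF AC02_continuous[OF x]]
  \<comment> \<open>The growth condition is stated for measurable functions under a pointwise bound
    because the retracted function is known to satisfy only that.\<close>
  have "square_norm M (\<Psi> x) \<le> \<kappa> * N x + D"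
    unfolding \<Psi>_def integrand_def[abs_def]
  proof (rule growth[OF continuous_imp_bounded_measurable(1)[OF \<pi>_cont[OF AC02_continuous[OF x]]] AC02_norm_nonneg])
    fix \<tau> assume "\<tau> \<in> {\<alpha>..\<beta>}"
    then show "norm (\<pi> (x \<tau>)) \<le> sqrt (\<tau> - \<alpha>) * N x" by (intro order_trans[OF \<pi>_norm AC02_norm_le[OF x]])
  qed
  moreover have "N x \<le> N y + square_norm M (\<Psi> x)"
  proof -
    have "x = (\<lambda>t. y t - primitive (\<Psi> x) t)" by (rule ext) (simp add: eq[symmetric])
    then have "N x = N (\<lambda>t. y t - primitive (\<Psi> x) t)" by (rule arg_cong)
    also have "\<dots> \<le> N y + N (primitive (\<Psi> x))" by (rule AC02_linear(4)[OF y primitive_mem_AC02[OF sqx]])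
    finally show ?thesis by (simp add: AC02_norm_primitive[OF sqx])
  qed
  ultimately have "N x * (1 - \<kappa>) \<le> N y + D" by (simp add: algebra_simps)
  then have Nx: "N x \<le> m" using \<kappa> by (simp add: m_def pos_le_divide_eq)
  have "\<pi> (x t) = x t" if "t \<in> {\<alpha>..\<beta>}" for t
    using AC02_bounded[OF x Nx that] by (intro \<pi>_id) (simp add: \<rho>_def)
  then have "\<Psi> x s = integrand x s" if "s \<in> {\<alpha>..\<beta>}" for s
    unfolding \<Psi>_def integrand_def using that
    by (auto intro!: arg_cong2[where f="(+)"] Bochner_Integration.integral_cong)
  then have "primitive (\<Psi> x) = primitive (integrand x)" by (rule primitive_cong)
  then have "V x = y" using eq by (simp add: V_def fun_eq_iff)
  then show thesis using that x by blast
qed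

definition stability_const :: "real \<Rightarrow> real" where
  "stability_const \<rho> = 1 + 2 * lip_const \<rho> * (\<beta> - \<alpha>) * exp (2 * lip_const \<rho> * (\<beta> - \<alpha>))"

lemma stability_const_pos: "stability_const \<rho> > 0"
  using less lip_const_pos[of \<rho>] unfolding stability_const_def by (intro add_pos_nonneg) auto

text \<open>The difference z of x and y satisfies z = (V x - V y) - primitive r, where r is the
  difference of the integrands and is bounded causally by z. The common radius R fixes the Lipschitz
  constant.\<close>

lemma V_stability:
  assumes x: "x \<in> X" "N x \<le> R" and y: "y \<in> X" "N y \<le> R"
  shows "N (\<lambda>t. x t - y t) \<le> stability_const (sqrt (\<beta> - \<alpha>) * R) * N (\<lambda>t. V x t - V y t)"
  unfolding stability_const_def
proof (rule causal_perturbation_norm_le[OF lip_const_pos])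
  note sx = square_integrable_integrand_AC02[OF x(1)] and sy = square_integrable_integrand_AC02[OF y(1)]
  show "square_integrable M (\<lambda>s. integrand x s - integrand y s)" by (rule square_integrable_diff(1)[OF sx sy])
  show "x t - y t = V x t - V y t - primitive (\<lambda>s. integrand x s - integrand y s) t" for t
    using primitive_linear(2)[OF sx[THEN square_integrable_integrable] sy[THEN square_integrable_integrable], of t]
    by (simp add: V_def)
  show "norm (integrand x s - integrand y s) \<le> lip_const (sqrt (\<beta> - \<alpha>) * R) * c"
    if "s \<in> {\<alpha>..\<beta>}" "\<And>\<tau>. \<tau> \<in> {\<alpha>..s} \<Longrightarrow> norm (x \<tau> - y \<tau>) \<le> c" for s c
    by (rule integrand_lipschitz[OF AC02_measurable[OF x(1)] AC02_bounded[OF x] AC02_measurable[OF y(1)] AC02_bounded[OF y] that])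
qed (intro AC02_linear(3) V_mem x y)+

lemma AC02_norm_zero_imp:
  assumes "x \<in> X" "N x \<le> 0"
  shows "x t = 0"
proof (cases "t \<in> {\<alpha>..\<beta>}")
  case True
  have "norm (x t) \<le> sqrt (\<beta> - \<alpha>) * 0" by (rule AC02_bounded[OF assms True])
  then show ?thesis by simp
qed (rule AC02_outside[OF assms(1)])

lemma AC02_norm_zero_fun: "N (\<lambda>t. 0 :: 'v) = 0"
proof -
  have z: "square_integrable M (\<lambda>t. 0 :: 'v)" by (simp add: square_integrable_def)
  have "primitive (\<lambda>t. 0 :: 'v) = (\<lambda>t. 0)" by (auto simp: primitive_def)
  then show ?thesis using AC02_norm_primitive[OF z] by (simp add: square_norm_def)
qed

lemma V_inj: "inj_on V X"
proof (rule inj_onI)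
  fix x y assume xy: "x \<in> X" "y \<in> X" "V x = V y"
  have "N (\<lambda>t. x t - y t) \<le> stability_const (sqrt (\<beta> - \<alpha>) * max (N x) (N y)) * N (\<lambda>t. V x t - V y t)"
    by (rule V_stability) (use xy in auto)
  then have "N (\<lambda>t. x t - y t) \<le> 0" using xy(3) by (simp add: AC02_norm_zero_fun)
  then have "x t - y t = 0" for t by (rule AC02_norm_zero_imp[OF AC02_linear(3)[OF xy(1,2)]])
  then show "x = y" by (simp add: fun_eq_iff)
qed

context
  fixes x :: "real \<Rightarrow> 'v"
  assumes x: "x \<in> X"
begin

lemma dV_base:
  shows "x \<in> borel_measurable M" "t \<in> {\<alpha>..\<beta>} \<Longrightarrow> norm (x t) \<le> sqrt (\<beta> - \<alpha>) * N x"
  using AC02_measurable[OF x] AC02_norm_le'[OF x] by auto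

lemma square_integrable_d_integrand_AC02: "h \<in> X \<Longrightarrow> square_integrable M (d_integrand x h)"
  by (rule square_integrable_d_integrand[OF dV_base AC02_continuous])

lemma dV_mem: "h \<in> X \<Longrightarrow> dV x h \<in> X"
  unfolding dV_def[abs_def]
  by (intro AC02_linear(1) primitive_mem_AC02 square_integrable_d_integrand_AC02)

lemma dV_linear:
  assumes h: "h \<in> X" and k: "k \<in> X"
  shows "dV x (\<lambda>t. h t + k t) = (\<lambda>t. dV x h t + dV x k t)"
    "dV x (\<lambda>t. h t - k t) = (\<lambda>t. dV x h t - dV x k t)"
    "dV x (\<lambda>t. c *\<^sub>R h t) = (\<lambda>t. c *\<^sub>R dV x h t)"
proof -
  note i = square_integrable_d_integrand_AC02[OF h, THEN square_integrable_integrable]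
    square_integrable_d_integrand_AC02[OF k, THEN square_integrable_integrable]
  note lin = d_integrand_linear[OF dV_base _ AC02_continuous[OF h] AC02_continuous[OF k]]
  have 1: "primitive (d_integrand x (\<lambda>t. h t + k t)) = primitive (\<lambda>s. d_integrand x h s + d_integrand x k s)"
    by (rule primitive_cong) (rule lin(1))
  have 2: "primitive (d_integrand x (\<lambda>t. h t - k t)) = primitive (\<lambda>s. d_integrand x h s - d_integrand x k s)"
    by (rule primitive_cong) (rule lin(2))
  have 3: "primitive (d_integrand x (\<lambda>t. c *\<^sub>R h t)) = primitive (\<lambda>s. c *\<^sub>R d_integrand x h s)"
    by (rule primitive_cong) (rule lin(3))
  show "dV x (\<lambda>t. h t + k t) = (\<lambda>t. dV x h t + dV x k t)"
    "dV x (\<lambda>t. h t - k t) = (\<lambda>t. dV x h t - dV x k t)"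
    "dV x (\<lambda>t. c *\<^sub>R h t) = (\<lambda>t. c *\<^sub>R dV x h t)"
    unfolding dV_def[abs_def] 1 2 3 using primitive_linear[OF i] by (auto simp: scaleR_add_right)
qed

text \<open>The linearised integrand is causally Lipschitz with one constant on all continuous
  functions, so the fixed point argument applies to it directly.\<close>

lemma dV_surj:
  assumes "k \<in> X"
  obtains h where "h \<in> X" "dV x h = k"
proof -
  obtain h where "h \<in> X" "\<And>t. h t + primitive (d_integrand x h) t = k t"
    using causal_equation_solvable[OF causal_lipschitz_d_integrand[OF dV_base] lip_const_pos
        square_integrable_d_integrand[OF dV_base] assms] by blast
  then show thesis using that by (simp add: dV_def fun_eq_iff)
qed

text \<open>The linear counterpart of \<open>V_stability\<close>: h equals \<open>dV x h\<close>
  minus the primitive of a term that is causally bounded by h.\<close>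

lemma dV_stability:
  assumes h: "h \<in> X"
  shows "N h \<le> stability_const (sqrt (\<beta> - \<alpha>) * N x) * N (dV x h)"
  unfolding stability_const_def
proof (rule causal_perturbation_norm_le[OF lip_const_pos h dV_mem[OF h] square_integrable_d_integrand_AC02[OF h]])
  show "h t = dV x h t - primitive (d_integrand x h) t" for t by (simp add: dV_def)
  show "norm (d_integrand x h s) \<le> lip_const (sqrt (\<beta> - \<alpha>) * N x) * c"
    if "s \<in> {\<alpha>..\<beta>}" "\<And>\<tau>. \<tau> \<in> {\<alpha>..s} \<Longrightarrow> norm (h \<tau>) \<le> c" for s c
    by (rule norm_d_integrand_le[OF dV_base that])
qed

lemma dV_bounded:
  assumes h: "h \<in> X"
  shows "N (dV x h) \<le> (1 + (\<beta> - \<alpha>) * lip_const (sqrt (\<beta> - \<alpha>) * N x)) * N h"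
proof -
  let ?K = "lip_const (sqrt (\<beta> - \<alpha>) * N x)"
  note sq = square_integrable_d_integrand_AC02[OF h]
  have le: "norm (d_integrand x h s) \<le> ?K * (sqrt (\<beta> - \<alpha>) * N h)" if "s \<in> {\<alpha>..\<beta>}" for s
    by (rule norm_d_integrand_le[OF dV_base that]) (use that in \<open>auto intro: AC02_norm_le'[OF h]\<close>)
  have "square_norm M (d_integrand x h) \<le> sqrt (\<beta> - \<alpha>) * (?K * (sqrt (\<beta> - \<alpha>) * N h))"
    by (rule square_integrable_bounded_M(2)[OF square_integrable_measurable[OF sq] le])
      (use less lip_const_pos in \<open>auto intro!: mult_nonneg_nonneg simp: less_imp_le\<close>)
  also have "\<dots> = (sqrt (\<beta> - \<alpha>) * sqrt (\<beta> - \<alpha>)) * ?K * N h" by simp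
  also have "sqrt (\<beta> - \<alpha>) * sqrt (\<beta> - \<alpha>) = \<beta> - \<alpha>" using less by simp
  finally have r: "N (primitive (d_integrand x h)) \<le> (\<beta> - \<alpha>) * ?K * N h" by (simp add: AC02_norm_primitive[OF sq])
  have "N (dV x h) \<le> N h + N (primitive (d_integrand x h))"
    unfolding dV_def[abs_def] by (rule AC02_linear(2)[OF h primitive_mem_AC02[OF sq]])
  then show ?thesis using r by (simp add: algebra_simps)
qed

lemma bounded_linear_dV: "bounded_linear_in X N (dV x)"
  unfolding bounded_linear_in_def
  by (intro conjI ballI allI exI[of _ "1 + (\<beta> - \<alpha>) * lip_const (sqrt (\<beta> - \<alpha>) * N x)"])
    (auto intro: dV_mem dV_bounded simp: dV_linear)

end

end

section \<open>Frechet derivatives of the operator and of its inverse\<close>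

section \<open>Differentiability\<close>

lemma norm_divideR_le:
  assumes "\<nu> > 0" "norm v \<le> \<nu> * B"
  shows "norm (v /\<^sub>R \<nu>) \<le> B"
proof -
  have "norm (v /\<^sub>R \<nu>) = inverse \<nu> * norm v" using assms(1) by simp
  also have "\<dots> \<le> inverse \<nu> * (\<nu> * B)" using assms by (intro mult_left_mono) auto
  also have "\<dots> = B" using assms(1) by simp
  finally show ?thesis .
qed

context volterra_coefficients
begin

lemma V_image: "V ` X = X"
proof
  show "X \<subseteq> V ` X"
  proof
    fix y :: "real \<Rightarrow> 'v" assume "y \<in> X"
    then obtain x where "x \<in> X" "V x = y" by (rule V_surj)
    then show "y \<in> V ` X" by blast
  qed
qed (use V_mem in blast)

lemma V_inverse:
  assumes "z \<in> X"
  shows "inv_into X V z \<in> X" "V (inv_into X V z) = z"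
proof -
  have "z \<in> V ` X" using assms V_image by simp
  then show "inv_into X V z \<in> X" "V (inv_into X V z) = z" by (rule inv_into_into, rule f_inv_into_f)
qed

lemma dV_inverse:
  assumes x: "x \<in> X" and k: "k \<in> X"
  shows "inv_into X (dV x) k \<in> X" "dV x (inv_into X (dV x) k) = k"
proof -
  obtain h where "h \<in> X" "dV x h = k" by (rule dV_surj[OF x k])
  then have "k \<in> dV x ` X" by blast
  then show "inv_into X (dV x) k \<in> X" "dV x (inv_into X (dV x) k) = k" by (rule inv_into_into, rule f_inv_into_f)
qed

text \<open>Dominated convergence is used twice, in \<tau> for fixed s and in s. The pointwise
  remainders are o(\<open>N (h n)\<close>) because the values of \<open>h n\<close> are bounded by a
  multiple of \<open>N (h n)\<close>; the Lipschitz bounds on a fixed ball, divided by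
  \<open>N (h n)\<close>, give constant dominating functions.\<close>

lemma d_integrand_remainder_tendsto:
  assumes x: "x \<in> X" and h: "\<And>n. h n \<in> X" and h_pos: "\<And>n. N (h n) > 0" and h_lim: "(\<lambda>n. N (h n)) \<longlonglongrightarrow> 0"
  shows "(\<lambda>n. square_norm M (\<lambda>s. integrand (\<lambda>t. x t + h n t) s - integrand x s - d_integrand x (h n) s) / N (h n)) \<longlonglongrightarrow> 0"
proof -
  define c where "c = sqrt (\<beta> - \<alpha>)"
  have c: "c > 0" using less by (simp add: c_def)
  obtain R where R: "\<And>n. N (h n) \<le> R" "R > 0"
  proof -
    have "Bseq (\<lambda>n. N (h n))" using h_lim by (intro convergent_imp_Bseq convergentI)
    then obtain R where "R > 0 \<and> (\<forall>n. norm (N (h n)) \<le> R)" unfolding Bseq_def by (rule exE) simp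
    then show thesis using that[of R] by simp
  qed
  \<comment> \<open>A ball containing the values of x and of every x + \<open>h n\<close>, so that
    one Lipschitz constant serves all n.\<close>
  define \<rho> where "\<rho> = c * (N x + R)"
  let ?L = "lip_const \<rho>"
  have xh: "(\<lambda>t. x t + h n t) \<in> X" for n by (rule AC02_linear(1)[OF x h])
  have x_le: "norm (x t) \<le> \<rho>" if "t \<in> {\<alpha>..\<beta>}" for t
    using AC02_bounded[OF x _ that, of "N x + R"] R(2) by (simp add: \<rho>_def c_def)
  have xh_le: "norm (x t + h n t) \<le> \<rho>" if "t \<in> {\<alpha>..\<beta>}" for t n
    using AC02_bounded[OF xh _ that, of n "N x + R"] AC02_linear(2)[OF x h, of n] R(1)[of n] by (simp add: \<rho>_def c_def)
  have h_le: "norm (h n t) \<le> c * N (h n)" if "t \<in> {\<alpha>..\<beta>}" for t n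
    using AC02_norm_le'[OF h that] by (simp add: c_def)
  note xm = AC02_measurable[OF x] and xhm = AC02_measurable[OF xh] and hm = AC02_measurable[OF h]
  note hc = AC02_continuous[OF h]
  define q where "q n s = (integrand (\<lambda>t. x t + h n t) s - integrand x s - d_integrand x (h n) s) /\<^sub>R N (h n)" for n s
  \<comment> \<open>One Lipschitz bound for the difference of integrands and one for the
    differential, both at a direction of supremum at most \<open>c * N (h n)\<close>.\<close>
  define B where "B = 2 * ?L * c"
  have q_bound: "norm (q n s) \<le> B" if s: "s \<in> {\<alpha>..\<beta>}" for n s
  proof -
    have 1: "norm (integrand (\<lambda>t. x t + h n t) s - integrand x s) \<le> ?L * (c * N (h n))"
      by (rule integrand_lipschitz[OF xhm xh_le xm x_le s]) (use h_le s in auto)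
    have 2: "norm (d_integrand x (h n) s) \<le> ?L * (c * N (h n))"
      by (rule norm_d_integrand_le[OF xm x_le s]) (use h_le s in auto)
    have "norm (integrand (\<lambda>t. x t + h n t) s - integrand x s - d_integrand x (h n) s) \<le> ?L * (c * N (h n)) + ?L * (c * N (h n))"
      by (rule order_trans[OF norm_triangle_ineq4 add_mono[OF 1 2]])
    also have "\<dots> = N (h n) * B" by (simp add: B_def)
    finally show ?thesis unfolding q_def by (rule norm_divideR_le[OF h_pos])
  qed
  have q_meas: "q n \<in> borel_measurable M" for n
    unfolding q_def[abs_def]
    by (intro borel_measurable_scaleR borel_measurable_const borel_measurable_diff
        integrand_measurable[OF xhm xh_le] integrand_measurable[OF xm x_le] d_integrand_measurable[OF xm x_le hm])
  have q_lim: "(\<lambda>n. q n s) \<longlonglongrightarrow> 0" if s: "s \<in> {\<alpha>..\<beta>}" for s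
  proof -
    define A where "A n = (a s (x s + h n s) - a s (x s) - a' s (x s) (h n s)) /\<^sub>R N (h n)" for n
    define E where "E n \<tau> = (b s \<tau> (x \<tau> + h n \<tau>) - b s \<tau> (x \<tau>) - b' s \<tau> (x \<tau>) (h n \<tau>)) /\<^sub>R N (h n)" for n \<tau>
    have A: "A \<longlonglongrightarrow> 0"
      unfolding A_def by (rule has_derivative_scaled_remainder_tendsto[OF a_deriv[OF s] h_le[OF s] h_pos h_lim])
    have i1: "integrable M (\<lambda>\<tau>. b s \<tau> (x \<tau> + h n \<tau>))" for n by (rule b_integrable[OF xhm xh_le s])
    have i2: "integrable M (\<lambda>\<tau>. b s \<tau> (x \<tau>))" by (rule b_integrable[OF xm x_le s])
    have i3: "integrable M (\<lambda>\<tau>. b' s \<tau> (x \<tau>) (h n \<tau>))" for n by (rule b'_integrable_continuous[OF xm x_le s hc])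
    have qAE: "q n s = A n + (\<integral>\<tau>. E n \<tau> \<partial>M)" for n
    proof -
      have "(\<integral>\<tau>. E n \<tau> \<partial>M) = ((\<integral>\<tau>. b s \<tau> (x \<tau> + h n \<tau>) \<partial>M) - (\<integral>\<tau>. b s \<tau> (x \<tau>) \<partial>M) - (\<integral>\<tau>. b' s \<tau> (x \<tau>) (h n \<tau>) \<partial>M)) /\<^sub>R N (h n)"
        unfolding E_def using i1[of n] i2 i3[of n] by simp
      moreover have "integrand (\<lambda>t. x t + h n t) s - integrand x s - d_integrand x (h n) s =
          (a s (x s + h n s) - a s (x s) - a' s (x s) (h n s)) +
          ((\<integral>\<tau>. b s \<tau> (x \<tau> + h n \<tau>) \<partial>M) - (\<integral>\<tau>. b s \<tau> (x \<tau>) \<partial>M) - (\<integral>\<tau>. b' s \<tau> (x \<tau>) (h n \<tau>) \<partial>M))"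
        by (simp add: integrand_def d_integrand_def)
      ultimately show ?thesis by (simp add: q_def A_def scaleR_add_right)
    qed
    have "(\<lambda>n. \<integral>\<tau>. E n \<tau> \<partial>M) \<longlonglongrightarrow> (\<integral>\<tau>. 0 \<partial>M)"
    proof (rule integral_dominated_convergence[where w = "\<lambda>_. 2 * local_bound \<rho> * c"])
      show "E n \<in> borel_measurable M" for n
        unfolding E_def[abs_def] using i1[of n] i2 i3[of n]
        by (intro borel_measurable_scaleR borel_measurable_const borel_measurable_diff) auto
      show "AE \<tau> in M. (\<lambda>n. E n \<tau>) \<longlonglongrightarrow> 0"
      proof (rule AE_I2)
        fix \<tau> assume "\<tau> \<in> space M"
        then have \<tau>: "\<tau> \<in> {\<alpha>..\<beta>}" by simp
        show "(\<lambda>n. E n \<tau>) \<longlonglongrightarrow> 0"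
          unfolding E_def by (rule has_derivative_scaled_remainder_tendsto[OF b_deriv[OF s \<tau>] h_le[OF \<tau>] h_pos h_lim])
      qed
      show "AE \<tau> in M. norm (E n \<tau>) \<le> 2 * local_bound \<rho> * c" for n
      proof (rule AE_I2)
        fix \<tau> assume "\<tau> \<in> space M"
        then have \<tau>: "\<tau> \<in> {\<alpha>..\<beta>}" by simp
        have 1: "norm (b s \<tau> (x \<tau> + h n \<tau>) - b s \<tau> (x \<tau>)) \<le> local_bound \<rho> * norm (h n \<tau>)"
          using norm_diff_le_on_cball[OF b_deriv[OF s \<tau>] local_bound(5)[OF s \<tau>] xh_le[OF \<tau>, of n] x_le[OF \<tau>]] by simp
        have 2: "norm (b' s \<tau> (x \<tau>) (h n \<tau>)) \<le> local_bound \<rho> * norm (h n \<tau>)" by (rule local_bound(5)[OF s \<tau> x_le[OF \<tau>]])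
        have "norm (b s \<tau> (x \<tau> + h n \<tau>) - b s \<tau> (x \<tau>) - b' s \<tau> (x \<tau>) (h n \<tau>)) \<le> local_bound \<rho> * norm (h n \<tau>) + local_bound \<rho> * norm (h n \<tau>)"
          by (rule order_trans[OF norm_triangle_ineq4 add_mono[OF 1 2]])
        also have "\<dots> \<le> 2 * local_bound \<rho> * (c * N (h n))"
          using mult_left_mono[OF h_le[OF \<tau>, of n], of "local_bound \<rho>"] local_bound_pos[of \<rho>] by simp
        also have "\<dots> = N (h n) * (2 * local_bound \<rho> * c)" by simp
        finally show "norm (E n \<tau>) \<le> 2 * local_bound \<rho> * c" unfolding E_def by (rule norm_divideR_le[OF h_pos])
      qed
    qed auto
    then have "(\<lambda>n. A n + (\<integral>\<tau>. E n \<tau> \<partial>M)) \<longlonglongrightarrow> 0 + 0" by (intro tendsto_add A) simp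
    then show ?thesis by (simp add: qAE)
  qed
  have "(\<lambda>n. \<integral>s. (norm (q n s))\<^sup>2 \<partial>M) \<longlonglongrightarrow> (\<integral>s. 0 \<partial>M)"
  proof (rule integral_dominated_convergence[where w = "\<lambda>_. B\<^sup>2"])
    show "(\<lambda>s. (norm (q n s))\<^sup>2) \<in> borel_measurable M" for n
      using q_meas[of n] by measurable
    show "AE s in M. (\<lambda>n. (norm (q n s))\<^sup>2) \<longlonglongrightarrow> 0"
    proof (rule AE_I2)
      fix s assume "s \<in> space M"
      then have "(\<lambda>n. (norm (q n s))\<^sup>2) \<longlonglongrightarrow> (norm (0 :: 'v))\<^sup>2"
        by (intro tendsto_power tendsto_norm q_lim) simp
      then show "(\<lambda>n. (norm (q n s))\<^sup>2) \<longlonglongrightarrow> 0" by simp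
    qed
    show "AE s in M. norm ((norm (q n s))\<^sup>2) \<le> B\<^sup>2" for n
    proof (rule AE_I2)
      fix s assume "s \<in> space M"
      then have "norm (q n s) \<le> B" using q_bound by simp
      then show "norm ((norm (q n s))\<^sup>2) \<le> B\<^sup>2" by (simp add: power_mono)
    qed
  qed auto
  then have "(\<lambda>n. square_norm M (q n)) \<longlonglongrightarrow> sqrt 0"
    unfolding square_norm_def by (intro tendsto_real_sqrt) simp
  moreover have "square_norm M (q n) = square_norm M (\<lambda>s. integrand (\<lambda>t. x t + h n t) s - integrand x s - d_integrand x (h n) s) / N (h n)" for n
  proof -
    have "square_integrable M (\<lambda>s. integrand (\<lambda>t. x t + h n t) s - integrand x s - d_integrand x (h n) s)"
      by (intro square_integrable_diff(1) square_integrable_integrand[OF xhm xh_le] square_integrable_integrand[OF xm x_le]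
          square_integrable_d_integrand[OF xm x_le hc])
    from square_integrable_scaleR(2)[OF this, of "inverse (N (h n))"] show ?thesis
      using h_pos[of n] by (simp add: q_def[abs_def] divide_inverse_commute)
  qed
  ultimately show ?thesis by simp
qed

lemma V_remainder:
  assumes x: "x \<in> X" and h: "h \<in> X"
  shows "(\<lambda>t. V (\<lambda>r. x r + h r) t - V x t - dV x h t) \<in> X"
    "N (\<lambda>t. V (\<lambda>r. x r + h r) t - V x t - dV x h t) =
      square_norm M (\<lambda>s. integrand (\<lambda>t. x t + h t) s - integrand x s - d_integrand x h s)"
proof -
  note xh = AC02_linear(1)[OF x h]
  note s1 = square_integrable_integrand_AC02[OF xh] and s2 = square_integrable_integrand_AC02[OF x]
    and s3 = square_integrable_d_integrand_AC02[OF x h]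
  note s12 = square_integrable_diff(1)[OF s1 s2]
  note s123 = square_integrable_diff(1)[OF s12 s3]
  have eq: "(\<lambda>t. V (\<lambda>r. x r + h r) t - V x t - dV x h t) = primitive (\<lambda>s. integrand (\<lambda>t. x t + h t) s - integrand x s - d_integrand x h s)"
  proof
    fix t
    show "V (\<lambda>r. x r + h r) t - V x t - dV x h t = primitive (\<lambda>s. integrand (\<lambda>t. x t + h t) s - integrand x s - d_integrand x h s) t"
      unfolding primitive_linear(2)[OF s12[THEN square_integrable_integrable] s3[THEN square_integrable_integrable]]
        primitive_linear(2)[OF s1[THEN square_integrable_integrable] s2[THEN square_integrable_integrable]]
      by (simp add: V_def dV_def)
  qed
  show "(\<lambda>t. V (\<lambda>r. x r + h r) t - V x t - dV x h t) \<in> X"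
    unfolding eq by (rule primitive_mem_AC02[OF s123])
  show "N (\<lambda>t. V (\<lambda>r. x r + h r) t - V x t - dV x h t) =
      square_norm M (\<lambda>s. integrand (\<lambda>t. x t + h t) s - integrand x s - d_integrand x h s)"
    unfolding eq by (rule AC02_norm_primitive[OF s123])
qed

text \<open>Dominated convergence speaks of sequences, so a violation of the estimate is selected
  inside each ball of radius 1/(n+1) and refuted along the sequence.\<close>

lemma V_derivative:
  assumes x: "x \<in> X" and e: "e > 0"
  shows "\<exists>d>0. \<forall>h\<in>X. N h < d \<longrightarrow> N (\<lambda>t. V (\<lambda>r. x r + h r) t - V x t - dV x h t) \<le> e * N h"
proof (rule ccontr)
  assume neg: "\<not> ?thesis"
  define P where "P n h \<longleftrightarrow> h \<in> X \<and> N h < 1 / real (Suc n) \<and>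
    e * N h < N (\<lambda>t. V (\<lambda>r. x r + h r) t - V x t - dV x h t)" for n :: nat and h
  have "\<exists>h. P n h" for n
  proof -
    have "1 / real (Suc n) > 0" by simp
    then show ?thesis using neg unfolding P_def by (meson not_le)
  qed
  then obtain h where "\<And>n. P n (h n)" by metis
  then have h: "\<And>n. h n \<in> X" "\<And>n. N (h n) < 1 / real (Suc n)"
    "\<And>n. e * N (h n) < N (\<lambda>t. V (\<lambda>r. x r + h n r) t - V x t - dV x (h n) t)"
    unfolding P_def by simp_all
  \<comment> \<open>A violating direction of norm 0 would be the zero function, whose remainder is
    0.\<close>
  have pos: "N (h n) > 0" for n
  proof (rule ccontr)
    assume "\<not> N (h n) > 0"
    then have "N (h n) \<le> 0" by simp
    then have "h n t = 0" for t by (rule AC02_norm_zero_imp[OF h(1)])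
    then have h0: "h n = (\<lambda>t. 0)" by (rule ext)
    have "dV x (\<lambda>t. 0 *\<^sub>R h n t) = (\<lambda>t. 0 *\<^sub>R dV x (h n) t)" by (rule dV_linear(3)[OF x h(1) h(1)])
    then have "dV x (h n) = (\<lambda>t. 0)" by (simp add: h0)
    then have "N (\<lambda>t. V (\<lambda>r. x r + h n r) t - V x t - dV x (h n) t) = 0"
      by (simp add: h0 AC02_norm_zero_fun)
    then show False using h(3)[of n] mult_nonneg_nonneg[OF less_imp_le[OF e] AC02_norm_nonneg[of "h n"]] by simp
  qed
  have lim: "(\<lambda>n. N (h n)) \<longlonglongrightarrow> 0"
  proof (rule tendsto_sandwich[OF _ _ tendsto_const])
    show "(\<lambda>n. 1 / real (Suc n)) \<longlonglongrightarrow> 0" by (rule LIMSEQ_Suc[OF lim_1_over_n])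
  qed (use h(2) less_imp_le in \<open>auto intro!: always_eventually\<close>)
  from LIMSEQ_D[OF d_integrand_remainder_tendsto[OF x h(1) pos lim] e]
  obtain n where "norm (square_norm M (\<lambda>s. integrand (\<lambda>t. x t + h n t) s - integrand x s - d_integrand x (h n) s) / N (h n) - 0) < e"
    by blast
  then have "square_norm M (\<lambda>s. integrand (\<lambda>t. x t + h n t) s - integrand x s - d_integrand x (h n) s) < e * N (h n)"
    using pos[of n] by (simp add: pos_divide_less_eq)
  then show False using h(3)[of n] by (simp add: V_remainder(2)[OF x h(1)])
qed

text \<open>Let h be the increment of the inverse belonging to k, and let g be h minus the preimage
  of k under \<open>dV x\<close>, which is the remainder to be estimated. Then V (x + h) - V x - dV
  x h = k - dV x h = - dV x g. Stability of \<open>dV x\<close> bounds g by this remainder of V, and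
  stability of V bounds h by k.\<close>

lemma V_inverse_derivative:
  assumes y: "y \<in> X" and e: "e > 0"
  defines "x \<equiv> inv_into X V y"
  shows "\<exists>d>0. \<forall>k\<in>X. N k < d \<longrightarrow>
    N (\<lambda>t. inv_into X V (\<lambda>r. y r + k r) t - inv_into X V y t - inv_into X (dV x) k t) \<le> e * N k"
proof -
  note W = V_inverse
  have x: "x \<in> X" "V x = y" unfolding x_def by (rule W[OF y])+
  note U = dV_inverse[OF x(1)]
  \<comment> \<open>Bounds every w whose image has norm at most N y + 1; this is why N k < 1 is
    imposed below.\<close>
  define R where "R = (N y + 1 + D) / (1 - \<kappa>)"
  define C where "C = stability_const (sqrt (\<beta> - \<alpha>) * R)"
  define C' where "C' = stability_const (sqrt (\<beta> - \<alpha>) * N x)"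
  have C: "C > 0" "C' > 0" by (simp_all add: C_def C'_def stability_const_pos)
  have R: "N w \<le> R" if "w \<in> X" "N (V w) \<le> N y + 1" for w
  proof -
    have "N w \<le> (N (V w) + D) / (1 - \<kappa>)" by (rule a_priori_bound[OF that(1)])
    also have "\<dots> \<le> R" unfolding R_def using that(2) \<kappa> by (intro divide_right_mono) auto
    finally show ?thesis .
  qed
  \<comment> \<open>C passes from the norm of h to that of k, and C' from the norm of
    \<open>dV x g\<close> to that of g; together they turn this tolerance into e.\<close>
  have "e / (C * C') > 0" using e C by simp
  from V_derivative[OF x(1) this] obtain d where d: "d > 0 \<and>
    (\<forall>h\<in>X. N h < d \<longrightarrow> N (\<lambda>t. V (\<lambda>r. x r + h r) t - V x t - dV x h t) \<le> e / (C * C') * N h)"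
    by (rule exE)
  show ?thesis
  proof (intro exI[of _ "min 1 (d / C)"] conjI ballI impI)
    show "min 1 (d / C) > 0" using d C by simp
    fix k :: "real \<Rightarrow> 'v" assume k: "k \<in> X" "N k < min 1 (d / C)"
    have yk: "(\<lambda>r. y r + k r) \<in> X" by (rule AC02_linear(1)[OF y k(1)])
    define x2 where "x2 = inv_into X V (\<lambda>r. y r + k r)"
    have x2: "x2 \<in> X" "V x2 = (\<lambda>r. y r + k r)" unfolding x2_def by (rule W[OF yk])+
    define h where "h t = x2 t - x t" for t
    have h: "h \<in> X" unfolding h_def by (rule AC02_linear(3)[OF x2(1) x(1)])
    have x2_eq: "(\<lambda>r. x r + h r) = x2" by (simp add: h_def)
    have "N h \<le> C * N (\<lambda>t. V x2 t - V x t)"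
      unfolding h_def C_def
    proof (rule V_stability[OF x2(1) R[OF x2(1)] x(1) R[OF x(1)]])
      have "N (V x2) \<le> N y + N k" unfolding x2(2) by (rule AC02_linear(2)[OF y k(1)])
      then show "N (V x2) \<le> N y + 1" using k(2) by simp
      show "N (V x) \<le> N y + 1" by (simp add: x(2))
    qed
    also have "(\<lambda>t. V x2 t - V x t) = k" by (simp add: x2(2) x(2))
    finally have Nh: "N h \<le> C * N k" .
    have "C * N k < d" using k(2) C by (simp add: pos_less_divide_eq mult.commute)
    then have "N h < d" using Nh by simp
    then have rem: "N (\<lambda>t. V (\<lambda>r. x r + h r) t - V x t - dV x h t) \<le> e / (C * C') * N h"
      using d h by blast
    define g where "g t = h t - inv_into X (dV x) k t" for t
    have g: "g \<in> X" unfolding g_def by (rule AC02_linear(3)[OF h U(1)[OF k(1)]])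
    have dVg: "dV x g = (\<lambda>t. dV x h t - k t)"
      unfolding g_def dV_linear(2)[OF x(1) h U(1)[OF k(1)]] by (simp add: U(2)[OF k(1)])
    have rem_eq: "(\<lambda>t. V (\<lambda>r. x r + h r) t - V x t - dV x h t) = (\<lambda>t. (-1) *\<^sub>R dV x g t)"
      unfolding x2_eq dVg by (simp add: x2(2) x(2))
    have dVgX: "dV x g \<in> X" by (rule dV_mem[OF x(1) g])
    have "N (dV x g) = N (\<lambda>t. (-1) *\<^sub>R dV x g t)"
    proof -
      obtain u where u: "square_integrable M u" "dV x g = primitive u" using dVgX by (rule AC02_primitiveE)
      have "(\<lambda>t. (-1) *\<^sub>R dV x g t) = primitive (\<lambda>s. (-1) *\<^sub>R u s)"
        using primitive_linear(3)[OF u(1)[THEN square_integrable_integrable] u(1)[THEN square_integrable_integrable], of "-1"] u(2)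
        by (auto simp: fun_eq_iff)
      then show ?thesis
        using AC02_norm_primitive[OF u(1)] AC02_norm_primitive[OF square_integrable_scaleR(1)[OF u(1), of "-1"]]
          square_integrable_scaleR(2)[OF u(1), of "-1"] u(2) by simp
    qed
    then have "N (dV x g) \<le> e / (C * C') * N h" using rem by (simp add: rem_eq)
    also have "\<dots> \<le> e / (C * C') * (C * N k)" using Nh e C by (intro mult_left_mono) auto
    also have "\<dots> = e / C' * N k" using C by simp
    finally have "C' * N (dV x g) \<le> C' * (e / C' * N k)" using C by (intro mult_left_mono) auto
    moreover have "N g \<le> C' * N (dV x g)" unfolding C'_def by (rule dV_stability[OF x(1) g])
    ultimately have "N g \<le> e * N k" using C by simp
    then show "N (\<lambda>t. inv_into X V (\<lambda>r. y r + k r) t - inv_into X V y t - inv_into X (dV x) k t) \<le> e * N k"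
      by (simp add: g_def[abs_def] h_def x2_def x_def)
  qed
qed

text \<open>Stability makes \<open>dV x\<close> injective, so any element of X with the right image
  is the preimage. Linearity follows from this uniqueness, and the stability estimate is the bound
  on the inverse.\<close>

lemma bounded_linear_dV_inverse:
  assumes x: "x \<in> X"
  shows "bounded_linear_in X N (inv_into X (dV x))"
proof -
  note U = dV_inverse[OF x]
  have inj: "inj_on (dV x) X"
  proof (rule inj_onI)
    fix h k :: "real \<Rightarrow> 'v" assume hk: "h \<in> X" "k \<in> X" "dV x h = dV x k"
    have "N (\<lambda>t. h t - k t) \<le> stability_const (sqrt (\<beta> - \<alpha>) * N x) * N (dV x (\<lambda>t. h t - k t))"
      by (rule dV_stability[OF x AC02_linear(3)[OF hk(1,2)]])
    then have "N (\<lambda>t. h t - k t) \<le> 0" by (simp add: dV_linear(2)[OF x hk(1,2)] hk(3) AC02_norm_zero_fun)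
    then have "h t - k t = 0" for t by (rule AC02_norm_zero_imp[OF AC02_linear(3)[OF hk(1,2)]])
    then show "h = k" by (simp add: fun_eq_iff)
  qed
  have eqI: "inv_into X (dV x) k = h" if "h \<in> X" "dV x h = k" for h k
    using inv_into_f_f[OF inj that(1)] that(2) by simp
  show ?thesis
    unfolding bounded_linear_in_def
  proof (intro conjI ballI allI exI)
    fix h k :: "real \<Rightarrow> 'v" assume h: "h \<in> X" and k: "k \<in> X"
    show "inv_into X (dV x) (\<lambda>s. h s + k s) = (\<lambda>s. inv_into X (dV x) h s + inv_into X (dV x) k s)"
      by (rule eqI[OF AC02_linear(1)[OF U(1)[OF h] U(1)[OF k]]])
        (simp add: dV_linear(1)[OF x U(1)[OF h] U(1)[OF k]] U(2)[OF h] U(2)[OF k])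
  next
    fix c and h :: "real \<Rightarrow> 'v" assume h: "h \<in> X"
    show "inv_into X (dV x) (\<lambda>s. c *\<^sub>R h s) = (\<lambda>s. c *\<^sub>R inv_into X (dV x) h s)"
      by (rule eqI[OF AC02_linear(5)[OF U(1)[OF h] U(1)[OF h]]])
        (simp add: dV_linear(3)[OF x U(1)[OF h] U(1)[OF h]] U(2)[OF h])
  next
    fix k :: "real \<Rightarrow> 'v" assume k: "k \<in> X"
    show "inv_into X (dV x) k \<in> X" by (rule U(1)[OF k])
    show "N (inv_into X (dV x) k) \<le> stability_const (sqrt (\<beta> - \<alpha>) * N x) * N k"
      using dV_stability[OF x U(1)[OF k]] U(2)[OF k] by simp
  qed
qed

theorem diffeomorphism_V: "diffeomorphism_in X N V"
proof -
  show ?thesis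
    unfolding diffeomorphism_in_def
  proof (intro conjI V_image exI[of _ "inv_into X V"] ballI)
    fix x :: "real \<Rightarrow> 'v" assume x: "x \<in> X"
    show "inv_into X V (V x) = x" by (rule inv_into_f_f[OF V_inj x])
    show "frechet_differentiable_in X N V x"
      unfolding frechet_differentiable_in_def
      by (rule exI[of _ "dV x"]) (use bounded_linear_dV[OF x] V_derivative[OF x] in blast)
  next
    fix y :: "real \<Rightarrow> 'v" assume y: "y \<in> X"
    show "inv_into X V y \<in> X" "V (inv_into X V y) = y" by (rule V_inverse[OF y])+
    show "frechet_differentiable_in X N (inv_into X V) y"
      unfolding frechet_differentiable_in_def
      by (rule exI[of _ "inv_into X (dV (inv_into X V y))"])
        (use bounded_linear_dV_inverse[OF V_inverse(1)[OF y]] V_inverse_derivative[OF y] in blast)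
  qed
qed

end

section \<open>From the growth of the kernel to a linear bound in the L2 norm\<close>

section \<open>Growth conditions\<close>

lemma continuous_on_matrix_vector_mult:
  "continuous_on UNIV (\<lambda>p. (fst p :: real^'n^'m) *v (snd p :: real^'n))"
  unfolding matrix_vector_mult_def by (intro continuous_intros)

text \<open>Cauchy-Schwarz in each row; the norm of a matrix is here the root of the sum of the
  squares of its entries.\<close>

lemma norm_matrix_vector_mult_le:
  fixes A :: "real^'n^'m"
  shows "norm (A *v h) \<le> norm A * norm h"
proof -
  have "norm (A *v h) = L2_set (\<lambda>i. norm ((A *v h) $ i)) UNIV" by (simp add: norm_vec_def)
  also have "\<dots> \<le> L2_set (\<lambda>i. norm (A $ i) * norm h) UNIV"
    by (rule L2_set_mono) (simp_all add: matrix_vector_mul_component Cauchy_Schwarz_ineq2)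
  also have "\<dots> = L2_set (\<lambda>i. norm (A $ i)) UNIV * norm h" by (simp add: L2_set_left_distrib)
  finally show ?thesis by (simp add: norm_vec_def)
qed

lemma has_derivative_d_x:
  assumes "(\<lambda>y. v t \<tau> y) differentiable (at x)"
  shows "((\<lambda>y. v t \<tau> y) has_derivative (\<lambda>h. d_x v t \<tau> x *v h)) (at x)"
proof -
  let ?f = "frechet_derivative (\<lambda>y. v t \<tau> y) (at x)"
  have f: "((\<lambda>y. v t \<tau> y) has_derivative ?f) (at x)" using assms by (simp add: frechet_derivative_works)
  have "matrix ?f *v h = ?f h" for h by (rule matrix_works) (use has_derivative_linear[OF f] in \<open>simp add: linear_matrix_vector_mul_eq\<close>)
  then show ?thesis using f by (simp add: d_x_def)
qed

context compact_interval
begin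

lemma square_norm_cong:
  assumes "\<And>s. s \<in> {\<alpha>..\<beta>} \<Longrightarrow> u s = w s"
  shows "square_norm M u = square_norm M w" "square_integrable M u = square_integrable M w"
proof -
  show "square_norm M u = square_norm M w" unfolding square_norm_def
    by (rule arg_cong[where f=sqrt], rule Bochner_Integration.integral_cong) (use assms in auto)
  have "u \<in> borel_measurable M \<longleftrightarrow> w \<in> borel_measurable M" by (rule measurable_cong) (use assms in auto)
  moreover have "integrable M (\<lambda>s. (norm (u s))\<^sup>2) \<longleftrightarrow> integrable M (\<lambda>s. (norm (w s))\<^sup>2)"
    by (rule Bochner_Integration.integrable_cong) (use assms in auto)
  ultimately show "square_integrable M u = square_integrable M w" by (simp add: square_integrable_def)
qed

lemma c_tilde_eq:
  assumes "s \<in> {\<alpha>..\<beta>}"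
  shows "c_tilde \<alpha> \<beta> c1 c2 s = sqrt (s - \<alpha>) * c1 s + (\<beta> - \<alpha>) / sqrt 2 * section_norm c2 s"
  unfolding c_tilde_def section_norm_eq[OF assms] by simp

text \<open>With c1 = 0, \<open>c_tilde\<close> is (\<beta> - \<alpha>) / sqrt 2 times the section
  norm of c, whose L2 norm is that of c over the triangle; the threshold of (A3) becomes exactly
  1/2.\<close>

lemma cond_A3_imp_cond_A4:
  assumes "cond_A3 \<alpha> \<beta> v"
  shows "cond_A4 \<alpha> \<beta> v"
proof -
  obtain c d where v0: "\<forall>t\<in>{\<alpha>..\<beta>}. \<forall>x. v t t x = 0" and c: "c \<in> L2_nonneg (P_tri \<alpha> \<beta>)"
    and d: "d \<in> L2_nonneg (P_tri \<alpha> \<beta>)" and growth: "d_t_linear_growth \<alpha> \<beta> v c d"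
    and small: "L2_norm (P_tri \<alpha> \<beta>) c < sqrt 2 / (2 * (\<beta> - \<alpha>))"
    using assms unfolding cond_A3_def by blast
  have 0: "(\<lambda>_. 0::real) \<in> L2_nonneg {\<alpha>..\<beta>}"
    by (simp add: L2_nonneg_def mem_L2_iff square_integrable_def)
  have "L2_norm {\<alpha>..\<beta>} (c_tilde \<alpha> \<beta> (\<lambda>_. 0) c) = square_norm M (\<lambda>s. ((\<beta> - \<alpha>) / sqrt 2) *\<^sub>R section_norm c s)"
    unfolding L2_norm_eq by (rule square_norm_cong(1)) (simp add: c_tilde_eq)
  also have "\<dots> = (\<beta> - \<alpha>) / sqrt 2 * L2_norm (P_tri \<alpha> \<beta>) c"
    using square_integrable_scaleR(2)[OF L2_triangle_sections(2)[OF c], of "(\<beta> - \<alpha>) / sqrt 2"] less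
    by (simp add: L2_triangle_sections(3)[OF c])
  also have "\<dots> < (\<beta> - \<alpha>) / sqrt 2 * (sqrt 2 / (2 * (\<beta> - \<alpha>)))"
    using small less by (intro mult_strict_left_mono) auto
  also have "\<dots> = 1 / 2" using less by (simp add: field_simps)
  finally have "L2_norm {\<alpha>..\<beta>} (c_tilde \<alpha> \<beta> (\<lambda>_. 0) c) < 1 / 2" .
  then show ?thesis unfolding cond_A4_def
    by (intro bexI[of _ "\<lambda>_. 0"] bexI[OF _ c] bexI[OF _ d] bexI[OF _ 0] conjI growth) (use v0 0 in auto)
qed

text \<open>The integral of \<tau> - \<alpha> over [\<alpha>, s] is (s - \<alpha>)^2 / 2, the origin
  of the factor 1 / sqrt 2 in \<open>c_tilde\<close>.\<close>

lemma square_norm_indicator_sqrt: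
  assumes s: "s \<in> {\<alpha>..\<beta>}"
  shows "square_integrable M (\<lambda>\<tau>. indicator {..s} \<tau> * sqrt (\<tau> - \<alpha>))"
    "square_norm M (\<lambda>\<tau>. indicator {..s} \<tau> * sqrt (\<tau> - \<alpha>)) = (s - \<alpha>) / sqrt 2"
proof -
  have m: "(\<lambda>\<tau>. sqrt (\<tau> - \<alpha>)) \<in> borel_measurable M"
    by (intro measurable_restrict_space1 measurable_completion) simp
  show "square_integrable M (\<lambda>\<tau>. indicator {..s} \<tau> * sqrt (\<tau> - \<alpha>))"
  proof (rule square_integrable_bounded_M(1)[of _ "sqrt (\<beta> - \<alpha>)"])
    show "(\<lambda>\<tau>. indicator {..s} \<tau> * sqrt (\<tau> - \<alpha>)) \<in> borel_measurable M"
      by (intro borel_measurable_times borel_measurable_indicator_M m) simp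
  qed (use less in \<open>auto simp: indicator_def\<close>)
  have "(\<integral>\<tau>. (norm (indicator {..s} \<tau> * sqrt (\<tau> - \<alpha>)))\<^sup>2 \<partial>M) = (\<integral>\<tau>. indicator {\<alpha>..s} \<tau> *\<^sub>R (\<tau> - \<alpha>) \<partial>M)"
    by (rule Bochner_Integration.integral_cong) (auto simp: indicator_def)
  also have "\<dots> = (s - \<alpha>)\<^sup>2 / 2 - (\<alpha> - \<alpha>)\<^sup>2 / 2"
  proof (rule integral_M_FTC)
    fix \<tau>
    have "((\<lambda>\<tau>. (\<tau> - \<alpha>)\<^sup>2 / 2) has_real_derivative (\<tau> - \<alpha>)) (at \<tau> within {\<alpha>..s})"
      by (auto intro!: derivative_eq_intros)
    then show "((\<lambda>\<tau>. (\<tau> - \<alpha>)\<^sup>2 / 2) has_vector_derivative (\<tau> - \<alpha>)) (at \<tau> within {\<alpha>..s})"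
      by (simp add: has_real_derivative_iff_has_vector_derivative)
  qed (use s in \<open>auto intro!: continuous_intros\<close>)
  finally have eq: "(\<integral>\<tau>. (norm (indicator {..s} \<tau> * sqrt (\<tau> - \<alpha>)))\<^sup>2 \<partial>M) = (s - \<alpha>)\<^sup>2 / 2" by simp
  show "square_norm M (\<lambda>\<tau>. indicator {..s} \<tau> * sqrt (\<tau> - \<alpha>)) = (s - \<alpha>) / sqrt 2"
    unfolding square_norm_def eq real_sqrt_divide using s by simp
qed

text \<open>Cauchy-Schwarz in \<tau>, for \<open>c\<close> against the weight sqrt(\<tau> -
  \<alpha>) and for \<open>d\<close> against the constant 1.\<close>

lemma norm_integral_le_section_norm:
  fixes f :: "real \<Rightarrow> 'a::euclidean_space"
  assumes s: "s \<in> {\<alpha>..\<beta>}" and m: "m \<ge> 0"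
    and c: "square_integrable M (\<lambda>\<tau>. indicator {..s} \<tau> * c (s, \<tau>))"
    and d: "square_integrable M (\<lambda>\<tau>. indicator {..s} \<tau> * d (s, \<tau>))"
    and nonneg: "\<And>\<tau>. \<tau> \<in> {\<alpha>..s} \<Longrightarrow> c (s, \<tau>) \<ge> 0" "\<And>\<tau>. \<tau> \<in> {\<alpha>..s} \<Longrightarrow> d (s, \<tau>) \<ge> 0"
    and f: "\<And>\<tau>. \<tau> \<in> {\<alpha>..s} \<Longrightarrow> norm (f \<tau>) \<le> c (s, \<tau>) * (sqrt (\<tau> - \<alpha>) * m) + d (s, \<tau>)"
      "\<And>\<tau>. \<tau> > s \<Longrightarrow> f \<tau> = 0"
  shows "norm (\<integral>\<tau>. f \<tau> \<partial>M) \<le> (\<beta> - \<alpha>) / sqrt 2 * section_norm c s * m + sqrt (\<beta> - \<alpha>) * section_norm d s"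
proof (cases "integrable M f")
  \<comment> \<open>The integral of a nonintegrable f is 0 by convention, and the right-hand side is
    nonnegative.\<close>
  case False
  then show ?thesis using less m by (simp add: not_integrable_integral_eq)
next
  case True
  let ?c = "\<lambda>\<tau>. indicator {..s} \<tau> * c (s, \<tau>)" and ?d = "\<lambda>\<tau>. indicator {..s} \<tau> * d (s, \<tau>)"
  let ?r = "\<lambda>\<tau>. indicator {..s} \<tau> * sqrt (\<tau> - \<alpha>)"
  have one: "square_integrable M (\<lambda>_. 1 :: real)" by (simp add: square_integrable_def)
  have one_norm: "square_norm M (\<lambda>_. 1 :: real) = sqrt (\<beta> - \<alpha>)"
    using measure_space_M by (simp add: square_norm_def)
  note r = square_norm_indicator_sqrt[OF s]
  have icr: "integrable M (\<lambda>\<tau>. \<bar>?c \<tau>\<bar> * \<bar>?r \<tau>\<bar>)"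
    using square_integrable_mult[OF square_integrable_norm[OF c] square_integrable_norm[OF r(1)]] by simp
  have id: "integrable M (\<lambda>\<tau>. \<bar>?d \<tau>\<bar> * \<bar>1\<bar>)"
    using square_integrable_mult[OF square_integrable_norm[OF d] square_integrable_norm[OF one]] by simp
  have "norm (\<integral>\<tau>. f \<tau> \<partial>M) \<le> (\<integral>\<tau>. norm (f \<tau>) \<partial>M)" by (rule integral_norm_bound)
  also have "\<dots> \<le> (\<integral>\<tau>. m * (\<bar>?c \<tau>\<bar> * \<bar>?r \<tau>\<bar>) + \<bar>?d \<tau>\<bar> * \<bar>1\<bar> \<partial>M)"
  proof (rule integral_mono)
    show "integrable M (\<lambda>\<tau>. norm (f \<tau>))" using True by simp
    show "integrable M (\<lambda>\<tau>. m * (\<bar>?c \<tau>\<bar> * \<bar>?r \<tau>\<bar>) + \<bar>?d \<tau>\<bar> * \<bar>1\<bar>)"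
      by (rule Bochner_Integration.integrable_add[OF integrable_mult_right[OF icr] id])
    fix \<tau> assume "\<tau> \<in> space M"
    then have \<tau>: "\<tau> \<in> {\<alpha>..\<beta>}" by simp
    show "norm (f \<tau>) \<le> m * (\<bar>?c \<tau>\<bar> * \<bar>?r \<tau>\<bar>) + \<bar>?d \<tau>\<bar> * \<bar>1\<bar>"
    proof (cases "\<tau> \<le> s")
      case True
      then have \<tau>': "\<tau> \<in> {\<alpha>..s}" using \<tau> by simp
      have I: "indicator {..s} \<tau> = (1::real)" using True by simp
      show ?thesis unfolding I using f(1)[OF \<tau>'] nonneg[OF \<tau>'] \<tau> by (simp add: mult.commute mult.left_commute)
    next
      case False
      then show ?thesis using f(2)[of \<tau>] m by simp
    qed
  qed
  also have "\<dots> = m * (\<integral>\<tau>. \<bar>?c \<tau>\<bar> * \<bar>?r \<tau>\<bar> \<partial>M) + (\<integral>\<tau>. \<bar>?d \<tau>\<bar> * \<bar>1\<bar> \<partial>M)"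
    using icr id by simp
  also have "\<dots> \<le> m * (section_norm c s * ((\<beta> - \<alpha>) / sqrt 2)) + section_norm d s * sqrt (\<beta> - \<alpha>)"
  proof (intro add_mono mult_left_mono m)
    have "(\<integral>\<tau>. \<bar>?c \<tau>\<bar> * \<bar>?r \<tau>\<bar> \<partial>M) \<le> section_norm c s * ((s - \<alpha>) / sqrt 2)"
      using square_norm_Cauchy_Schwarz[OF c r(1)] by (simp only: section_norm_def r(2))
    also have "\<dots> \<le> section_norm c s * ((\<beta> - \<alpha>) / sqrt 2)"
      using s by (intro mult_left_mono divide_right_mono) auto
    finally show "(\<integral>\<tau>. \<bar>?c \<tau>\<bar> * \<bar>?r \<tau>\<bar> \<partial>M) \<le> section_norm c s * ((\<beta> - \<alpha>) / sqrt 2)" .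
    show "(\<integral>\<tau>. \<bar>?d \<tau>\<bar> * \<bar>1\<bar> \<partial>M) \<le> section_norm d s * sqrt (\<beta> - \<alpha>)"
      using square_norm_Cauchy_Schwarz[OF d one] by (simp only: section_norm_def one_norm)
  qed
  finally show ?thesis by (simp add: mult.commute mult.left_commute)
qed

end

section \<open>Reduction of the Volterra operator to pointwise coefficients\<close>

section \<open>The Volterra operator\<close>

definition bounded_section :: "real \<Rightarrow> (real \<Rightarrow> real \<Rightarrow> 'a::real_normed_vector \<Rightarrow> 'b::real_normed_vector) \<Rightarrow> nat \<Rightarrow> real \<Rightarrow> real \<Rightarrow> bool"
  where "bounded_section \<beta> w n l \<tau> \<longleftrightarrow> (\<forall>t\<in>{\<tau>..\<beta>}. \<forall>x. norm x \<le> real (Suc n) \<longrightarrow> norm (w t \<tau> x) \<le> l)"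

lemma ae_locally_bounded_sequence:
  assumes "ae_locally_bounded_in_x \<alpha> \<beta> w"
  shows "\<exists>l. \<forall>n. l n > 0 \<and> (AE \<tau>\<in>{\<alpha>..\<beta>} in lebesgue. bounded_section \<beta> w n (l n) \<tau>)"
proof -
  have "\<exists>l>0. (AE \<tau>\<in>{\<alpha>..\<beta>} in lebesgue. bounded_section \<beta> w n l \<tau>)" for n
    using assms[unfolded ae_locally_bounded_in_x_def, THEN spec, of "real (Suc n)"] by (simp add: bounded_section_def)
  then show ?thesis by metis
qed

context compact_interval
begin

text \<open>All conditions that hold for almost every \<tau>, among them countably many local
  bounds, fail only inside one measurable null set; \<open>G\<close> is its complement in
  [\<alpha>, \<beta>] and therefore measurable.\<close>

lemma good_parameters:
  fixes v :: "real \<Rightarrow> real \<Rightarrow> real^'n \<Rightarrow> real^'n"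
  assumes A1: "cond_A1 \<alpha> \<beta> v" and A2: "cond_A2 \<alpha> \<beta> v" and growth: "d_t_linear_growth \<alpha> \<beta> v c d"
  obtains G where "G \<in> sets lebesgue" "G \<subseteq> {\<alpha>..\<beta>}" "AE \<tau> in M. \<tau> \<in> G"
    "\<forall>\<tau>\<in>G. continuous_on ({\<tau>..\<beta>} \<times> UNIV) (\<lambda>(t, x). v t \<tau> x)"
    "\<forall>\<tau>\<in>G. \<forall>t\<in>{\<tau>..\<beta>}. \<forall>x. (\<lambda>s. v s \<tau> x) differentiable (at t within {\<tau>..\<beta>})"
    "\<forall>\<tau>\<in>G. continuous_on ({\<tau>..\<beta>} \<times> UNIV) (\<lambda>(t, x). d_t \<beta> v t \<tau> x)"
    "\<forall>\<tau>\<in>G. \<forall>t\<in>{\<tau>..\<beta>}. \<forall>x. (\<lambda>y. v t \<tau> y) differentiable (at x)"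
    "\<forall>\<tau>\<in>G. continuous_on ({\<tau>..\<beta>} \<times> UNIV) (\<lambda>(t, x). d_x v t \<tau> x)"
    "\<forall>\<tau>\<in>G. \<forall>t\<in>{\<tau>..\<beta>}. \<forall>x. (\<lambda>y. d_t \<beta> v t \<tau> y) differentiable (at x)"
    "\<forall>\<tau>\<in>G. continuous_on ({\<tau>..\<beta>} \<times> UNIV) (\<lambda>(t, x). d_tx \<beta> v t \<tau> x)"
    "\<forall>\<tau>\<in>G. \<forall>t\<in>{\<tau>..\<beta>}. \<forall>x. norm (d_t \<beta> v t \<tau> x) \<le> c (t, \<tau>) * norm x + d (t, \<tau>)"
    "\<forall>\<rho>. \<exists>l>0. \<forall>\<tau>\<in>G. \<forall>t\<in>{\<tau>..\<beta>}. \<forall>x. norm x \<le> \<rho> \<longrightarrow>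
      norm (v t \<tau> x) \<le> l \<and> norm (d_t \<beta> v t \<tau> x) \<le> l \<and> norm (d_x v t \<tau> x) \<le> l \<and> norm (d_tx \<beta> v t \<tau> x) \<le> l"
proof -
  obtain l1 where l1: "\<forall>n. l1 n > 0 \<and> (AE \<tau>\<in>{\<alpha>..\<beta>} in lebesgue. bounded_section \<beta> (d_t \<beta> v) n (l1 n) \<tau>)"
    using ae_locally_bounded_sequence[of \<alpha> \<beta> "d_t \<beta> v"] A2 unfolding cond_A2_def by blast
  obtain l2 where l2: "\<forall>n. l2 n > 0 \<and> (AE \<tau>\<in>{\<alpha>..\<beta>} in lebesgue. bounded_section \<beta> (d_x v) n (l2 n) \<tau>)"
    using ae_locally_bounded_sequence[of \<alpha> \<beta> "d_x v"] A2 unfolding cond_A2_def by blast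
  obtain l3 where l3: "\<forall>n. l3 n > 0 \<and> (AE \<tau>\<in>{\<alpha>..\<beta>} in lebesgue. bounded_section \<beta> (d_tx \<beta> v) n (l3 n) \<tau>)"
    using ae_locally_bounded_sequence[of \<alpha> \<beta> "d_tx \<beta> v"] A2 unfolding cond_A2_def by blast
  define Q1 where "Q1 \<tau> \<longleftrightarrow>
        continuous_on ({\<tau>..\<beta>} \<times> UNIV) (\<lambda>(t, x). v t \<tau> x) \<and>
        (\<forall>t\<in>{\<tau>..\<beta>}. \<forall>x. (\<lambda>s. v s \<tau> x) differentiable (at t within {\<tau>..\<beta>})) \<and>
        continuous_on ({\<tau>..\<beta>} \<times> UNIV) (\<lambda>(t, x). d_t \<beta> v t \<tau> x) \<and>
        (\<forall>t\<in>{\<tau>..\<beta>}. \<forall>x. (\<lambda>y. v t \<tau> y) differentiable (at x)) \<and>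
        continuous_on ({\<tau>..\<beta>} \<times> UNIV) (\<lambda>(t, x). d_x v t \<tau> x) \<and>
        (\<forall>t\<in>{\<tau>..\<beta>}. \<forall>x. (\<lambda>y. d_t \<beta> v t \<tau> y) differentiable (at x)) \<and>
        continuous_on ({\<tau>..\<beta>} \<times> UNIV) (\<lambda>(t, x). d_tx \<beta> v t \<tau> x)" for \<tau>
  define Q2 where "Q2 \<tau> \<longleftrightarrow> (\<forall>t\<in>{\<tau>..\<beta>}. \<forall>x. norm (d_t \<beta> v t \<tau> x) \<le> c (t, \<tau>) * norm x + d (t, \<tau>))" for \<tau>
  define Q3 where "Q3 \<tau> \<longleftrightarrow> (\<forall>n. bounded_section \<beta> (d_t \<beta> v) n (l1 n) \<tau>) \<and> (\<forall>n. bounded_section \<beta> (d_x v) n (l2 n) \<tau>) \<and> (\<forall>n. bounded_section \<beta> (d_tx \<beta> v) n (l3 n) \<tau>)" for \<tau>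
  have "AE \<tau> in M. Q1 \<tau>" using A1 unfolding cond_A1_def Q1_def AE_M_iff .
  moreover have "AE \<tau> in M. Q2 \<tau>" using growth unfolding d_t_linear_growth_def Q2_def AE_M_iff .
  moreover have "AE \<tau> in M. Q3 \<tau>"
  proof -
    have "AE \<tau> in M. \<forall>n. bounded_section \<beta> (d_t \<beta> v) n (l1 n) \<tau>" "AE \<tau> in M. \<forall>n. bounded_section \<beta> (d_x v) n (l2 n) \<tau>"
      "AE \<tau> in M. \<forall>n. bounded_section \<beta> (d_tx \<beta> v) n (l3 n) \<tau>"
      unfolding AE_all_countable AE_M_iff using l1 l2 l3 by simp_all
    then show ?thesis unfolding Q3_def by eventually_elim simp
  qed
  ultimately have "AE \<tau> in M. Q1 \<tau> \<and> Q2 \<tau> \<and> Q3 \<tau>" by eventually_elim simp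
  then have "AE \<tau> in lebesgue. \<tau> \<in> {\<alpha>..\<beta>} \<longrightarrow> Q1 \<tau> \<and> Q2 \<tau> \<and> Q3 \<tau>" by (simp only: AE_M_iff)
  then obtain Z where Z: "{\<tau> \<in> space lebesgue. \<not> (\<tau> \<in> {\<alpha>..\<beta>} \<longrightarrow> Q1 \<tau> \<and> Q2 \<tau> \<and> Q3 \<tau>)} \<subseteq> Z" "emeasure lebesgue Z = 0" "Z \<in> sets lebesgue"
    by (rule AE_E)
  define G where "G = {\<alpha>..\<beta>} - Z"
  have G_sets: "G \<in> sets lebesgue" unfolding G_def using Z(3) by (intro sets.Diff) auto
  have G_sub: "G \<subseteq> {\<alpha>..\<beta>}" by (auto simp: G_def)
  have Q: "Q1 \<tau>" "Q2 \<tau>" "Q3 \<tau>" if "\<tau> \<in> G" for \<tau> using that Z(1) by (auto simp: G_def)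
  have "AE \<tau> in lebesgue. \<tau> \<notin> Z" by (rule AE_not_in) (use Z in \<open>auto simp: null_sets_def\<close>)
  then have G_AE: "AE \<tau> in M. \<tau> \<in> G" unfolding AE_M_iff by eventually_elim (simp add: G_def)
  have bound: "\<exists>l>0. \<forall>\<tau>\<in>G. \<forall>t\<in>{\<tau>..\<beta>}. \<forall>x. norm x \<le> \<rho> \<longrightarrow>
      norm (v t \<tau> x) \<le> l \<and> norm (d_t \<beta> v t \<tau> x) \<le> l \<and> norm (d_x v t \<tau> x) \<le> l \<and> norm (d_tx \<beta> v t \<tau> x) \<le> l" for \<rho>
  proof -
    \<comment> \<open>The bounds for an arbitrary radius are read off at the next integer
      radius.\<close>
    obtain n :: nat where n: "\<rho> < real n" using reals_Archimedean2 by blast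
    have n': "\<rho> \<le> real (Suc n)" using n by simp
    have "locally_bounded_in_x \<alpha> \<beta> v" using A2 by (simp add: cond_A2_def)
    from this[unfolded locally_bounded_in_x_def, THEN spec, THEN mp, of "real (Suc n)"]
    have "\<exists>l>0. \<forall>(t, \<tau>)\<in>P_tri \<alpha> \<beta>. \<forall>x. norm x \<le> real (Suc n) \<longrightarrow> norm (v t \<tau> x) \<le> l" by simp
    then obtain l0 where l0: "l0 > 0 \<and> (\<forall>(t, \<tau>)\<in>P_tri \<alpha> \<beta>. \<forall>x. norm x \<le> real (Suc n) \<longrightarrow> norm (v t \<tau> x) \<le> l0)" by (rule exE)
    define l where "l = max l0 (max (l1 n) (max (l2 n) (l3 n)))"
    show ?thesis
    proof (intro exI[of _ l] conjI ballI allI impI)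
      show "l > 0" using l0 by (simp add: l_def less_max_iff_disj)
      fix \<tau> t x assume \<tau>: "\<tau> \<in> G" and t: "t \<in> {\<tau>..\<beta>}" and x: "norm (x :: real^'n) \<le> \<rho>"
      have x': "norm x \<le> real (Suc n)" using x n' by simp
      have "(t, \<tau>) \<in> P_tri \<alpha> \<beta>" using \<tau> t G_sub by (auto simp: P_tri_def)
      then have "norm (v t \<tau> x) \<le> l0" using l0[THEN conjunct2, THEN bspec, of "(t, \<tau>)"] x' by simp
      then show "norm (v t \<tau> x) \<le> l" by (simp add: l_def)
      note q3 = Q(3)[OF \<tau>, unfolded Q3_def]
      have "norm (d_t \<beta> v t \<tau> x) \<le> l1 n"
        using q3[THEN conjunct1, THEN spec, of n, unfolded bounded_section_def, THEN bspec, OF t] x' by blast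
      then show "norm (d_t \<beta> v t \<tau> x) \<le> l" by (simp add: l_def)
      have "norm (d_x v t \<tau> x) \<le> l2 n"
        using q3[THEN conjunct2, THEN conjunct1, THEN spec, of n, unfolded bounded_section_def, THEN bspec, OF t] x' by blast
      then show "norm (d_x v t \<tau> x) \<le> l" by (simp add: l_def)
      have "norm (d_tx \<beta> v t \<tau> x) \<le> l3 n"
        using q3[THEN conjunct2, THEN conjunct2, THEN spec, of n, unfolded bounded_section_def, THEN bspec, OF t] x' by blast
      then show "norm (d_tx \<beta> v t \<tau> x) \<le> l" by (simp add: l_def)
    qed
  qed
  show thesis
    by (rule that[OF G_sets G_sub G_AE _ _ _ _ _ _ _ _ allI[OF bound]])
      (use Q(1,2) in \<open>simp_all add: Q1_def Q2_def\<close>)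
qed

text \<open>For fixed \<tau> in \<open>G\<close> and \<tau> \<le> t, the fundamental theorem of
  calculus writes \<open>v t \<tau> (x \<tau>)\<close> as the diagonal value at \<tau> plus the
  integral of \<open>d_t \<beta> v\<close> over [\<tau>, t]. After integration in \<tau>, Fubini
  makes s the outer variable, and everything is one integral over [\<alpha>, t].\<close>

lemma volterra_eq_primitive:
  fixes v :: "real \<Rightarrow> real \<Rightarrow> real^'n \<Rightarrow> real^'n"
  assumes G: "G \<subseteq> {\<alpha>..\<beta>}" "AE \<tau> in M. \<tau> \<in> G"
    and diff: "\<And>\<tau> t x. \<tau> \<in> G \<Longrightarrow> t \<in> {\<tau>..\<beta>} \<Longrightarrow> (\<lambda>s. v s \<tau> x) differentiable (at t within {\<tau>..\<beta>})"
    and cont: "\<And>\<tau>. \<tau> \<in> G \<Longrightarrow> continuous_on ({\<tau>..\<beta>} \<times> UNIV) (\<lambda>(t, x). d_t \<beta> v t \<tau> x)"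
    and a: "a = (\<lambda>s. if s \<in> G then v s s (x s) else 0)" "integrable M a"
    and b: "b = (\<lambda>s \<tau>. if \<tau> \<in> G \<and> \<tau> \<le> s \<and> s \<le> \<beta> then d_t \<beta> v s \<tau> (x \<tau>) else 0)"
      "integrable (M \<Otimes>\<^sub>M M) (\<lambda>(s, \<tau>). b s \<tau>)"
    and t: "t \<in> {\<alpha>..\<beta>}"
  shows "(LINT \<tau>:{\<alpha>..t}|lebesgue. v t \<tau> (x \<tau>)) = primitive (\<lambda>s. a s + (\<integral>\<tau>. b s \<tau> \<partial>M)) t"
proof -
  define I where "I s = (indicator {..t} s :: real)" for s
  have Im: "I \<in> borel_measurable M" unfolding I_def by (rule borel_measurable_indicator_M) simp
  have bt: "integrable (M \<Otimes>\<^sub>M M) (\<lambda>(s, \<tau>). I s *\<^sub>R b s \<tau>)"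
  proof (rule Bochner_Integration.integrable_bound[OF b(2)])
    have "(\<lambda>z. I (fst z) *\<^sub>R (case z of (s, \<tau>) \<Rightarrow> b s \<tau>)) \<in> borel_measurable (M \<Otimes>\<^sub>M M)"
      using b(2) by (intro borel_measurable_scaleR measurable_compose[OF measurable_fst Im]) auto
    then show "(\<lambda>(s, \<tau>). I s *\<^sub>R b s \<tau>) \<in> borel_measurable (M \<Otimes>\<^sub>M M)" by (simp add: case_prod_beta')
  qed (auto simp: I_def indicator_def)
  have ftc: "(\<integral>s. I s *\<^sub>R b s \<tau> \<partial>M) = I \<tau> *\<^sub>R (v t \<tau> (x \<tau>) - a \<tau>)" if \<tau>: "\<tau> \<in> G" for \<tau>
  proof (cases "\<tau> \<le> t")
    case True
    have "(\<integral>s. I s *\<^sub>R b s \<tau> \<partial>M) = (\<integral>s. indicator {\<tau>..t} s *\<^sub>R d_t \<beta> v s \<tau> (x \<tau>) \<partial>M)"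
      using \<tau> t by (intro Bochner_Integration.integral_cong) (auto simp: I_def b(1) indicator_def)
    also have "\<dots> = v t \<tau> (x \<tau>) - v \<tau> \<tau> (x \<tau>)"
    proof (rule integral_M_FTC)
      show "\<alpha> \<le> \<tau>" "\<tau> \<le> t" "t \<le> \<beta>" using True \<tau> t G by auto
      show "((\<lambda>s. v s \<tau> (x \<tau>)) has_vector_derivative d_t \<beta> v s \<tau> (x \<tau>)) (at s within {\<tau>..t})" if "s \<in> {\<tau>..t}" for s
      proof -
        have s: "s \<in> {\<tau>..\<beta>}" using that t by auto
        have "((\<lambda>s. v s \<tau> (x \<tau>)) has_vector_derivative d_t \<beta> v s \<tau> (x \<tau>)) (at s within {\<tau>..\<beta>})"
          unfolding d_t_def using diff[OF \<tau> s] by (simp add: vector_derivative_works)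
        then show ?thesis by (rule has_vector_derivative_within_subset) (use t in auto)
      qed
      show "continuous_on {\<tau>..t} (\<lambda>s. d_t \<beta> v s \<tau> (x \<tau>))"
      proof -
        have "continuous_on {\<tau>..t} (\<lambda>s. (\<lambda>(t, x). d_t \<beta> v t \<tau> x) (s, x \<tau>))"
          by (rule continuous_on_compose2[OF cont[OF \<tau>]]) (use t in \<open>auto intro!: continuous_intros\<close>)
        then show ?thesis by simp
      qed
    qed
    finally show ?thesis using True \<tau> by (simp add: I_def a(1))
  next
    case False
    then have "(\<lambda>s. I s *\<^sub>R b s \<tau>) = (\<lambda>s. 0)" by (auto simp: I_def b(1) indicator_def)
    then show ?thesis using False by (simp add: I_def)
  qed
  have Ia: "integrable M (\<lambda>s. I s *\<^sub>R a s)" unfolding I_def by (rule integrable_indicator_scaleR[OF a(2)]) simp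
  have ib1: "integrable M (\<lambda>\<tau>. \<integral>s. I s *\<^sub>R b s \<tau> \<partial>M)" by (rule pair.integrable_snd[OF bt])
  have ib2: "integrable M (\<lambda>s. \<integral>\<tau>. I s *\<^sub>R b s \<tau> \<partial>M)" by (rule pair.integrable_fst[OF bt])
  have ae: "AE \<tau> in M. I \<tau> *\<^sub>R a \<tau> + (\<integral>s. I s *\<^sub>R b s \<tau> \<partial>M) = I \<tau> *\<^sub>R v t \<tau> (x \<tau>)"
    using G(2) by eventually_elim (simp add: ftc scaleR_diff_right)
  have m: "(\<lambda>\<tau>. I \<tau> *\<^sub>R a \<tau> + (\<integral>s. I s *\<^sub>R b s \<tau> \<partial>M)) \<in> borel_measurable M"
    using Ia ib1 by (intro borel_measurable_add borel_measurable_integrable)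
  \<comment> \<open>The original integrand is measurable by completeness, since it agrees almost
    everywhere with a function already known to be measurable.\<close>
  have m': "(\<lambda>\<tau>. I \<tau> *\<^sub>R v t \<tau> (x \<tau>)) \<in> borel_measurable M"
    by (rule borel_measurable_lebesgue_on_cong_AE[OF _ m ae]) simp
  have "(LINT \<tau>:{\<alpha>..t}|lebesgue. v t \<tau> (x \<tau>)) = (\<integral>\<tau>. I \<tau> *\<^sub>R v t \<tau> (x \<tau>) \<partial>M)"
    unfolding I_def by (rule set_integral_eq) (use t in simp)
  also have "\<dots> = (\<integral>\<tau>. I \<tau> *\<^sub>R a \<tau> + (\<integral>s. I s *\<^sub>R b s \<tau> \<partial>M) \<partial>M)"
    by (rule integral_cong_AE[OF m' m]) (use ae in \<open>eventually_elim; simp\<close>)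
  also have "\<dots> = (\<integral>\<tau>. I \<tau> *\<^sub>R a \<tau> \<partial>M) + (\<integral>\<tau>. \<integral>s. I s *\<^sub>R b s \<tau> \<partial>M \<partial>M)"
    by (rule Bochner_Integration.integral_add[OF Ia ib1])
  also have "(\<integral>\<tau>. \<integral>s. I s *\<^sub>R b s \<tau> \<partial>M \<partial>M) = (\<integral>s. \<integral>\<tau>. I s *\<^sub>R b s \<tau> \<partial>M \<partial>M)"
    by (rule pair.Fubini_integral[OF bt])
  also have "(\<integral>\<tau>. I \<tau> *\<^sub>R a \<tau> \<partial>M) + \<dots> = (\<integral>s. I s *\<^sub>R a s + (\<integral>\<tau>. I s *\<^sub>R b s \<tau> \<partial>M) \<partial>M)"
    by (rule Bochner_Integration.integral_add[OF Ia ib2, symmetric])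
  also have "\<dots> = (\<integral>s. I s *\<^sub>R (a s + (\<integral>\<tau>. b s \<tau> \<partial>M)) \<partial>M)"
    by (simp add: scaleR_add_right)
  finally show ?thesis using t by (simp add: primitive_def I_def)
qed

end

text \<open>Every clause of \<open>diffeomorphism_in\<close> evaluates the operator at points of X
  only; closure under sums is what keeps x + h among them.\<close>

lemma diffeomorphism_in_cong:
  assumes "diffeomorphism_in X N V" and eq: "\<And>x. x \<in> X \<Longrightarrow> V' x = V x"
    and add: "\<And>x h. x \<in> X \<Longrightarrow> h \<in> X \<Longrightarrow> (\<lambda>r. x r + h r) \<in> X"
  shows "diffeomorphism_in X N V'"
proof -
  obtain W where im: "V ` X = X" and W: "\<forall>y\<in>X. W y \<in> X" "\<forall>x\<in>X. W (V x) = x" "\<forall>y\<in>X. V (W y) = y"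
    "\<forall>x\<in>X. frechet_differentiable_in X N V x" "\<forall>y\<in>X. frechet_differentiable_in X N W y"
    using assms(1) unfolding diffeomorphism_in_def by blast
  have "frechet_differentiable_in X N V' x" if x: "x \<in> X" for x
  proof -
    have eq1: "V' (\<lambda>r. x r + h r) = V (\<lambda>r. x r + h r)" if "h \<in> X" for h
      by (rule eq[OF add[OF x that]])
    have "frechet_differentiable_in X N V x" using W(4) x by blast
    then show ?thesis unfolding frechet_differentiable_in_def by (simp add: eq[OF x] eq1 cong: ball_cong)
  qed
  moreover have "V' ` X = X" using im eq by (simp cong: image_cong)
  ultimately show ?thesis
    unfolding diffeomorphism_in_def using W eq by (intro conjI exI[of _ W]) auto
qed

theorem theorem4p2:
  fixes \<alpha> \<beta> :: real and v :: "real \<Rightarrow> real \<Rightarrow> real^'n \<Rightarrow> real^'n"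
  assumes "\<alpha> < \<beta>"
    and "cond_A1 \<alpha> \<beta> v"
    and "cond_A2 \<alpha> \<beta> v"
    and "cond_A3 \<alpha> \<beta> v \<or> cond_A4 \<alpha> \<beta> v"
  shows "diffeomorphism_in (AC02 \<alpha> \<beta>) (AC02_norm \<alpha> \<beta>) (volterra \<alpha> \<beta> v)"
proof -
  interpret compact_interval \<alpha> \<beta> by unfold_locales (rule assms(1))
  have "cond_A4 \<alpha> \<beta> v" using assms(4) cond_A3_imp_cond_A4 by blast
  then obtain c1 d1 c2 d2 where c1: "c1 \<in> L2_nonneg {\<alpha>..\<beta>}" and d1: "d1 \<in> L2_nonneg {\<alpha>..\<beta>}"
    and c2: "c2 \<in> L2_nonneg (P_tri \<alpha> \<beta>)" and d2: "d2 \<in> L2_nonneg (P_tri \<alpha> \<beta>)"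
    and diag: "\<forall>t\<in>{\<alpha>..\<beta>}. \<forall>x. norm (v t t x) \<le> c1 t * norm x + d1 t"
    and growth: "d_t_linear_growth \<alpha> \<beta> v c2 d2" and small: "L2_norm {\<alpha>..\<beta>} (c_tilde \<alpha> \<beta> c1 c2) < 1 / 2"
    unfolding cond_A4_def by blast
  have meas: "measurable_in_tau \<alpha> \<beta> v" "measurable_in_tau \<alpha> \<beta> (d_t \<beta> v)"
    "measurable_in_tau \<alpha> \<beta> (d_x v)" "measurable_in_tau \<alpha> \<beta> (d_tx \<beta> v)"
    using assms(3) by (simp_all add: cond_A2_def)
  obtain G where G: "G \<in> sets lebesgue" "G \<subseteq> {\<alpha>..\<beta>}" "AE \<tau> in M. \<tau> \<in> G"
    and v_cont': "\<forall>\<tau>\<in>G. continuous_on ({\<tau>..\<beta>} \<times> UNIV) (\<lambda>(t, x). v t \<tau> x)"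
    and v_diff_t': "\<forall>\<tau>\<in>G. \<forall>t\<in>{\<tau>..\<beta>}. \<forall>x. (\<lambda>s. v s \<tau> x) differentiable (at t within {\<tau>..\<beta>})"
    and vt_cont': "\<forall>\<tau>\<in>G. continuous_on ({\<tau>..\<beta>} \<times> UNIV) (\<lambda>(t, x). d_t \<beta> v t \<tau> x)"
    and v_diff_x': "\<forall>\<tau>\<in>G. \<forall>t\<in>{\<tau>..\<beta>}. \<forall>x. (\<lambda>y. v t \<tau> y) differentiable (at x)"
    and vx_cont': "\<forall>\<tau>\<in>G. continuous_on ({\<tau>..\<beta>} \<times> UNIV) (\<lambda>(t, x). d_x v t \<tau> x)"
    and vt_diff_x': "\<forall>\<tau>\<in>G. \<forall>t\<in>{\<tau>..\<beta>}. \<forall>x. (\<lambda>y. d_t \<beta> v t \<tau> y) differentiable (at x)"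
    and vtx_cont': "\<forall>\<tau>\<in>G. continuous_on ({\<tau>..\<beta>} \<times> UNIV) (\<lambda>(t, x). d_tx \<beta> v t \<tau> x)"
    and vt_growth': "\<forall>\<tau>\<in>G. \<forall>t\<in>{\<tau>..\<beta>}. \<forall>x. norm (d_t \<beta> v t \<tau> x) \<le> c2 (t, \<tau>) * norm x + d2 (t, \<tau>)"
    and v_bound': "\<forall>\<rho>. \<exists>l>0. \<forall>\<tau>\<in>G. \<forall>t\<in>{\<tau>..\<beta>}. \<forall>x. norm x \<le> \<rho> \<longrightarrow>
      norm (v t \<tau> x) \<le> l \<and> norm (d_t \<beta> v t \<tau> x) \<le> l \<and> norm (d_x v t \<tau> x) \<le> l \<and> norm (d_tx \<beta> v t \<tau> x) \<le> l"
    by (rule good_parameters[OF assms(2,3) growth])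
  note v_cont = v_cont'[rule_format]
  note v_diff_t = v_diff_t'[rule_format]
  note vt_cont = vt_cont'[rule_format]
  note v_diff_x = v_diff_x'[rule_format]
  note vx_cont = vx_cont'[rule_format]
  note vt_diff_x = vt_diff_x'[rule_format]
  note vtx_cont = vtx_cont'[rule_format]
  note vt_growth = vt_growth'[rule_format]
  note v_bound = v_bound'[THEN spec]
  \<comment> \<open>The coefficients vanish off \<open>G\<close> and above the diagonal, so the
    locale assumptions hold for all parameters; on the triangle this changes \<open>v\<close> and
    \<open>d_t\<close> only for a null set of \<tau>.\<close>
  define a where "a s x = (if s \<in> G then v s s x else 0)" for s x
  define b where "b s \<tau> x = (if \<tau> \<in> G \<and> \<tau> \<le> s \<and> s \<le> \<beta> then d_t \<beta> v s \<tau> x else 0)" for s \<tau> x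
  define a' where "a' s x h = (if s \<in> G then d_x v s s x *v h else 0)" for s x h
  define b' where "b' s \<tau> x h = (if \<tau> \<in> G \<and> \<tau> \<le> s \<and> s \<le> \<beta> then d_tx \<beta> v s \<tau> x *v h else 0)" for s \<tau> x h
  \<comment> \<open>The additive part of the growth bound: \<open>d1\<close> from the diagonal and,
    by Cauchy-Schwarz against 1, the section norm of \<open>d2\<close>.\<close>
  define Dc where "Dc s = d1 s + sqrt (\<beta> - \<alpha>) * section_norm d2 s" for s
  have G_le: "s \<le> \<beta>" if "s \<in> G" for s using that G(2) by auto
  have idb: "(\<lambda>s. s) \<in> borel_measurable M" by (intro measurable_restrict_space1 measurable_completion) simp
  \<comment> \<open>For the diagonal terms, p and \<sigma> are both the identity on
    [\<alpha>, \<beta>]; for the kernel below they are the two projections of the square.\<close>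
  note diag_meas = caratheodory_measurable[OF _ G(1,2) _ measurable_id_M idb]
  have sndM: "snd \<in> M \<Otimes>\<^sub>M M \<rightarrow>\<^sub>M lebesgue" by (rule measurable_compose[OF measurable_snd measurable_id_M])
  have fstM: "fst \<in> borel_measurable (M \<Otimes>\<^sub>M M)" by (rule measurable_compose[OF measurable_fst idb])
  note pair_meas = caratheodory_measurable[OF _ G(1,2) _ sndM fstM]
  have sndx: "(\<lambda>z. x (snd z)) \<in> borel_measurable (M \<Otimes>\<^sub>M M)" if "x \<in> borel_measurable M" for x :: "real \<Rightarrow> real^'n"
    by (rule measurable_compose[OF measurable_snd that])
  have a_meas: "(\<lambda>s. a s (x s)) \<in> borel_measurable M" if x: "x \<in> borel_measurable M" for x
    using diag_meas[OF meas(1) v_cont x] G_le by (simp add: a_def cong: if_cong conj_cong)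
  have b_meas: "(\<lambda>(s, \<tau>). b s \<tau> (x \<tau>)) \<in> borel_measurable (M \<Otimes>\<^sub>M M)" if x: "x \<in> borel_measurable M" for x
    using pair_meas[OF meas(2) vt_cont sndx[OF x]] by (simp add: b_def case_prod_beta')
  have a'_meas: "(\<lambda>s. a' s (x s) (h s)) \<in> borel_measurable M" if x: "x \<in> borel_measurable M" and h: "h \<in> borel_measurable M" for x h
  proof -
    have "(\<lambda>s. (if s \<in> G \<and> s \<le> s \<and> s \<le> \<beta> then d_x v s s (x s) else 0) *v h s) \<in> borel_measurable M"
      by (rule borel_measurable_continuous_Pair[OF diag_meas[OF meas(3) vx_cont x] h continuous_on_matrix_vector_mult])
    also have "(\<lambda>s. (if s \<in> G \<and> s \<le> s \<and> s \<le> \<beta> then d_x v s s (x s) else 0) *v h s) = (\<lambda>s. a' s (x s) (h s))"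
      using G_le by (auto simp: a'_def fun_eq_iff)
    finally show ?thesis .
  qed
  have b'_meas: "(\<lambda>(s, \<tau>). b' s \<tau> (x \<tau>) (h \<tau>)) \<in> borel_measurable (M \<Otimes>\<^sub>M M)" if x: "x \<in> borel_measurable M" and h: "h \<in> borel_measurable M" for x h
  proof -
    have "(\<lambda>z. (if snd z \<in> G \<and> snd z \<le> fst z \<and> fst z \<le> \<beta> then d_tx \<beta> v (fst z) (snd z) (x (snd z)) else 0) *v h (snd z)) \<in> borel_measurable (M \<Otimes>\<^sub>M M)"
      by (rule borel_measurable_continuous_Pair[OF pair_meas[OF meas(4) vtx_cont sndx[OF x]] sndx[OF h] continuous_on_matrix_vector_mult])
    also have "(\<lambda>z. (if snd z \<in> G \<and> snd z \<le> fst z \<and> fst z \<le> \<beta> then d_tx \<beta> v (fst z) (snd z) (x (snd z)) else 0) *v h (snd z)) =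
        (\<lambda>(s, \<tau>). b' s \<tau> (x \<tau>) (h \<tau>))"
      by (auto simp: b'_def fun_eq_iff)
    finally show ?thesis .
  qed
  have sq_c1: "square_integrable M c1" and sq_d1: "square_integrable M d1"
    using c1 d1 by (simp_all add: L2_nonneg_def mem_L2_iff)
  have sq_Dc: "square_integrable M Dc"
    unfolding Dc_def
    using square_integrable_add(1)[OF sq_d1 square_integrable_scaleR(1)[OF L2_triangle_sections(2)[OF d2], of "sqrt (\<beta> - \<alpha>)"]] by simp
  let ?ct = "c_tilde \<alpha> \<beta> c1 c2"
  \<comment> \<open>The weight sqrt(s - \<alpha>) is at most sqrt(\<beta> - \<alpha>), so both
    summands of \<open>c_tilde\<close> are square integrable.\<close>
  have sq_ct: "square_integrable M ?ct"
  proof -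
    have sm: "(\<lambda>s. sqrt (s - \<alpha>)) \<in> borel_measurable M" by (intro measurable_restrict_space1 measurable_completion) simp
    have "square_integrable M (\<lambda>s. sqrt (s - \<alpha>) * c1 s)"
    proof (rule square_norm_mono(1)[OF square_integrable_scaleR(1)[OF sq_c1, of "sqrt (\<beta> - \<alpha>)"]])
      show "AE s in M. norm (sqrt (s - \<alpha>) * c1 s) \<le> norm (sqrt (\<beta> - \<alpha>) *\<^sub>R c1 s)"
        by (rule AE_I2) (auto simp: abs_mult intro!: mult_right_mono)
      show "(\<lambda>s. sqrt (s - \<alpha>) * c1 s) \<in> borel_measurable M"
        by (intro borel_measurable_times sm square_integrable_measurable[OF sq_c1])
    qed
    then have "square_integrable M (\<lambda>s. sqrt (s - \<alpha>) * c1 s + (\<beta> - \<alpha>) / sqrt 2 * section_norm c2 s)"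
      using square_integrable_add(1)[OF _ square_integrable_scaleR(1)[OF L2_triangle_sections(2)[OF c2], of "(\<beta> - \<alpha>) / sqrt 2"]] by simp
    then show ?thesis by (subst square_norm_cong(2)[OF c_tilde_eq])
  qed
  interpret volterra_coefficients \<alpha> \<beta> a b a' b' "square_norm M ?ct" "square_norm M Dc"
  proof unfold_locales
    fix \<rho>
    obtain l where l: "l > 0 \<and> (\<forall>\<tau>\<in>G. \<forall>t\<in>{\<tau>..\<beta>}. \<forall>x. norm x \<le> \<rho> \<longrightarrow>
      norm (v t \<tau> x) \<le> l \<and> norm (d_t \<beta> v t \<tau> x) \<le> l \<and> norm (d_x v t \<tau> x) \<le> l \<and> norm (d_tx \<beta> v t \<tau> x) \<le> l)"
      by (rule exE[OF v_bound[of \<rho>]])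
    have l0: "l > 0" using l by simp
    have lv: "norm (v t \<tau> x) \<le> l" "norm (d_t \<beta> v t \<tau> x) \<le> l" "norm (d_x v t \<tau> x *v h) \<le> l * norm h"
        "norm (d_tx \<beta> v t \<tau> x *v h) \<le> l * norm h"
      if "\<tau> \<in> G" "\<tau> \<le> t" "t \<le> \<beta>" "norm x \<le> \<rho>" for t \<tau> x h
    proof -
      have "norm (v t \<tau> x) \<le> l \<and> norm (d_t \<beta> v t \<tau> x) \<le> l \<and> norm (d_x v t \<tau> x) \<le> l \<and> norm (d_tx \<beta> v t \<tau> x) \<le> l"
        using l[THEN conjunct2, THEN bspec, OF that(1), THEN bspec, of t] that by simp
      then show "norm (v t \<tau> x) \<le> l" "norm (d_t \<beta> v t \<tau> x) \<le> l" "norm (d_x v t \<tau> x *v h) \<le> l * norm h"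
        "norm (d_tx \<beta> v t \<tau> x *v h) \<le> l * norm h"
        by (simp_all add: order_trans[OF norm_matrix_vector_mult_le mult_right_mono[OF _ norm_ge_zero]])
    qed
    show "\<exists>l>0. \<forall>s\<in>{\<alpha>..\<beta>}. \<forall>\<tau>\<in>{\<alpha>..\<beta>}. \<forall>x. norm x \<le> \<rho> \<longrightarrow> norm (a s x) \<le> l \<and> norm (b s \<tau> x) \<le> l \<and>
        (\<forall>h. norm (a' s x h) \<le> l * norm h) \<and> (\<forall>h. norm (b' s \<tau> x h) \<le> l * norm h)"
    proof (intro exI[of _ l] conjI l0 ballI allI impI)
      fix s \<tau> x h assume x: "norm (x :: real^'n) \<le> \<rho>"
      show "norm (a s x) \<le> l" using lv(1)[OF _ order_refl G_le x] l0 by (simp add: a_def)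
      show "norm (a' s x h) \<le> l * norm h" using lv(3)[OF _ order_refl G_le x] l0 by (simp add: a'_def)
      show "norm (b s \<tau> x) \<le> l" using lv(2)[OF _ _ _ x] l0 by (simp add: b_def)
      show "norm (b' s \<tau> x h) \<le> l * norm h" using lv(4)[OF _ _ _ x] l0 by (simp add: b'_def)
    qed
  next
    fix s z assume "s \<in> {\<alpha>..\<beta>}"
    show "(a s has_derivative a' s z) (at z)"
    proof (cases "s \<in> G")
      case True
      then show ?thesis unfolding a_def a'_def
        using has_derivative_d_x[of v s s z, OF v_diff_x[OF True]] G_le[OF True] True by simp
    qed (simp add: a_def[abs_def] a'_def[abs_def])
  next
    fix s \<tau> z
    show "(b s \<tau> has_derivative b' s \<tau> z) (at z)"
    proof (cases "\<tau> \<in> G \<and> \<tau> \<le> s \<and> s \<le> \<beta>")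
      case True
      then have "((\<lambda>y. d_t \<beta> v s \<tau> y) has_derivative (\<lambda>h. d_x (d_t \<beta> v) s \<tau> z *v h)) (at z)"
        by (intro has_derivative_d_x vt_diff_x) auto
      then show ?thesis using True by (simp add: b_def[abs_def] b'_def[abs_def] d_tx_def)
    next
      case False
      then have "b s \<tau> = (\<lambda>_. 0)" "b' s \<tau> z = (\<lambda>_. 0)" by (auto simp: b_def b'_def fun_eq_iff)
      then show ?thesis by simp
    qed
  next
    show "square_norm M ?ct < 1" using small by (simp add: L2_norm_eq)
  next
    fix x :: "real \<Rightarrow> real^'n" and m
    assume x: "x \<in> borel_measurable M" and m: "m \<ge> 0" and xm: "\<And>\<tau>. \<tau> \<in> {\<alpha>..\<beta>} \<Longrightarrow> norm (x \<tau>) \<le> sqrt (\<tau> - \<alpha>) * m"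
    let ?I = "\<lambda>s. a s (x s) + (\<integral>\<tau>. b s \<tau> (x \<tau>) \<partial>M)"
    have c1_nonneg: "c1 s \<ge> 0" and d1_nonneg: "d1 s \<ge> 0" if "s \<in> {\<alpha>..\<beta>}" for s
      using c1 d1 that by (auto simp: L2_nonneg_def)
    have cd2_nonneg: "c2 (s, \<tau>) \<ge> 0" "d2 (s, \<tau>) \<ge> 0" if "s \<in> {\<alpha>..\<beta>}" "\<tau> \<in> {\<alpha>..s}" for s \<tau>
      using c2 d2 that by (auto simp: L2_nonneg_def P_tri_def)
    \<comment> \<open>Claimed only where the sections of \<open>c2\<close> and \<open>d2\<close> are
      square integrable, which by Fubini is almost everywhere.\<close>
    have pointwise: "norm (?I s) \<le> m * ?ct s + Dc s"
      if s: "s \<in> {\<alpha>..\<beta>}" and sec: "square_integrable M (\<lambda>\<tau>. indicator {..s} \<tau> * c2 (s, \<tau>))"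
        "square_integrable M (\<lambda>\<tau>. indicator {..s} \<tau> * d2 (s, \<tau>))" for s
    proof -
      have "norm (a s (x s)) \<le> c1 s * (sqrt (s - \<alpha>) * m) + d1 s"
      proof -
        have "norm (a s (x s)) \<le> c1 s * norm (x s) + d1 s"
          using diag s c1_nonneg[OF s] d1_nonneg[OF s] by (simp add: a_def)
        also have "c1 s * norm (x s) \<le> c1 s * (sqrt (s - \<alpha>) * m)"
          by (rule mult_left_mono[OF xm[OF s] c1_nonneg[OF s]])
        finally show ?thesis by simp
      qed
      moreover have "norm (\<integral>\<tau>. b s \<tau> (x \<tau>) \<partial>M) \<le> (\<beta> - \<alpha>) / sqrt 2 * section_norm c2 s * m + sqrt (\<beta> - \<alpha>) * section_norm d2 s"
      proof (rule norm_integral_le_section_norm[OF s m sec cd2_nonneg[OF s]])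
        fix \<tau> assume \<tau>: "\<tau> \<in> {\<alpha>..s}"
        then have \<tau>': "\<tau> \<in> {\<alpha>..\<beta>}" using s by auto
        have "norm (b s \<tau> (x \<tau>)) \<le> c2 (s, \<tau>) * norm (x \<tau>) + d2 (s, \<tau>)"
          using vt_growth[of \<tau> s "x \<tau>"] cd2_nonneg[OF s \<tau>] by (simp add: b_def)
        also have "c2 (s, \<tau>) * norm (x \<tau>) \<le> c2 (s, \<tau>) * (sqrt (\<tau> - \<alpha>) * m)"
          by (rule mult_left_mono[OF xm[OF \<tau>'] cd2_nonneg(1)[OF s \<tau>]])
        finally show "norm (b s \<tau> (x \<tau>)) \<le> c2 (s, \<tau>) * (sqrt (\<tau> - \<alpha>) * m) + d2 (s, \<tau>)" by simp
      qed (simp_all add: b_def)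
      ultimately have "norm (?I s) \<le> (c1 s * (sqrt (s - \<alpha>) * m) + d1 s) +
          ((\<beta> - \<alpha>) / sqrt 2 * section_norm c2 s * m + sqrt (\<beta> - \<alpha>) * section_norm d2 s)"
        by (intro order_trans[OF norm_triangle_ineq add_mono])
      also have "\<dots> = m * ?ct s + Dc s" unfolding c_tilde_eq[OF s] Dc_def by (simp add: algebra_simps)
      finally show ?thesis .
    qed
    have Im: "?I \<in> borel_measurable M"
      by (intro borel_measurable_add a_meas[OF x] borel_measurable_lebesgue_integral b_meas[OF x])
    have ae: "AE s in M. norm (?I s) \<le> norm (m *\<^sub>R ?ct s + Dc s)"
    proof -
      have "AE s in M. s \<in> {\<alpha>..\<beta>}" by (rule AE_I2) simp
      with L2_triangle_sections(1)[OF c2] L2_triangle_sections(1)[OF d2] show ?thesis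
      proof eventually_elim
        case (elim s)
        have "norm (?I s) \<le> m * ?ct s + Dc s" by (rule pointwise[OF elim(3,1,2)])
        also have "\<dots> \<le> norm (m *\<^sub>R ?ct s + Dc s)" by simp
        finally show ?case .
      qed
    qed
    have "square_norm M ?I \<le> square_norm M (\<lambda>s. m *\<^sub>R ?ct s + Dc s)"
      by (rule square_norm_mono(2)[OF square_integrable_add(1)[OF square_integrable_scaleR(1)[OF sq_ct] sq_Dc] ae Im])
    also have "\<dots> \<le> square_norm M (\<lambda>s. m *\<^sub>R ?ct s) + square_norm M Dc"
      by (rule square_integrable_add(2)[OF square_integrable_scaleR(1)[OF sq_ct] sq_Dc])
    also have "square_norm M (\<lambda>s. m *\<^sub>R ?ct s) = square_norm M ?ct * m"
      using square_integrable_scaleR(2)[OF sq_ct, of m] m by simp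
    finally show "square_norm M ?I \<le> square_norm M ?ct * m + square_norm M Dc" .
  qed (use a_meas b_meas a'_meas b'_meas in \<open>simp_all add: b_def b'_def\<close>)
  \<comment> \<open>Off [\<alpha>, \<beta>] both sides are 0. Inside, x is bounded, so the
    coefficients along x are bounded and hence integrable on the finite measure spaces, as the
    integral formula requires.\<close>
  have eq: "volterra \<alpha> \<beta> v x = V x" if x: "x \<in> AC02 \<alpha> \<beta>" for x
  proof
    fix t
    show "volterra \<alpha> \<beta> v x t = V x t"
    proof (cases "t \<in> {\<alpha>..\<beta>}")
      case False
      then show ?thesis using AC02_outside[OF x False] by (auto simp: volterra_def V_def primitive_def)
    next
      case True
      note xm = AC02_measurable[OF x]
      define B where "B = local_bound (sqrt (\<beta> - \<alpha>) * N x)"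
      have "integrable M (\<lambda>s. a s (x s))"
        by (rule integrable_bounded_M[OF a_meas[OF xm]]) (rule local_bound(2)[OF _ AC02_norm_le'[OF x]]; assumption)
      then have ai: "integrable M (\<lambda>s. if s \<in> G then v s s (x s) else 0)" by (simp add: a_def)
      have bi: "integrable (M \<Otimes>\<^sub>M M) (\<lambda>(s, \<tau>). b s \<tau> (x \<tau>))"
      proof (rule finite_measure.integrable_const_bound[OF finite_measure_pair_measure])
        show "AE z in M \<Otimes>\<^sub>M M. norm (case z of (s, \<tau>) \<Rightarrow> b s \<tau> (x \<tau>)) \<le> B"
        proof (rule AE_I2)
          fix z assume "z \<in> space (M \<Otimes>\<^sub>M M)"
          then have z: "fst z \<in> {\<alpha>..\<beta>}" "snd z \<in> {\<alpha>..\<beta>}" by (auto simp: space_pair_measure)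
          have "norm (b (fst z) (snd z) (x (snd z))) \<le> B"
            unfolding B_def by (rule local_bound(3)[OF z AC02_norm_le'[OF x z(2)]])
          then show "norm (case z of (s, \<tau>) \<Rightarrow> b s \<tau> (x \<tau>)) \<le> B" by (simp add: case_prod_beta)
        qed
      qed (use b_meas[OF xm] finite_measure_axioms in auto)
      have "(LINT \<tau>:{\<alpha>..t}|lebesgue. v t \<tau> (x \<tau>)) =
          primitive (\<lambda>s. (if s \<in> G then v s s (x s) else 0) + (\<integral>\<tau>. (if \<tau> \<in> G \<and> \<tau> \<le> s \<and> s \<le> \<beta> then d_t \<beta> v s \<tau> (x \<tau>) else 0) \<partial>M)) t"
        by (rule volterra_eq_primitive[OF G(2,3) v_diff_t vt_cont refl ai refl _ True])
          (use bi in \<open>simp_all only: b_def\<close>)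
      also have "\<dots> = primitive (integrand x) t"
        by (simp add: integrand_def[abs_def] a_def b_def)
      finally show ?thesis using True by (simp add: volterra_def V_def)
    qed
  qed
  show ?thesis by (rule diffeomorphism_in_cong[OF diffeomorphism_V eq AC02_linear(1)])
qed

end
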